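(* Let $p$ be an odd prime power, let $\lambda$ be any positive divisor of $(p-1)/2$, and put $d=(p-1)/(2\lambda)$. Then there exists an $(\mathbb{F}_{p}\times \mathbb{F}_{q},\mathbb{F}_{p}\times \{0\},p,\lambda)$-DF for every prime power $q$ with $\lambda(q-1)\equiv 0\pmod{p-1}$ and $q>Q(d,p-2)$.
   Context: For an additive group $G$ of order $g$ with a subgroup $N$ of order $n$, a $(G,N,k,\lambda)$ relative difference family (DF) is a multiset $[B_1,\dots,B_r]$ of $k$-subsets of $G$ such that the multiset $\bigcup_{i}[x-y: x,y\in B_i, x\neq y]$ contains every element of $G\setminus N$ exactly $\lambda$ times and no element of $N$. For positive integers $d,m$, $Q(d,m)=\frac{1}{4}\left(U+\sqrt{U^2+4d^{m-1}m}\right)^2$ where $U=\sum_{h=1}^m \binom{m}{h}(d-1)^h(h-1)$. *)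

theory Defs
  imports Complex_Main "HOL-Library.Multiset" "HOL-Library.Product_Plus"
    "HOL-Number_Theory.Cong" "HOL-Number_Theory.Prime_Powers"
begin

definition additive_subgroup :: "'g::group_add set \<Rightarrow> 'g set \<Rightarrow> bool" where
  "additive_subgroup N G \<longleftrightarrow>
     N \<subseteq> G \<and> 0 \<in> N \<and> (\<forall>x\<in>N. \<forall>y\<in>N. x + y \<in> N) \<and> (\<forall>x\<in>N. - x \<in> N)"

definition differences :: "'g::group_add set \<Rightarrow> 'g multiset" where
  "differences B = {# x - y. (x, y) \<in># mset_set {(x, y). x \<in> B \<and> y \<in> B \<and> x \<noteq> y} #}"

text \<open>
  A \<open>(G, N, k, \<lambda>)\<close> relative difference family. The group \<open>G\<close> is given as a finite subgroup of
  the additive group of the ambient type, so that \<open>G = UNIV\<close> is the ambient group itself.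
  The base blocks form a multiset, so repeated blocks are allowed.
\<close>

definition relative_difference_family ::
    "'g::group_add set \<Rightarrow> 'g set \<Rightarrow> nat \<Rightarrow> nat \<Rightarrow> 'g set multiset \<Rightarrow> bool" where
  "relative_difference_family G N k l Bs \<longleftrightarrow>
     finite G \<and> additive_subgroup G UNIV \<and> additive_subgroup N G \<and>
     (\<forall>B \<in># Bs. B \<subseteq> G \<and> card B = k) \<and>
     (\<forall>g \<in> G - N. count (\<Sum>B \<in># Bs. differences B) g = l) \<and>
     (\<forall>g \<in> N. g \<notin># (\<Sum>B \<in># Bs. differences B))"

definition U_bound :: "nat \<Rightarrow> nat \<Rightarrow> real" where
  "U_bound d m = (\<Sum>h = 1..m. real (m choose h) * (real d - 1) ^ h * (real h - 1))"

definition Q_bound :: "nat \<Rightarrow> nat \<Rightarrow> real" where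
  "Q_bound d m =
     1 / 4 * (U_bound d m + sqrt ((U_bound d m)\<^sup>2 + 4 * real d ^ (m - 1) * real m))\<^sup>2"

end

theory Submission
  imports Defs "HOL-Algebra.Algebraic_Closure_Type"
    "HOL-Number_Theory.Residues"
begin

text \<open>
  The blocks are the graphs \<open>{(x\<^sup>2, s F(x))}\<close> of an odd map \<open>F\<close> from the field of order \<open>p\<close> to that of
  order \<open>q\<close>, where \<open>s\<close> runs through representatives modulo \<open>\<plusminus>1\<close> of the nonzero \<open>d\<close>-th powers.
  Since \<open>x\<^sup>2 - y\<^sup>2 = g\<close> has \<open>p - 1\<close> solutions for \<open>g \<noteq> 0\<close> and oddness makes the differences symmetric, it
  suffices that for every \<open>g\<close> the classes of \<open>F(x) - F(y)\<close> modulo \<open>d\<close>-th powers, over the solutions of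
  \<open>x\<^sup>2 - y\<^sup>2 = g\<close> with \<open>x \<noteq> y\<close>, are equidistributed. Such classes are prescribed combinatorially, and the
  values of \<open>F\<close> are then chosen one after the other: each new value \<open>v\<close> is subject to at most \<open>p - 2\<close>
  conditions on the class of \<open>t - v\<close>, which can be met by expanding them in characters and using
  Weil's bound \<open>\<bar>\<Sum>\<^sub>x \<Prod>\<^sub>t \<chi>(t - x)\<^sup>e\<^sup>t\<bar> \<le> (h - 1) \<surd>q\<close> for \<open>h\<close> nontrivial factors.

  For Weil's bound, let \<open>A\<^sub>n\<close> be the sum of \<open>\<Prod>\<^sub>t \<chi>(f(t))\<^sup>e\<^sup>t\<close> over the monic polynomials \<open>f\<close> of degree \<open>n\<close>; it
  vanishes for \<open>n \<ge> h\<close>. Newton's identities relate the \<open>A\<^sub>n\<close> to the analogous character sums over the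
  fields of order \<open>q\<^sup>\<nu>\<close>, which are \<open>O(q\<^sup>\<nu>\<^sup>/\<^sup>2)\<close> by Stepanov's method. Hence \<open>\<Sum> A\<^sub>n z\<^sup>n\<close> has no zeros in
  \<open>\<bar>z\<bar> < 1 / \<surd>q\<close>, which bounds \<open>A\<^sub>1\<close>.
\<close>

text \<open>The case g = 0 shapes the colouring. Its pairs are (x, -x), with the class of 2 F(x), so
  the classes of F(x) = F(x) - F(0) must be balanced over x \<noteq> 0. But they are also the
  classes of the pairs (x, 0) and (0, x), which belong to g = x^2 and g = -x^2. Hence they are fixed
  beforehand, and the colouring for each g \<noteq> 0 has to extend a partial one. The class of y
  \<noteq> 0 is encoded as the d-th root of unity y^u with d u = q - 1. Here u is even because
  \<lambda> (q - 1) is a multiple of p - 1 = 2 \<lambda> d; so -1 is a d-th power, and F(x) - F(y)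
  and F(y) - F(x) share their class. With colours symmetric under (x, y) \<mapsto> (-x, -y), the
  conditions on F(-x) = -F(x) follow from those on F(x). The last pair \<plusminus>x meets only the
  p - 2 other arguments, hence p - 2 in \<open>Q_bound\<close>. Stepanov's method loses a constant
  factor, but the same one for all fields of order q^\<nu>; such a factor does not change the radius
  of convergence, which is all that the location of the zeros depends on.\<close>

hide_const (open) Polynomials.degree Coset.order Divisibility.prime


subsection \<open>Linear independence over function fields\<close>

text \<open>Supplies the coefficients of Stepanov's auxiliary polynomial. Induction on the
  equations: one with only zero coefficients is dropped, any other eliminates an unknown
  \<open>k\<close>, whose value is then solved for.\<close>

lemma homogeneous_system_nontrivial:
  fixes m :: "'e \<Rightarrow> 'i \<Rightarrow> 'a::field"
  assumes "finite E" "finite I" "card E < card I"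
  shows "\<exists>v. (\<exists>i\<in>I. v i \<noteq> 0) \<and> (\<forall>e\<in>E. (\<Sum>i\<in>I. m e i * v i) = 0)"
  using assms
proof (induction E arbitrary: I m rule: finite_induct)
  case empty
  then have "I \<noteq> {}" by auto
  then show ?case by (intro exI[of _ "\<lambda>_. 1"]) auto
next
  case (insert e E)
  show ?case
  proof (cases "\<forall>i\<in>I. m e i = 0")
    case True
    have "card E < card I" using insert.prems insert.hyps by simp
    from insert.IH[OF insert.prems(1) this, of m] obtain v where
      "\<exists>i\<in>I. v i \<noteq> 0" "\<forall>e\<in>E. (\<Sum>i\<in>I. m e i * v i) = 0" by blast
    with True show ?thesis by (intro exI[of _ v]) auto
  next
    case False
    then obtain k where k: "k \<in> I" "m e k \<noteq> 0" by blast
    define J where "J = I - {k}"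
    define m' where "m' = (\<lambda>e' i. m e' i - m e' k * m e i / m e k)"
    have J: "finite J" "I = insert k J" "k \<notin> J" using insert.prems k by (auto simp: J_def)
    have "card E < card J" using insert.prems insert.hyps k by (simp add: J_def)
    from insert.IH[OF J(1) this, of m'] obtain v where
      v: "\<exists>i\<in>J. v i \<noteq> 0" "\<forall>e'\<in>E. (\<Sum>i\<in>J. m' e' i * v i) = 0" by blast
    define S where "S = (\<Sum>i\<in>J. m e i * v i)"
    define w where "w = v(k := - S / m e k)"
    have w: "(\<Sum>i\<in>I. m e' i * w i) = (\<Sum>i\<in>J. m e' i * v i) - m e' k * S / m e k" for e'
    proof -
      have "(\<Sum>i\<in>J. m e' i * w i) = (\<Sum>i\<in>J. m e' i * v i)"
        using J(3) by (intro sum.cong) (auto simp: w_def)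
      then show ?thesis using J by (simp add: w_def)
    qed
    have 1: "(\<Sum>i\<in>I. m e i * w i) = 0" unfolding w using k by (simp add: S_def)
    have 2: "(\<Sum>i\<in>I. m e' i * w i) = 0" if "e' \<in> E" for e'
    proof -
      have "m e' k * S / m e k = (\<Sum>i\<in>J. m e' k * m e i / m e k * v i)"
        by (simp add: S_def sum_distrib_left sum_divide_distrib mult_ac)
      then have "(\<Sum>i\<in>I. m e' i * w i) = (\<Sum>i\<in>J. m' e' i * v i)"
        unfolding w by (simp add: m'_def left_diff_distrib sum_subtractf)
      then show ?thesis using v that by simp
    qed
    have 3: "\<exists>i\<in>I. w i \<noteq> 0" using v(1) J by (auto simp: w_def)
    show ?thesis using 1 2 3 by (intro exI[of _ w]) auto
  qed
qed

section \<open>Applying a ring homomorphism to the coefficients of a polynomial\<close>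

lemma map_poly_hom_add:
  fixes h :: "'a::comm_semiring_0 \<Rightarrow> 'b::comm_semiring_0"
  assumes "h 0 = 0" "\<And>a b. h (a + b) = h a + h b"
  shows "map_poly h (p + q) = map_poly h p + map_poly h q"
  by (intro poly_eqI) (simp add: coeff_map_poly assms)

lemma map_poly_hom_mult:
  fixes h :: "'a::comm_semiring_0 \<Rightarrow> 'b::comm_semiring_0"
  assumes h: "h 0 = 0" "\<And>a b. h (a + b) = h a + h b" "\<And>a b. h (a * b) = h a * h b"
  shows "map_poly h (p * q) = map_poly h p * map_poly h q"
proof (intro poly_eqI)
  fix n
  have "h (sum f A) = (\<Sum>x\<in>A. h (f x))" for f and A :: "nat set"
    by (induction A rule: infinite_finite_induct) (auto simp: h)
  then show "coeff (map_poly h (p * q)) n = coeff (map_poly h p * map_poly h q) n"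
    by (simp add: coeff_map_poly h coeff_mult)
qed

lemma map_poly_hom_prod:
  fixes h :: "'a::comm_semiring_1 \<Rightarrow> 'b::comm_semiring_1"
  assumes h: "h 0 = 0" "h 1 = 1" "\<And>a b. h (a + b) = h a + h b" "\<And>a b. h (a * b) = h a * h b"
  shows "map_poly h (prod f A) = (\<Prod>x\<in>A. map_poly h (f x))"
  by (induction A rule: infinite_finite_induct)
    (auto simp: map_poly_hom_mult[OF h(1,3,4)] map_poly_1' h(2))

lemma poly_map_poly_hom:
  fixes h :: "'a::comm_semiring_0 \<Rightarrow> 'b::comm_semiring_0"
  assumes h: "h 0 = 0" "\<And>a b. h (a + b) = h a + h b" "\<And>a b. h (a * b) = h a * h b"
  shows "poly (map_poly h p) (h x) = h (poly p x)"
  by (induction p) (auto simp: map_poly_pCons h)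

lemmas map_poly_to_ac_add = map_poly_hom_add[of to_ac, OF to_ac_0 to_ac_add]
lemmas map_poly_to_ac_mult = map_poly_hom_mult[of to_ac, OF to_ac_0 to_ac_add to_ac_mult]
lemmas poly_map_poly_to_ac = poly_map_poly_hom[of to_ac, OF to_ac_0 to_ac_add to_ac_mult]

lemma degree_map_poly_to_ac [simp]: "degree (map_poly to_ac p) = degree p"
  by (rule degree_map_poly) simp

lemma map_poly_to_ac_eq_0_iff [simp]: "map_poly to_ac p = 0 \<longleftrightarrow> p = 0"
  by (rule map_poly_eq_0_iff) auto

lemma to_fract_power: "to_fract (x ^ n) = to_fract x ^ n"
  by (induction n) auto

lemma order_power_poly:
  fixes p :: "'a::field poly"
  assumes "p \<noteq> 0"
  shows "order x (p ^ n) = n * order x p"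
  using assms by (induction n) (auto simp: order_mult)

text \<open>Euclid's argument: the product of all X - a, plus 1, would have no root.\<close>

lemma infinite_UNIV_alg_closed: "infinite (UNIV :: 'a::alg_closed_field set)"
proof
  assume fin: "finite (UNIV :: 'a set)"
  define p :: "'a poly" where "p = (\<Prod>a\<in>UNIV. [:-a, 1:]) + 1"
  have "degree (\<Prod>a\<in>(UNIV::'a set). [:-a, 1:]) = card (UNIV :: 'a set)"
    by (subst degree_prod_eq_sum_degree) auto
  then have "degree p > 0" unfolding p_def using fin
    by (subst degree_add_eq_left) (auto simp: card_gt_0_iff)
  then obtain x where "poly p x = 0" using alg_closed_imp_poly_has_root by blast
  moreover have "poly p x = 1" unfolding p_def using fin by (auto simp: poly_prod prod_zero_iff)
  ultimately show False by simp
qed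

text \<open>
  The constant term of the minimal polynomial of \<open>\<tau>\<close> over \<open>K(X)\<close> is, up to sign, a product of
  \<open>r\<close> conjugates, so its \<open>s\<close>-th power is \<open>\<plusminus>f\<^sup>-\<^sup>r\<close>; comparing orders of vanishing forces \<open>s\<close> to
  divide all multiples \<open>r * order t f\<close>.
\<close>

lemma kummer_independent:
  fixes f :: "'k::field poly" and \<tau> :: "'k poly fract alg_closure" and H :: "nat \<Rightarrow> 'k poly"
  assumes f: "f \<noteq> 0" and s: "s > 0"
    and ord: "\<And>r. 0 < r \<Longrightarrow> r < s \<Longrightarrow> \<exists>t. \<not> s dvd r * order t f"
    and tau: "\<tau> ^ s * to_ac (to_fract f) = 1"
    and rel: "(\<Sum>j<s. to_ac (to_fract (H j)) * \<tau> ^ j) = 0"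
    and j: "j < s"
  shows "H j = 0"
proof (rule ccontr)
  assume Hj: "H j \<noteq> 0"
  let ?\<phi> = "\<lambda>p :: 'k poly fract poly. poly (map_poly to_ac p) \<tau>"
  define P where "P = (\<Sum>j<s. monom (to_fract (H j)) j)"
  have coeff_P: "coeff P i = (if i < s then to_fract (H i) else 0)" for i
    by (simp add: P_def coeff_sum sum.delta)
  have "P \<noteq> 0" using coeff_P[of j] Hj j by force
  have "map_poly to_ac P = (\<Sum>j<s. monom (to_ac (to_fract (H j))) j)"
    by (intro poly_eqI) (simp add: coeff_map_poly coeff_P coeff_sum sum.delta)
  then have P\<tau>: "?\<phi> P = 0" using rel by (simp add: poly_sum poly_monom)
  have degP: "degree P < s"
    using \<open>P \<noteq> 0\<close> coeff_P leading_coeff_0_iff[of P] by (metis (no_types))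
  \<comment> \<open>Up to a scalar, \<open>G\<close> is the minimal polynomial of \<tau> over K(X);
    the given relation forces its degree r below s.\<close>
  define G where "G = arg_min degree (\<lambda>p. p \<noteq> 0 \<and> ?\<phi> p = 0)"
  have G: "G \<noteq> 0" "?\<phi> G = 0" and Gmin: "\<And>p. p \<noteq> 0 \<Longrightarrow> ?\<phi> p = 0 \<Longrightarrow> degree G \<le> degree p"
    using arg_min_nat_lemma[of "\<lambda>p. p \<noteq> 0 \<and> ?\<phi> p = 0" P degree] \<open>P \<noteq> 0\<close> P\<tau>
    unfolding G_def by blast+
  define r where "r = degree G"
  have "r < s" using Gmin[OF \<open>P \<noteq> 0\<close> P\<tau>] degP by (simp add: r_def)
  have "r > 0"
  proof (rule ccontr)
    assume "\<not> r > 0"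
    then obtain c where "G = [:c:]" by (auto simp: r_def elim: degree_eq_zeroE)
    then show False using G by (simp add: map_poly_pCons split: if_splits)
  qed
  define a where "a = 1 / to_fract f"
  have tf: "to_fract f \<noteq> 0" using f by simp
  have tau': "\<tau> ^ s = to_ac a" using tau tf by (simp add: a_def field_simps)
  \<comment> \<open>\<open>G\<close> divides X^s - a, so every conjugate of \<tau> has s-th power a
    as well. This determines the s-th power of the constant term of \<open>G\<close>.\<close>
  define E where "E = monom 1 s - [:a:]"
  have mapE: "map_poly to_ac E = monom 1 s - [:to_ac a:]"
    by (intro poly_eqI) (simp add: E_def coeff_map_poly coeff_pCons split: nat.splits)
  have "?\<phi> (E mod G) = 0"
  proof -
    have "?\<phi> E = 0" by (simp add: mapE poly_monom tau')
    moreover have "E = G * (E div G) + E mod G" by simp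
    then have "?\<phi> E = ?\<phi> (G * (E div G) + E mod G)" by simp
    then have "?\<phi> E = ?\<phi> G * ?\<phi> (E div G) + ?\<phi> (E mod G)"
      by (simp only: map_poly_to_ac_add map_poly_to_ac_mult poly_add poly_mult)
    ultimately show ?thesis using G by simp
  qed
  then have "E mod G = 0"
    using Gmin[of "E mod G"] degree_mod_less[of G E] G \<open>r > 0\<close> by (force simp: r_def)
  then have "G dvd E" by (simp add: mod_eq_0_iff_dvd)
  then have dvd: "map_poly to_ac G dvd map_poly to_ac E"
    by (auto simp: map_poly_to_ac_mult elim!: dvdE)
  obtain A where A: "size A = r" "map_poly to_ac G = smult (lead_coeff (map_poly to_ac G)) (\<Prod>x\<in>#A. [:-x, 1:])"
    using alg_closed_imp_factorization[of "map_poly to_ac G"] G by (auto simp: r_def)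
  have pow: "x ^ s = to_ac a" if "x \<in># A" for x
  proof -
    have "[:-x, 1:] dvd map_poly to_ac G"
      by (subst A(2)) (intro dvd_smult dvd_prod_mset, use that in auto)
    then have "poly (map_poly to_ac E) x = 0"
      using dvd by (meson dvd_trans poly_eq_0_iff_dvd)
    then show ?thesis by (simp add: mapE poly_monom)
  qed
  define u where "u = coeff G 0 / lead_coeff G"
  have "to_ac (coeff G 0) = poly (map_poly to_ac G) 0"
    by (simp add: poly_0_coeff_0 coeff_map_poly)
  also have "\<dots> = to_ac (lead_coeff G) * (\<Prod>x\<in>#A. - x)"
    by (subst A(2)) (simp add: coeff_map_poly poly_prod_mset)
  finally have u: "to_ac u = (\<Prod>x\<in>#A. - x)" using G by (simp add: u_def field_simps)
  have "(\<Prod>x\<in>#B. - x) ^ s = ((-1) ^ s * to_ac a) ^ size B" if "B \<subseteq># A" for B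
    using that
  proof (induction B)
    case (add x B)
    then have "x \<in># A" "B \<subseteq># A" by (auto dest: mset_subset_eq_insertD)
    have "(- x) ^ s = (-1) ^ s * to_ac a" using pow[OF \<open>x \<in># A\<close>] by (metis power_minus)
    moreover have "(\<Prod>x\<in>#add_mset x B. - x) ^ s = (- x) ^ s * (\<Prod>x\<in>#B. - x) ^ s"
      by (simp only: image_mset_add_mset prod_mset.add_mset power_mult_distrib)
    ultimately show ?case using add.IH[OF \<open>B \<subseteq># A\<close>] by simp
  qed simp
  from this[of A] have "to_ac (u ^ s) = to_ac (((-1) ^ s * a) ^ r)" using u A by simp
  then have us: "u ^ s = ((-1) ^ s * a) ^ r" by (simp only: to_ac_eq_iff)
  obtain n d where nd: "u = to_fract n / to_fract d" "d \<noteq> 0"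
    by (metis Fract_conv_to_fract Fract_cases)
  have "u \<noteq> 0" using us f s by (auto simp: a_def power_0_left)
  then have "n \<noteq> 0" using nd by auto
  \<comment> \<open>Clearing denominators moves the identity to K[X], where orders of vanishing can
    be compared; modulo s only that of f^r survives.\<close>
  have "(to_fract n) ^ s * to_fract f ^ r = ((-1) ^ s) ^ r * to_fract d ^ s"
    using us nd(2) tf by (simp add: nd(1) a_def power_divide power_mult_distrib field_simps)
  then have "to_fract (n ^ s * f ^ r) = to_fract (((-1) ^ s) ^ r * d ^ s)"
    by (simp add: to_fract_power to_fract_uminus)
  then have eq: "n ^ s * f ^ r = ((-1) ^ s) ^ r * d ^ s" by (simp only: to_fract_eq_iff)
  obtain t where t: "\<not> s dvd r * order t f" using ord[OF \<open>0 < r\<close> \<open>r < s\<close>] by blast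
  have "order t (n ^ s * f ^ r) = s * order t n + r * order t f"
    using \<open>n \<noteq> 0\<close> f by (simp add: order_mult order_power_poly)
  moreover have "order t (((-1) ^ s) ^ r * d ^ s) = s * order t d"
  proof -
    have "((-1 :: 'k poly) ^ s) ^ r = 1 \<or> ((-1 :: 'k poly) ^ s) ^ r = -1"
      by (metis neg_one_even_power neg_one_odd_power power_mult)
    then show ?thesis using nd(2) by (auto simp: order_mult order_power_poly)
  qed
  ultimately have "s * order t n + r * order t f = s * order t d" using eq by simp
  then show False using t by (metis dvd_add_right_iff dvd_triv_left)
qed

section \<open>Separable polynomials and roots of unity\<close>

lemma card_roots_separable:
  fixes p :: "'k::alg_closed_field poly"
  assumes "p \<noteq> 0" and sep: "\<And>x. poly p x = 0 \<Longrightarrow> poly (pderiv p) x \<noteq> 0"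
  shows "card {x. poly p x = 0} = degree p"
proof -
  obtain A where A: "size A = degree p" "p = smult (lead_coeff p) (\<Prod>x\<in>#A. [:-x, 1:])"
    using alg_closed_imp_factorization[OF assms(1)] by blast
  have roots: "{x. poly p x = 0} = set_mset A"
    by (subst A(2)) (use assms(1) in \<open>auto simp: poly_prod_mset prod_mset_zero_iff\<close>)
  have "count A x \<le> 1" for x
  proof (rule ccontr)
    assume "\<not> count A x \<le> 1"
    then have "{#x, x#} \<subseteq># A" by (auto simp: subseteq_mset_def)
    then obtain B where B: "A = {#x, x#} + B" by (metis subset_mset.le_iff_add)
    define q where "q = smult (lead_coeff p) (\<Prod>x\<in>#B. [:-x, 1:])"
    define r where "r = [:-x, 1:]"
    have "p = r * (r * q)"
      by (subst A(2)) (simp add: B q_def mult_ac r_def)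
    moreover have "poly r x = 0" by (simp add: r_def)
    ultimately have "poly (pderiv p) x = 0 \<and> poly p x = 0" by (simp add: pderiv_mult)
    then show False using sep by blast
  qed
  moreover have "count A x \<ge> 1" if "x \<in># A" for x using that by (simp add: Suc_le_eq)
  ultimately have "(\<Sum>x\<in>set_mset A. count A x) = (\<Sum>x\<in>set_mset A. 1)"
    by (intro sum.cong) (auto intro: antisym)
  then show ?thesis using A(1) roots by (simp add: size_multiset_overloaded_eq)
qed

lemma card_roots_of_unity:
  assumes "of_nat s \<noteq> (0 :: 'k::alg_closed_field)"
  shows "card {z :: 'k. z ^ s = 1} = s"
proof -
  have s: "s > 0" using assms by (cases s) auto
  define p :: "'k poly" where "p = monom 1 s - 1"
  have deg: "degree p = s" unfolding p_def
    using degree_add_eq_left[of "-1" "monom (1::'k) s"] s by (simp add: degree_monom_eq)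
  have "card {x. poly p x = 0} = degree p"
    by (rule card_roots_separable)
      (use deg s assms in \<open>auto simp: p_def pderiv_diff pderiv_monom poly_monom power_0_left\<close>)
  then show ?thesis by (simp add: deg) (simp add: p_def poly_monom)
qed

lemma card_fixed_points_power:
  assumes "of_nat Q = (0 :: 'k::alg_closed_field)" "Q > 1"
  shows "card {z :: 'k. z ^ Q = z} = Q"
proof -
  define p :: "'k poly" where "p = monom 1 Q + [:0, -1:]"
  have deg: "degree p = Q" unfolding p_def
    using degree_add_eq_left[of "[:0, - 1:]" "monom (1::'k) Q"] assms by (simp add: degree_monom_eq)
  have "card {x. poly p x = 0} = degree p"
    by (rule card_roots_separable)
      (use deg assms in \<open>auto simp: p_def pderiv_add pderiv_monom poly_monom pderiv_pCons\<close>)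
  then show ?thesis by (simp add: deg) (simp add: p_def poly_monom)
qed

section \<open>Norms along s-th roots of unity\<close>

definition kummer_twist :: "nat \<Rightarrow> (nat \<Rightarrow> 'a::comm_ring_1) \<Rightarrow> 'a \<Rightarrow> 'a poly" where
  "kummer_twist s H \<zeta> = (\<Sum>j<s. monom (\<zeta> ^ j * H j) j)"

text \<open>The twists are the images of the sum of the \<open>H j\<close> T^j under T \<mapsto>
  \<zeta> T. Over the group of all s-th roots of unity their product is the norm along T^s, a
  polynomial in T^s, so only the coefficients at multiples of s are kept.\<close>

definition kummer_norm :: "nat \<Rightarrow> (nat \<Rightarrow> 'a::comm_ring_1) \<Rightarrow> 'a set \<Rightarrow> nat \<Rightarrow> 'a" where
  "kummer_norm s H Z k = coeff (\<Prod>\<zeta>\<in>Z. kummer_twist s H \<zeta>) (s * k)"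

lemma coeff_kummer_twist: "coeff (kummer_twist s H \<zeta>) j = (if j < s then \<zeta> ^ j * H j else 0)"
  by (simp add: kummer_twist_def coeff_sum sum.delta)

text \<open>Multiplication by \<zeta> permutes Z, so T \<mapsto> \<zeta> T fixes the product; but it
  multiplies the coefficient of T^k by \<zeta>^k \<noteq> 1.\<close>

lemma kummer_twist_prod_coeff_eq_0:
  fixes H :: "nat \<Rightarrow> 'a::idom"
  assumes Z: "finite Z" "\<And>\<zeta> \<eta>. \<zeta> \<in> Z \<Longrightarrow> \<eta> \<in> Z \<Longrightarrow> \<eta> * \<zeta> \<in> Z" "0 \<notin> Z"
    and \<zeta>: "\<zeta> \<in> Z" "\<zeta> ^ k \<noteq> 1"
  shows "coeff (\<Prod>\<zeta>\<in>Z. kummer_twist s H \<zeta>) k = 0"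
proof -
  let ?N = "\<Prod>\<zeta>\<in>Z. kummer_twist s H \<zeta>"
  have tw: "pcompose (kummer_twist s H \<eta>) [:0, \<zeta>:] = kummer_twist s H (\<eta> * \<zeta>)" for \<eta>
    by (intro poly_eqI) (simp add: coeff_pcompose_linear coeff_kummer_twist power_mult_distrib)
  have inj: "inj_on (\<lambda>\<eta>. \<eta> * \<zeta>) Z" using \<zeta> Z by (auto simp: inj_on_def)
  moreover have "(\<lambda>\<eta>. \<eta> * \<zeta>) ` Z \<subseteq> Z" using Z \<zeta> by auto
  ultimately have img: "(\<lambda>\<eta>. \<eta> * \<zeta>) ` Z = Z" using endo_inj_surj[OF Z(1)] by blast
  have "pcompose ?N [:0, \<zeta>:] = (\<Prod>\<eta>\<in>Z. kummer_twist s H (\<eta> * \<zeta>))"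
    by (simp add: pcompose_prod tw)
  also have "\<dots> = (\<Prod>\<eta>\<in>(\<lambda>\<eta>. \<eta> * \<zeta>) ` Z. kummer_twist s H \<eta>)"
    by (subst prod.reindex[OF inj]) simp
  finally have "pcompose ?N [:0, \<zeta>:] = ?N" by (simp add: img)
  then have "coeff ?N k = \<zeta> ^ k * coeff ?N k" by (metis coeff_pcompose_linear)
  then show ?thesis using \<zeta> by (metis mult_cancel_right1)
qed

lemma poly_eq_sum_coeff:
  fixes p :: "'a::comm_ring_1 poly"
  assumes "degree p \<le> n"
  shows "poly p x = (\<Sum>k\<le>n. coeff p k * x ^ k)"
  unfolding poly_altdef
  by (rule sum.mono_neutral_left) (use assms in \<open>auto intro: le_degree\<close>)

text \<open>The product has degree at most s (s - 1) in T and involves only multiples of s, so the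
  indices k < s cover it. The homomorphism \<phi> allows evaluation both in K[X] and in the
  algebraic closure of K(X).\<close>

lemma kummer_norm_eval:
  fixes H :: "nat \<Rightarrow> 'a::idom" and \<phi> :: "'a \<Rightarrow> 'b::comm_ring_1"
  assumes \<phi>: "\<phi> 0 = 0" "\<phi> 1 = 1" "\<And>a b. \<phi> (a + b) = \<phi> a + \<phi> b" "\<And>a b. \<phi> (a * b) = \<phi> a * \<phi> b"
    and Z: "finite Z" "card Z = s" "\<And>\<zeta> \<eta>. \<zeta> \<in> Z \<Longrightarrow> \<eta> \<in> Z \<Longrightarrow> \<eta> * \<zeta> \<in> Z" "0 \<notin> Z"
    and Zs: "\<And>k. \<not> s dvd k \<Longrightarrow> \<exists>\<zeta>\<in>Z. \<zeta> ^ k \<noteq> 1" and s: "s > 0"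
  shows "(\<Sum>k<s. \<phi> (kummer_norm s H Z k) * T ^ (s * k)) = (\<Prod>\<zeta>\<in>Z. \<Sum>j<s. \<phi> \<zeta> ^ j * \<phi> (H j) * T ^ j)"
proof -
  let ?N = "\<Prod>\<zeta>\<in>Z. kummer_twist s H \<zeta>"
  have pow: "\<phi> (a ^ n) = \<phi> a ^ n" for a n by (induction n) (auto simp: \<phi>)
  have tw: "poly (map_poly \<phi> (kummer_twist s H \<zeta>)) T = (\<Sum>j<s. \<phi> \<zeta> ^ j * \<phi> (H j) * T ^ j)" for \<zeta>
  proof -
    have "map_poly \<phi> (kummer_twist s H \<zeta>) = (\<Sum>j<s. monom (\<phi> \<zeta> ^ j * \<phi> (H j)) j)"
      by (intro poly_eqI) (simp add: coeff_map_poly \<phi> coeff_kummer_twist coeff_sum sum.delta pow)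
    then show ?thesis by (simp add: poly_sum poly_monom)
  qed
  have "degree (kummer_twist s H \<zeta>) \<le> s - 1" for \<zeta>
    by (intro degree_le) (use s in \<open>auto simp: coeff_kummer_twist\<close>)
  then have "degree ?N \<le> (\<Sum>\<zeta>\<in>Z. s - 1)"
    by (intro order.trans[OF degree_prod_sum_le[OF Z(1)]] sum_mono) (simp add: o_def)
  then have degN: "degree ?N \<le> s * (s - 1)" using Z by simp
  have "(\<Prod>\<zeta>\<in>Z. \<Sum>j<s. \<phi> \<zeta> ^ j * \<phi> (H j) * T ^ j) = poly (map_poly \<phi> ?N) T"
    by (simp add: map_poly_hom_prod[OF \<phi>] poly_prod tw)
  also have "\<dots> = (\<Sum>k\<le>s * (s - 1). \<phi> (coeff ?N k) * T ^ k)"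
  proof -
    have "degree (map_poly \<phi> ?N) \<le> s * (s - 1)"
      using degN map_poly_degree_leq[of \<phi> ?N] by linarith
    then show ?thesis by (simp add: poly_eq_sum_coeff[of _ "s * (s - 1)"] coeff_map_poly \<phi>)
  qed
  also have "\<dots> = (\<Sum>k\<in>(\<lambda>k. s * k) ` {..<s}. \<phi> (coeff ?N k) * T ^ k)"
  proof (rule sum.mono_neutral_right)
    show "(\<lambda>k. s * k) ` {..<s} \<subseteq> {..s * (s - 1)}" by (auto intro!: mult_left_mono)
    show "\<forall>k\<in>{..s * (s - 1)} - (\<lambda>k. s * k) ` {..<s}. \<phi> (coeff ?N k) * T ^ k = 0"
    proof
      fix k assume k: "k \<in> {..s * (s - 1)} - (\<lambda>k. s * k) ` {..<s}"
      have "\<not> s dvd k"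
      proof
        assume "s dvd k"
        then obtain m where m: "k = s * m" by blast
        with k s have "m \<le> s - 1" by auto
        with s have "m < s" by linarith
        with m k show False by auto
      qed
      then obtain \<zeta> where "\<zeta> \<in> Z" "\<zeta> ^ k \<noteq> 1" using Zs by blast
      then have "coeff ?N k = 0" by (intro kummer_twist_prod_coeff_eq_0[where \<zeta> = \<zeta>] Z)
      then show "\<phi> (coeff ?N k) * T ^ k = 0" by (simp add: \<phi>)
    qed
  qed auto
  also have "\<dots> = (\<Sum>k<s. \<phi> (kummer_norm s H Z k) * T ^ (s * k))"
    by (subst sum.reindex) (use s in \<open>auto simp: inj_on_def kummer_norm_def\<close>)
  finally show ?thesis by simp
qed

text \<open>A bound on the X-degree of a polynomial in two variables: the coefficients are
  polynomials in X, and the outer variable Z will be set to X^Q or to a constant.\<close>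

definition coeff_degree_le :: "nat \<Rightarrow> 'a::comm_ring_1 poly poly \<Rightarrow> bool" where
  "coeff_degree_le n w \<longleftrightarrow> (\<forall>i. degree (coeff w i) \<le> n)"

lemma coeff_degree_le_mult:
  assumes "coeff_degree_le m v" "coeff_degree_le n w"
  shows "coeff_degree_le (m + n) (v * w)"
  unfolding coeff_degree_le_def coeff_mult
  by (intro allI degree_sum_le) 
    (use assms in \<open>auto intro!: order.trans[OF degree_mult_le] add_mono simp: coeff_degree_le_def\<close>)

lemma coeff_degree_le_sum:
  assumes "\<And>i. i \<in> I \<Longrightarrow> coeff_degree_le n (f i)" "finite I"
  shows "coeff_degree_le n (sum f I)"
  unfolding coeff_degree_le_def coeff_sum
  by (intro allI degree_sum_le) (use assms in \<open>auto simp: coeff_degree_le_def\<close>)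

lemma coeff_degree_le_power:
  assumes "coeff_degree_le m v"
  shows "coeff_degree_le (k * m) (v ^ k)"
  by (induction k) (auto intro: coeff_degree_le_mult[OF assms] simp: coeff_degree_le_def[of 0])

lemma coeff_degree_le_const: "degree p \<le> n \<Longrightarrow> coeff_degree_le n [:p:]"
  by (auto simp: coeff_degree_le_def coeff_pCons split: nat.splits)

lemma coeff_degree_le_kummer_norm:
  fixes H :: "nat \<Rightarrow> 'a::idom poly poly"
  assumes H: "\<And>j. j < s \<Longrightarrow> coeff_degree_le n (H j)" and Z: "\<And>\<zeta>. \<zeta> \<in> Z \<Longrightarrow> coeff_degree_le 0 \<zeta>" "finite Z"
  shows "coeff_degree_le (card Z * n) (kummer_norm s H Z k)"
proof -
  have "\<forall>k. coeff_degree_le (card Z * n) (coeff (\<Prod>\<zeta>\<in>Z. kummer_twist s H \<zeta>) k)"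
    using Z(2,1)
  proof (induction Z rule: finite_induct)
    case empty
    then show ?case by (auto simp: coeff_degree_le_def coeff_1)
  next
    case (insert \<zeta> Z)
    have "coeff_degree_le n (coeff (kummer_twist s H \<zeta>) j)" for j
      using coeff_degree_le_mult[OF coeff_degree_le_power[of 0 \<zeta> j] H[of j]] insert.prems
      by (auto simp: coeff_kummer_twist) (auto simp: coeff_degree_le_def)
    then show ?case using insert
      by (auto simp: coeff_mult intro!: coeff_degree_le_sum coeff_degree_le_mult)
  qed
  then show ?thesis by (simp add: kummer_norm_def)
qed

text \<open>Substituting \<open>X\<^sup>Q\<close> for the outer variable places the coefficients, all of degree
  below \<open>Q\<close>, into disjoint blocks.\<close>

lemma poly_monom_eq_0_imp:
  fixes w :: "'a::idom poly poly"
  assumes "\<And>i. degree (coeff w i) < Q" and "poly w (monom 1 Q) = 0"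
  shows "w = 0"
proof (rule ccontr)
  assume "w \<noteq> 0"
  define n where "n = degree w"
  have ex: "(\<Sum>i\<le>n. coeff w i * monom 1 (Q * i)) = 0"
    using assms(2) by (simp add: poly_altdef monom_power n_def)
  have lt: "coeff (coeff w i) j = 0" if "j \<ge> Q" for i j
    using assms(1)[of i] that by (intro coeff_eq_0) simp
  have "coeff (coeff w n) j = 0" for j
  proof (cases "j < Q")
    case True
    have "coeff (\<Sum>i\<le>n. coeff w i * monom 1 (Q * i)) (Q * n + j) =
        (\<Sum>i\<le>n. coeff (coeff w i) (Q * n + j - Q * i))"
      by (simp add: coeff_sum mult.commute[of _ "monom 1 _"] coeff_monom_mult)
        (intro sum.cong refl, auto simp: trans_le_add1 not_le dest: mult_le_mono2[of _ n Q])
    also have "\<dots> = (\<Sum>i\<in>{n}. coeff (coeff w i) (Q * n + j - Q * i))"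
    proof (rule sum.mono_neutral_right)
      show "\<forall>i\<in>{..n} - {n}. coeff (coeff w i) (Q * n + j - Q * i) = 0"
      proof
        fix i assume "i \<in> {..n} - {n}"
        then have "Suc i \<le> n" by auto
        then have "Q * Suc i \<le> Q * n" by (rule mult_left_mono) simp
        then show "coeff (coeff w i) (Q * n + j - Q * i) = 0" by (intro lt) simp
      qed
    qed auto
    finally show ?thesis using ex by simp
  qed (use lt in auto)
  then have "coeff w n = 0" by (intro poly_eqI) simp
  then show False using \<open>w \<noteq> 0\<close> by (simp add: n_def)
qed


text \<open>Otherwise all s roots of X^s - 1 would be roots of X^m - 1, where m =
  \<open>k mod s\<close> satisfies 0 < m < s.\<close>

lemma exists_root_of_unity_power_neq_1:
  assumes s: "of_nat s \<noteq> (0 :: 'k::alg_closed_field)" and k: "\<not> s dvd k"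
  shows "\<exists>z::'k. z ^ s = 1 \<and> z ^ k \<noteq> 1"
proof (rule ccontr)
  assume *: "\<not> ?thesis"
  have "s > 0" using s by (cases s) auto
  define m where "m = k mod s"
  have m: "0 < m" "m < s" using k \<open>s > 0\<close> by (auto simp: m_def mod_greater_zero_iff_not_dvd)
  define p :: "'k poly" where "p = monom 1 m + (-1)"
  have deg: "degree p = m" unfolding p_def
    using degree_add_eq_left[of "-1" "monom (1::'k) m"] m by (simp add: degree_monom_eq)
  then have "p \<noteq> 0" using m by auto
  have "{z :: 'k. z ^ s = 1} \<subseteq> {z. poly p z = 0}"
  proof
    fix z :: 'k assume "z \<in> {z. z ^ s = 1}"
    then have z: "z ^ s = 1" by simp
    then have "1 = z ^ k" using * by auto
    also have "\<dots> = (z ^ s) ^ (k div s) * z ^ m"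
      unfolding m_def by (metis power_add power_mult mult_div_mod_eq)
    finally show "z \<in> {z. poly p z = 0}" using z by (simp add: p_def poly_monom)
  qed
  then have "s \<le> card {z. poly p z = 0}"
    using card_mono[OF poly_roots_finite[OF \<open>p \<noteq> 0\<close>]] card_roots_of_unity[OF s] by metis
  also have "\<dots> \<le> m" using card_poly_roots_bound[OF \<open>p \<noteq> 0\<close>] deg by simp
  finally show False using m by simp
qed

text \<open>
  The norm of \<open>\<Sum>j. H j (X, Z) T\<^sup>j\<close> along \<open>T\<^sup>s f(X) = f(Z)\<close> is a polynomial in \<open>X, Z\<close> of
  \<open>X\<close>-degree below \<open>Q\<close> that vanishes at \<open>Z = X\<^sup>Q\<close>, where \<open>T = f\<^sup>(\<^sup>Q\<^sup>-\<^sup>1\<^sup>)\<^sup>/\<^sup>s\<close> is a solution; hence it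
  vanishes identically, and specialising \<open>Z\<close> to constants gives relations over \<open>K(X)\<close>.
\<close>

lemma stepanov_independent:
  fixes f :: "'k::alg_closed_field poly" and h :: "nat \<Rightarrow> nat \<Rightarrow> 'k poly"
  assumes f: "f \<noteq> 0" and s: "of_nat s \<noteq> (0 :: 'k)"
    and ord: "\<And>r. 0 < r \<Longrightarrow> r < s \<Longrightarrow> \<exists>t. \<not> s dvd r * order t f"
    and frob: "f ^ Q = pcompose f (monom 1 Q)" and c: "c * s = Q - 1"
    and deg: "\<And>j b. j < s \<Longrightarrow> b < B \<Longrightarrow> degree (h j b) < A"
    and Q: "s * A + s * degree f \<le> Q"
    and rel: "(\<Sum>j<s. \<Sum>b<B. h j b * monom 1 (Q * b) * f ^ (c * j)) = 0"
    and jb: "j < s" "b < B"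
  shows "h j b = 0"
proof -
  have "s > 0" using s by (cases s) auto
  have "A > 0" using deg[OF jb] by simp
  then have "Q > 0" using Q \<open>s > 0\<close> by (metis add_gr_0 gr0I mult_is_0 not_less0 le_zero_eq)
  \<comment> \<open>The factor X^(Q b) of the relation becomes Z^b.\<close>
  define H where "H = (\<lambda>j. \<Sum>b<B. monom (h j b) b)"
  have coeff_H: "coeff (H j) b = (if b < B then h j b else 0)" for j b
    by (simp add: H_def coeff_sum sum.delta)
  define Z :: "'k poly poly set" where "Z = (\<lambda>z. [:[:z:]:]) ` {z. z ^ s = 1}"
  have injZ: "inj_on (\<lambda>z::'k. [:[:z:]:]) {z. z ^ s = 1}" by (auto simp: inj_on_def)
  have cardZ: "card Z = s"
    unfolding Z_def card_image[OF injZ] by (rule card_roots_of_unity[OF s])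
  have finZ: "finite Z" using cardZ \<open>s > 0\<close> by (metis card.infinite less_numeral_extra(3))
  have closedZ: "\<eta> * \<zeta> \<in> Z" if "\<zeta> \<in> Z" "\<eta> \<in> Z" for \<zeta> \<eta>
    using that by (auto simp: Z_def power_mult_distrib intro!: image_eqI)
  have "0 \<notin> Z" using \<open>s > 0\<close> by (auto simp: Z_def power_0_left)
  have powc: "[:[:z:]:] ^ k = [:[:z ^ k:]:]" for z :: 'k and k by (induction k) (auto simp: one_pCons)
  have Zs: "\<exists>\<zeta>\<in>Z. \<zeta> ^ k \<noteq> 1" if "\<not> s dvd k" for k
    using exists_root_of_unity_power_neq_1[OF s that] by (auto simp: Z_def powc one_pCons)
  define F where "F = map_poly (\<lambda>a. [:a:]) f"
  have polyF: "poly F p = pcompose f p" for p by (simp add: F_def pcompose_altdef)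
  \<comment> \<open>The norm of the sum of the \<open>H j\<close> T^j, with T^s read as f(Z) / f(X)
    and denominators cleared by f(X)^(s-1).\<close>
  define N where "N = (\<Sum>k<s. kummer_norm s H Z k * F ^ k * [:f ^ (s - 1 - k):])"
  have evalN: "\<phi> (poly N p) = \<phi> f ^ (s - 1) * (\<Prod>\<zeta>\<in>Z. \<Sum>j<s. \<phi> (poly \<zeta> p) ^ j * \<phi> (poly (H j) p) * T ^ j)"
    if \<phi>: "\<phi> 0 = 0" "\<phi> 1 = 1" "\<And>a b. \<phi> (a + b) = \<phi> a + \<phi> b" "\<And>a b. \<phi> (a * b) = \<phi> a * \<phi> b"
      and T: "\<phi> (pcompose f p) = \<phi> f * T ^ s"
    for \<phi> :: "'k poly \<Rightarrow> 'b::comm_ring_1" and p T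
  proof -
    let ?\<psi> = "\<lambda>w. \<phi> (poly w p)"
    have sum: "\<phi> (sum g I) = (\<Sum>i\<in>I. \<phi> (g i))" for g and I :: "nat set"
      by (induction I rule: infinite_finite_induct) (auto simp: \<phi>)
    have pow: "\<phi> (a ^ n) = \<phi> a ^ n" for a n by (induction n) (auto simp: \<phi>)
    have "?\<psi> N = (\<Sum>k<s. ?\<psi> (kummer_norm s H Z k) * (\<phi> f * T ^ s) ^ k * \<phi> f ^ (s - 1 - k))"
      by (simp add: N_def poly_sum sum \<phi> pow polyF T) (simp only: mult_ac)
    also have "\<dots> = (\<Sum>k<s. \<phi> f ^ (s - 1) * (?\<psi> (kummer_norm s H Z k) * T ^ (s * k)))"
    proof (intro sum.cong refl)
      fix k assume "k \<in> {..<s}"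
      then have "\<phi> f ^ (s - 1) = \<phi> f ^ k * \<phi> f ^ (s - 1 - k)" by (simp flip: power_add)
      then show "?\<psi> (kummer_norm s H Z k) * (\<phi> f * T ^ s) ^ k * \<phi> f ^ (s - 1 - k) =
          \<phi> f ^ (s - 1) * (?\<psi> (kummer_norm s H Z k) * T ^ (s * k))"
        by (simp add: power_mult_distrib mult_ac flip: power_mult)
    qed
    also have "\<dots> = \<phi> f ^ (s - 1) * (\<Sum>k<s. ?\<psi> (kummer_norm s H Z k) * T ^ (s * k))"
      by (simp add: sum_distrib_left)
    also have "(\<Sum>k<s. ?\<psi> (kummer_norm s H Z k) * T ^ (s * k)) =
        (\<Prod>\<zeta>\<in>Z. \<Sum>j<s. ?\<psi> \<zeta> ^ j * ?\<psi> (H j) * T ^ j)"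
      by (rule kummer_norm_eval) (use finZ cardZ closedZ \<open>0 \<notin> Z\<close> Zs \<open>s > 0\<close> \<phi> in auto)
    finally show ?thesis .
  qed
  have "N = 0"
  proof (rule poly_monom_eq_0_imp)
    have "coeff_degree_le (s * (A - 1) + (s - 1) * degree f) N"
      unfolding N_def
    proof (intro coeff_degree_le_sum)
      fix k assume k: "k \<in> {..<s}"
      have "coeff_degree_le (A - 1) (H j)" if "j < s" for j
        unfolding coeff_degree_le_def
      proof
        fix i
        show "degree (coeff (H j) i) \<le> A - 1"
          using deg[OF that, of i] by (cases "i < B") (auto simp: coeff_H)
      qed
      then have 1: "coeff_degree_le (s * (A - 1)) (kummer_norm s H Z k)"
        unfolding cardZ[symmetric]
        by (rule coeff_degree_le_kummer_norm)
          (use finZ cardZ in \<open>auto simp: Z_def coeff_degree_le_const\<close>)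
      have "coeff_degree_le 0 F" by (auto simp: coeff_degree_le_def F_def coeff_map_poly)
      then have 2: "coeff_degree_le (k * 0) (F ^ k)" by (rule coeff_degree_le_power)
      have "degree (f ^ (s - 1 - k)) \<le> (s - 1) * degree f"
        using f by (simp add: degree_power_eq diff_le_mono2)
      then have 3: "coeff_degree_le ((s - 1) * degree f) [:f ^ (s - 1 - k):]"
        by (rule coeff_degree_le_const)
      show "coeff_degree_le (s * (A - 1) + (s - 1) * degree f)
          (kummer_norm s H Z k * F ^ k * [:f ^ (s - 1 - k):])"
        using coeff_degree_le_mult[OF coeff_degree_le_mult[OF 1 2] 3] by simp
    qed auto
    moreover have "s * (A - 1) + (s - 1) * degree f < Q"
    proof -
      have "s * (A - 1) < s * A" using \<open>A > 0\<close> \<open>s > 0\<close> by simp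
      moreover have "(s - 1) * degree f \<le> s * degree f" by (intro mult_right_mono) auto
      ultimately show ?thesis using Q by linarith
    qed
    ultimately show "degree (coeff N i) < Q" for i
      by (auto simp: coeff_degree_le_def intro: le_less_trans)
    let ?p = "monom 1 Q :: 'k poly"
    have "Q = Suc (c * s)" using \<open>Q > 0\<close> c by simp
    then have "f ^ Q = f * (f ^ c) ^ s" by (simp add: power_mult)
    then have "pcompose f ?p = f * (f ^ c) ^ s" by (simp only: frob)
    then have "poly N ?p = f ^ (s - 1) *
        (\<Prod>\<zeta>\<in>Z. \<Sum>j<s. poly \<zeta> ?p ^ j * poly (H j) ?p * (f ^ c) ^ j)"
      using evalN[of "\<lambda>x. x" ?p "f ^ c"] by simp
    also have "(\<Prod>\<zeta>\<in>Z. \<Sum>j<s. poly \<zeta> ?p ^ j * poly (H j) ?p * (f ^ c) ^ j) = 0"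
    proof (rule prod_zero[OF finZ], rule bexI)
      show "1 \<in> Z" by (auto simp: Z_def one_pCons intro!: image_eqI[of _ _ 1])
      have "(\<Sum>j<s. poly 1 ?p ^ j * poly (H j) ?p * (f ^ c) ^ j) =
          (\<Sum>j<s. \<Sum>b<B. h j b * monom 1 (Q * b) * f ^ (c * j))"
        by (simp add: H_def poly_sum poly_monom monom_power power_mult sum_distrib_right)
      then show "(\<Sum>j<s. poly 1 ?p ^ j * poly (H j) ?p * (f ^ c) ^ j) = 0" using rel by simp
    qed
    finally show "poly N ?p = 0" by simp
  qed
  \<comment> \<open>Set Z to a constant z. Then T = \<alpha> \<tau> with \<alpha>^s = f(z) and
    \<tau>^s = 1 / f. As the norm vanishes, some twist does, and this is a Kummer relation with
    polynomial coefficients \<open>H'\<close>.\<close>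
  have Hz: "poly (H j) [:z:] = 0" if z: "poly f z \<noteq> 0" for z
  proof -
    let ?\<phi> = "\<lambda>p :: 'k poly. to_ac (to_fract p)"
    have tf: "?\<phi> f \<noteq> 0" using f by simp
    obtain \<alpha> where \<alpha>: "\<alpha> ^ s = poly f z" using nth_root_exists[OF \<open>s > 0\<close>] by blast
    then have "\<alpha> \<noteq> 0" using z \<open>s > 0\<close> by (auto simp: power_0_left)
    obtain \<tau> where \<tau>: "\<tau> ^ s = inverse (?\<phi> f)" using nth_root_exists[OF \<open>s > 0\<close>] by blast
    have pc: "pcompose f [:z:] = [:poly f z:]" by (induction f) (auto simp: pcompose_pCons)
    have "?\<phi> (pcompose f [:z:]) = ?\<phi> f * (?\<phi> [:\<alpha>:] * \<tau>) ^ s"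
    proof -
      have "[:\<alpha>:] ^ s = [:poly f z:]" by (simp flip: \<alpha>) (induction s; simp add: one_pCons)
      then have "?\<phi> [:\<alpha>:] ^ s = ?\<phi> [:poly f z:]" by (simp flip: to_ac_power to_fract_power)
      then show ?thesis using tf by (simp add: pc power_mult_distrib \<tau> field_simps)
    qed
    then have "?\<phi> f ^ (s - 1) * (\<Prod>\<zeta>\<in>Z. \<Sum>j<s. ?\<phi> (poly \<zeta> [:z:]) ^ j * ?\<phi> (poly (H j) [:z:]) *
        (?\<phi> [:\<alpha>:] * \<tau>) ^ j) = 0"
      using evalN[of ?\<phi> "[:z:]" "?\<phi> [:\<alpha>:] * \<tau>"] \<open>N = 0\<close> by simp
    then obtain \<zeta> where \<zeta>: "\<zeta> \<in> Z" "(\<Sum>j<s. ?\<phi> (poly \<zeta> [:z:]) ^ j * ?\<phi> (poly (H j) [:z:]) *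
        (?\<phi> [:\<alpha>:] * \<tau>) ^ j) = 0"
      using tf finZ by (auto simp: prod_zero_iff)
    then obtain w where w: "\<zeta> = [:[:w:]:]" "w ^ s = 1" by (auto simp: Z_def)
    then have "w \<noteq> 0" using \<open>s > 0\<close> by (auto simp: power_0_left)
    define H' where "H' = (\<lambda>j. [:w:] ^ j * poly (H j) [:z:] * [:\<alpha>:] ^ j)"
    have "H' j = 0"
    proof (rule kummer_independent[of f s \<tau> H'])
      show "\<tau> ^ s * to_ac (to_fract f) = 1" using tf by (simp add: \<tau>)
      have "(\<Sum>j<s. ?\<phi> (H' j) * \<tau> ^ j) = (\<Sum>j<s. ?\<phi> (poly \<zeta> [:z:]) ^ j * ?\<phi> (poly (H j) [:z:]) *
        (?\<phi> [:\<alpha>:] * \<tau>) ^ j)"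
        by (simp add: H'_def w to_fract_power power_mult_distrib mult_ac)
      then show "(\<Sum>j<s. ?\<phi> (H' j) * \<tau> ^ j) = 0" using \<zeta> by simp
    qed (use f ord \<open>s > 0\<close> jb in auto)
    then show ?thesis using \<open>w \<noteq> 0\<close> \<open>\<alpha> \<noteq> 0\<close> by (simp add: H'_def)
  qed
  have "H j = 0"
  proof (rule ccontr)
    assume "H j \<noteq> 0"
    then have "finite {p. poly (H j) p = 0}" by (rule poly_roots_finite)
    moreover have "(\<lambda>z. [:z:]) ` {z. poly f z \<noteq> 0} \<subseteq> {p. poly (H j) p = 0}" using Hz by auto
    ultimately have "finite ((\<lambda>z. [:z:]) ` {z. poly f z \<noteq> 0})" by (rule rev_finite_subset)
    then have "finite {z. poly f z \<noteq> 0}" by (rule finite_imageD) (auto simp: inj_on_def)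
    then have "finite ({z. poly f z \<noteq> 0} \<union> {z. poly f z = 0})" using poly_roots_finite[OF f] by simp
    moreover have "{z. poly f z \<noteq> 0} \<union> {z. poly f z = 0} = UNIV" by auto
    ultimately show False using infinite_UNIV_alg_closed by metis
  qed
  then show ?thesis using coeff_H[of j b] jb by simp
qed

subsection \<open>Stepanov's method\<close>

text \<open>This is p(X + Y) with Y as outer variable. Its coefficient at Y^k is the k-th Hasse
  derivative of p, which still detects the order of vanishing beyond the characteristic, where
  iterated derivatives fail.\<close>

definition taylor_poly :: "'a::comm_ring_1 poly \<Rightarrow> 'a poly poly" where
  "taylor_poly p = pcompose (map_poly (\<lambda>a. [:a:]) p) [:[:0, 1:], 1:]"

lemma taylor_poly_0 [simp]: "taylor_poly 0 = 0"
  by (simp add: taylor_poly_def)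

lemma taylor_poly_pCons: "taylor_poly (pCons a p) = [:[:a:]:] + [:[:0, 1:], 1:] * taylor_poly p"
  by (cases "a = 0 \<and> p = 0") (auto simp: taylor_poly_def map_poly_pCons pcompose_pCons)

lemma map_poly_poly_taylor_poly: "map_poly (\<lambda>c. poly c x) (taylor_poly p) = pcompose p [:x, 1:]"
proof (induction p)
  case (pCons a p)
  have hom: "map_poly (\<lambda>c. poly c x) (u + v) = map_poly (\<lambda>c. poly c x) u + map_poly (\<lambda>c. poly c x) v"
    "map_poly (\<lambda>c. poly c x) (u * v) = map_poly (\<lambda>c. poly c x) u * map_poly (\<lambda>c. poly c x) v" for u v :: "'a poly poly"
    by (rule map_poly_hom_add map_poly_hom_mult; simp)+
  show ?case unfolding taylor_poly_pCons pcompose_pCons hom pCons.IH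
    by (simp add: map_poly_pCons)
qed simp

lemma coeff_degree_le_taylor_poly: "coeff_degree_le (degree p) (taylor_poly p)"
proof (induction p)
  case (pCons a p)
  show ?case
  proof (cases "p = 0")
    case True
    then show ?thesis by (simp add: taylor_poly_pCons coeff_degree_le_const)
  next
    case False
    have 1: "coeff_degree_le 1 [:[:0, 1:], 1 :: 'a poly:]"
      by (auto simp: coeff_degree_le_def coeff_pCons split: nat.splits)
    have "coeff_degree_le (1 + degree p) ([:[:0, 1:], 1:] * taylor_poly p)"
      by (rule coeff_degree_le_mult[OF 1 pCons.IH])
    moreover have "coeff_degree_le (1 + degree p) [:[:a:]:]"
      by (rule coeff_degree_le_const) simp
    ultimately have "coeff_degree_le (1 + degree p) (taylor_poly (pCons a p))"
      unfolding taylor_poly_pCons coeff_degree_le_def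
      by (auto intro: degree_add_le)
    then show ?thesis using False by simp
  qed
qed (simp add: coeff_degree_le_def)

lemma coeff_mult_monom_power_eq_0:
  fixes p q :: "'a::comm_ring_1 poly"
  assumes "coeff q 0 = 0" "k < i"
  shows "coeff (p * q ^ i) k = 0"
proof -
  obtain r where "q = pCons 0 r" using assms(1) by (metis coeff_pCons_0 pCons_cases)
  then have "q = monom 1 1 * r" by (simp add: monom_altdef)
  then have "p * q ^ i = monom 1 i * (p * r ^ i)" by (simp add: power_mult_distrib monom_power mult_ac)
  then show ?thesis using assms(2) by (simp add: coeff_monom_mult)
qed

section \<open>Multiple zeros and degrees\<close>

lemma prod_linear_powers_dvd:
  fixes R :: "'k::field poly"
  assumes "finite Z" "\<And>x. x \<in> Z \<Longrightarrow> [:-x, 1:] ^ k dvd R"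
  shows "(\<Prod>x\<in>Z. [:-x, 1:] ^ k) dvd R"
  using assms
proof (induction Z rule: finite_induct)
  case (insert x Z)
  then obtain S where S: "R = (\<Prod>x\<in>Z. [:-x, 1:] ^ k) * S" by (auto elim!: dvdE)
  show ?case
  proof (cases "R = 0")
    case False
    have "[:-x, 1:] ^ k dvd S"
    proof -
      have nz: "(\<Prod>x\<in>Z. [:-x, 1:] ^ k) * S \<noteq> 0" using False S by simp
      then have "order x R = order x (\<Prod>x\<in>Z. [:-x, 1:] ^ k) + order x S"
        unfolding S by (rule order_mult)
      moreover have "order x (\<Prod>x\<in>Z. [:-x, 1:] ^ k) = 0"
        using insert.hyps by (intro order_0I) (auto simp: poly_prod prod_zero_iff)
      moreover have "k \<le> order x R" using insert.prems False by (simp add: order_divides)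
      ultimately show ?thesis by (simp add: order_divides)
    qed
    then have "(\<Prod>x\<in>Z. [:-x, 1:] ^ k) * [:-x, 1:] ^ k dvd R" unfolding S by (rule mult_dvd_mono[OF dvd_refl])
    then show ?thesis using insert.hyps by (simp add: mult.commute)
  qed simp
qed simp

lemma card_linear_powers_le_degree:
  fixes R :: "'k::field poly"
  assumes "R \<noteq> 0" "finite Z" "\<And>x. x \<in> Z \<Longrightarrow> [:-x, 1:] ^ M dvd R"
  shows "card Z * M \<le> degree R"
proof -
  have "card Z * M = degree (\<Prod>x\<in>Z. [:-x, 1:] ^ M)"
    by (subst degree_prod_eq_sum_degree) (auto simp: degree_linear_power)
  also have "\<dots> \<le> degree R"
    by (intro dvd_imp_degree_le prod_linear_powers_dvd assms)
  finally show ?thesis .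
qed

lemma linear_power_dvd_if_coeffs_eq_0:
  fixes R :: "'a::field poly"
  assumes "\<And>k. k < M \<Longrightarrow> coeff (pcompose R [:x, 1:]) k = 0"
  shows "[:-x, 1:] ^ M dvd R"
proof -
  obtain W where W: "pcompose R [:x, 1:] = monom 1 M * W"
    using assms monom_1_dvd_iff' by (metis dvdE)
  have "pcompose [:x, 1:] [:-x, 1:] = [:0, 1::'a:]" by (simp add: pcompose_pCons)
  then have "R = pcompose (pcompose R [:x, 1:]) [:-x, 1:]"
    by (simp add: pcompose_idR flip: pcompose_assoc)
  also have "\<dots> = pcompose (monom 1 M) [:-x, 1:] * pcompose W [:-x, 1:]"
    by (simp add: W pcompose_mult)
  also have "pcompose (monom 1 M) [:-x, 1:] = [:-x, 1::'a:] ^ M"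
    by (induction M) (auto simp: monom_Suc pcompose_pCons pcompose_1)
  finally show ?thesis by (metis dvd_triv_left)
qed


lemma pcompose_power: "pcompose (p ^ n) q = pcompose p q ^ n"
  by (induction n) (auto simp: pcompose_mult pcompose_1)

text \<open>
  These polynomials stand in for the hyperderivatives of \<open>X\<^sup>e f\<^sup>n\<close>: up to the factor \<open>f\<^sup>n\<^sup>-\<^sup>k\<close>, the
  Taylor coefficient of order \<open>k\<close> has a degree that does not grow with \<open>n\<close>.
\<close>

definition stepanov_coeff :: "'a::comm_ring_1 poly \<Rightarrow> nat \<Rightarrow> nat \<Rightarrow> nat \<Rightarrow> 'a poly" where
  "stepanov_coeff f n e k = (\<Sum>i\<le>k. smult (of_nat (n choose i))
     (f ^ (k - i) * coeff (taylor_poly (monom 1 e) * (taylor_poly f - [:f:]) ^ i) k))"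

lemma degree_stepanov_coeff: "degree (stepanov_coeff f n e k) \<le> e + k * degree f"
  unfolding stepanov_coeff_def
proof (intro degree_sum_le)
  fix i assume "i \<in> {..k}"
  let ?D = "degree f"
  have 1: "coeff_degree_le e (taylor_poly (monom 1 e :: 'a poly))"
    using coeff_degree_le_taylor_poly[of "monom (1::'a) e"] by (simp add: degree_monom_eq)
  have "coeff_degree_le ?D (taylor_poly f)" "coeff_degree_le ?D [:f:]"
    by (simp_all add: coeff_degree_le_taylor_poly coeff_degree_le_const)
  then have "coeff_degree_le ?D (taylor_poly f - [:f:])"
    by (auto simp: coeff_degree_le_def intro: degree_diff_le)
  from coeff_degree_le_mult[OF 1 coeff_degree_le_power[OF this, of i]]
  have "degree (coeff (taylor_poly (monom 1 e) * (taylor_poly f - [:f:]) ^ i) k) \<le> e + i * ?D"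
    by (simp add: coeff_degree_le_def)
  moreover have "degree (f ^ (k - i)) \<le> (k - i) * ?D" 
    using degree_power_le[of f "k - i"] by (simp add: mult.commute)
  ultimately have "degree (f ^ (k - i) * coeff (taylor_poly (monom 1 e) * (taylor_poly f - [:f:]) ^ i) k)
      \<le> (k - i) * ?D + (e + i * ?D)"
    by (intro order.trans[OF degree_mult_le] add_mono)
  also have "\<dots> = e + k * ?D"
  proof -
    have "k * ?D = (k - i) * ?D + i * ?D" using \<open>i \<in> {..k}\<close> by (simp flip: add_mult_distrib)
    then show ?thesis by simp
  qed
  finally show "degree (smult (of_nat (n choose i))
     (f ^ (k - i) * coeff (taylor_poly (monom 1 e) * (taylor_poly f - [:f:]) ^ i) k)) \<le> e + k * ?D"
    by (rule order.trans[OF degree_smult_le])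
qed auto

text \<open>With f(x + Y) = f(x) + \<Delta> and \<Delta> divisible by Y, the binomial expansion of
  the n-th power contributes to Y^k only through i \<le> k. The factor f(x)^k on the left turns
  f(x)^(n-i) into f(x)^n f(x)^(k-i).\<close>

lemma stepanov_coeff_eval:
  fixes f :: "'a::field poly"
  shows "poly f x ^ k * coeff (pcompose (monom 1 e * f ^ n) [:x, 1:]) k =
    poly f x ^ n * poly (stepanov_coeff f n e k) x"
proof -
  define E where "E = pcompose (monom 1 e) [:x, 1:]"
  define \<Delta> where "\<Delta> = pcompose f [:x, 1:] - [:poly f x:]"
  have hom: "map_poly (\<lambda>c. poly c x) (u * v) = map_poly (\<lambda>c. poly c x) u * map_poly (\<lambda>c. poly c x) v"
    for u v :: "'a poly poly" by (rule map_poly_hom_mult) auto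
  have hom_pow: "map_poly (\<lambda>c. poly c x) (u ^ i) = map_poly (\<lambda>c. poly c x) u ^ i" for u :: "'a poly poly" and i
    by (induction i) (auto simp: hom)
  have hom_diff: "map_poly (\<lambda>c. poly c x) (u - v) = map_poly (\<lambda>c. poly c x) u - map_poly (\<lambda>c. poly c x) v"
    for u v :: "'a poly poly" by (intro poly_eqI) (simp add: coeff_map_poly)
  have m\<Delta>: "map_poly (\<lambda>c. poly c x) (taylor_poly f - [:f:]) = \<Delta>"
    by (simp add: hom_diff map_poly_poly_taylor_poly \<Delta>_def map_poly_pCons)
  have c: "poly (coeff (taylor_poly (monom 1 e) * (taylor_poly f - [:f:]) ^ i) k) x = coeff (E * \<Delta> ^ i) k" for i
  proof -
    have "poly (coeff w k) x = coeff (map_poly (\<lambda>c. poly c x) w) k" for w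
      by (simp add: coeff_map_poly)
    then show ?thesis by (simp only: hom hom_pow m\<Delta> map_poly_poly_taylor_poly E_def)
  qed
  have \<Delta>0: "coeff \<Delta> 0 = 0"
    by (simp add: \<Delta>_def flip: poly_0_coeff_0) (simp add: poly_pcompose)
  have "pcompose (f ^ n) [:x, 1:] = (\<Delta> + [:poly f x:]) ^ n" by (simp add: \<Delta>_def pcompose_power)
  also have "\<dots> = (\<Sum>i\<le>n. of_nat (n choose i) * \<Delta> ^ i * [:poly f x:] ^ (n - i))"
    by (rule binomial_ring)
  finally have "pcompose (monom 1 e * f ^ n) [:x, 1:] =
      (\<Sum>i\<le>n. smult (of_nat (n choose i) * poly f x ^ (n - i)) (E * \<Delta> ^ i))"
    by (simp add: pcompose_mult E_def sum_distrib_left of_nat_poly poly_const_pow mult_ac)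
  then have "coeff (pcompose (monom 1 e * f ^ n) [:x, 1:]) k =
      (\<Sum>i\<le>n. of_nat (n choose i) * poly f x ^ (n - i) * coeff (E * \<Delta> ^ i) k)"
    by (simp add: coeff_sum)
  \<comment> \<open>The range changes through \<open>max n k\<close>: the binomials vanish for i >
    n, the coefficients for i > k.\<close>
  also have "\<dots> = (\<Sum>i\<le>max n k. of_nat (n choose i) * poly f x ^ (n - i) * coeff (E * \<Delta> ^ i) k)"
    by (rule sum.mono_neutral_left) (auto simp: binomial_eq_0)
  also have "\<dots> = (\<Sum>i\<le>k. of_nat (n choose i) * poly f x ^ (n - i) * coeff (E * \<Delta> ^ i) k)"
    by (rule sum.mono_neutral_right) (auto simp: coeff_mult_monom_power_eq_0[OF \<Delta>0])
  finally have "poly f x ^ k * coeff (pcompose (monom 1 e * f ^ n) [:x, 1:]) k =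
      (\<Sum>i\<le>k. poly f x ^ k * (of_nat (n choose i) * poly f x ^ (n - i) * coeff (E * \<Delta> ^ i) k))"
    by (simp add: sum_distrib_left)
  also have "\<dots> = (\<Sum>i\<le>k. poly f x ^ n * (of_nat (n choose i) * (poly f x ^ (k - i) * coeff (E * \<Delta> ^ i) k)))"
  proof (intro sum.cong refl)
    fix i assume i: "i \<in> {..k}"
    show "poly f x ^ k * (of_nat (n choose i) * poly f x ^ (n - i) * coeff (E * \<Delta> ^ i) k) =
      poly f x ^ n * (of_nat (n choose i) * (poly f x ^ (k - i) * coeff (E * \<Delta> ^ i) k))"
    proof (cases "i \<le> n")
      case True
      then have "poly f x ^ k * poly f x ^ (n - i) = poly f x ^ n * poly f x ^ (k - i)"
        using i by (simp add: add.commute flip: power_add)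
      then have "(poly f x ^ k * poly f x ^ (n - i)) * (of_nat (n choose i) * coeff (E * \<Delta> ^ i) k) =
          (poly f x ^ n * poly f x ^ (k - i)) * (of_nat (n choose i) * coeff (E * \<Delta> ^ i) k)" by simp
      then show ?thesis by (simp only: mult_ac)
    qed (simp add: binomial_eq_0)
  qed
  also have "\<dots> = poly f x ^ n * poly (stepanov_coeff f n e k) x"
    by (simp add: stepanov_coeff_def poly_sum c sum_distrib_left)
  finally show ?thesis .
qed

text \<open>If x^Q = x, then (x + Y)^(Q b) = (x + Y^Q)^b, which is x^b modulo Y^Q. So X^(Q b),
  despite its large degree, acts on the Taylor coefficients below Q as the scalar x^b.\<close>

lemma coeff_pcompose_frobenius_mult:
  fixes F :: "'k::field poly"
  assumes "prime CHAR('k)" "Q = CHAR('k) ^ r" and x: "x ^ Q = x" and k: "k < Q"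
  shows "coeff (pcompose (F * monom 1 (Q * b)) [:x, 1:]) k = x ^ b * coeff (pcompose F [:x, 1:]) k"
proof -
  have "pcompose (monom 1 n) [:x, 1:] = [:x, 1:] ^ n" for n
    by (induction n) (auto simp: monom_Suc pcompose_pCons pcompose_1)
  moreover have "[:x, 1:] ^ Q = [:x:] + monom 1 Q"
  proof -
    have "[:x, 1:] = [:x:] + monom 1 1" by (simp add: monom_altdef)
    moreover have "([:x:] + monom 1 1) ^ Q = [:x:] ^ Q + monom 1 1 ^ Q"
      by (rule freshmans_dream') (use assms in auto)
    ultimately show ?thesis using x by (simp add: poly_const_pow monom_power)
  qed
  ultimately have pc: "pcompose (F * monom 1 (Q * b)) [:x, 1:] = pcompose F [:x, 1:] * ([:x:] + monom 1 Q) ^ b"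
    by (simp add: pcompose_mult power_mult)
  have "\<exists>W. ([:x:] + monom 1 Q) ^ b = [:x ^ b:] + monom 1 Q * W"
  proof (induction b)
    case (Suc b)
    then obtain W where W: "([:x:] + monom 1 Q) ^ b = [:x ^ b:] + monom 1 Q * W" by blast
    have "([:x:] + monom 1 Q) ^ Suc b = [:x ^ Suc b:] + monom 1 Q * ([:x:] * W + [:x ^ b:] + monom 1 Q * W)"
      unfolding power_Suc W by (simp add: algebra_simps)
    then show ?case by blast
  qed (auto intro: exI[of _ 0] simp: one_pCons)
  then obtain W where W: "([:x:] + monom 1 Q) ^ b = [:x ^ b:] + monom 1 Q * W" by blast
  have "pcompose (F * monom 1 (Q * b)) [:x, 1:] =
      smult (x ^ b) (pcompose F [:x, 1:]) + monom 1 Q * (pcompose F [:x, 1:] * W)"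
    unfolding pc W by (simp add: algebra_simps)
  then show ?thesis using k by (simp add: coeff_monom_mult)
qed

text \<open>The unknowns are the s A B coefficients of the \<open>h j b\<close>. Vanishing to order
  M on Z is implied by M identities between polynomials of degree below A + B + M D. A solution R
  \<noteq> 0 of degree at most A + Q B + Q D then has a zero of order M at each point of Z.\<close>

lemma stepanov_count:
  fixes f :: "'k::alg_closed_field poly" and a :: 'k
  assumes f: "f \<noteq> 0" and s: "of_nat s \<noteq> (0 :: 'k)"
    and ord: "\<And>r. 0 < r \<Longrightarrow> r < s \<Longrightarrow> \<exists>t. \<not> s dvd r * order t f"
    and char: "prime CHAR('k)" "Q = CHAR('k) ^ r"
    and frob: "f ^ Q = pcompose f (monom 1 Q)" and c: "c * s = Q - 1"
    and a: "a \<noteq> 0" and Z: "Z = {x. x ^ Q = x \<and> poly f x ^ c = a}" and D: "D = degree f"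
    and Q: "s * A + s * D \<le> Q" "M \<le> Q" and c0: "c > 0"
    and params: "M * (A + B + M * D) < s * A * B"
  shows "card Z * M \<le> A + Q * B + Q * D"
proof -
  define I where "I = {..<s} \<times> {..<B} \<times> {..<A}"
  define E where "E = {..<M} \<times> {..<A + B + M * D}"
  \<comment> \<open>On Z one has X^(Q b) = X^b and f^(c j) = a^j. So, up to the factor f(x)^k, the
    k-th Taylor coefficient of a basis term of R at x is the value of this polynomial, whose degree
    is at most b + e + k D.\<close>
  define G where "G = (\<lambda>k (j, b, e). smult (a ^ j) (monom 1 b * stepanov_coeff f (c * j) e k))"
  have "card E < card I" using params by (simp add: E_def I_def mult_ac)
  then obtain v where v: "\<exists>i\<in>I. v i \<noteq> 0" and
    rel: "\<forall>(k, l)\<in>E. (\<Sum>i\<in>I. coeff (G k i) l * v i) = 0"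
    using homogeneous_system_nontrivial[of E I "\<lambda>(k, l) i. coeff (G k i) l"]
    by (auto simp: E_def I_def split_beta)
  have G0: "(\<Sum>i\<in>I. smult (v i) (G k i)) = 0" if k: "k < M" for k
  proof (rule poly_eqI)
    fix l
    show "coeff (\<Sum>i\<in>I. smult (v i) (G k i)) l = coeff 0 l"
    proof (cases "l < A + B + M * D")
      case True
      then show ?thesis using k rel by (auto simp: E_def coeff_sum mult.commute)
    next
      case False
      have "coeff (G k i) l = 0" if iI: "i \<in> I" for i
      proof -
        obtain j b e where i: "i = (j, b, e)" "b < B" "e < A" using iI by (auto simp: I_def)
        have "k * D \<le> M * D" using k by simp
        moreover have "degree (G k i) \<le> b + (e + k * D)"
          unfolding G_def i D
          by (simp, intro impI order.trans[OF degree_mult_le] add_mono degree_monom_le degree_stepanov_coeff)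
        ultimately show ?thesis using False i by (intro coeff_eq_0) linarith
      qed
      then show ?thesis by (simp add: coeff_sum)
    qed
  qed
  define h where "h = (\<lambda>j b. \<Sum>e<A. monom (v (j, b, e)) e)"
  define R where "R = (\<Sum>j<s. \<Sum>b<B. h j b * monom 1 (Q * b) * f ^ (c * j))"
  have coeff_h: "coeff (h j b) e = (if e < A then v (j, b, e) else 0)" for j b e
    by (simp add: h_def coeff_sum sum.delta)
  have R_eq: "R = (\<Sum>(j, b, e)\<in>I. smult (v (j, b, e)) (monom 1 e * f ^ (c * j) * monom 1 (Q * b)))"
  proof -
    have "R = (\<Sum>j<s. \<Sum>b<B. \<Sum>e<A. smult (v (j, b, e)) (monom 1 e * f ^ (c * j) * monom 1 (Q * b)))"
      unfolding R_def h_def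
      by (intro sum.cong refl) (simp add: sum_distrib_left sum_distrib_right mult_ac smult_monom flip: mult_smult_left)
    then show ?thesis by (simp add: I_def sum.cartesian_product)
  qed
  have "R \<noteq> 0"
  proof
    assume "R = 0"
    obtain j b e where jbe: "j < s" "b < B" "e < A" "v (j, b, e) \<noteq> 0" using v by (auto simp: I_def)
    have "h j b = 0"
    proof (rule stepanov_independent[where h = h and A = A and B = B and Q = Q and c = c, OF f s ord frob c])
      show "degree (h j b) < A" for j b
      proof -
        have "degree (h j b) \<le> A - 1"
          by (intro degree_le) (auto simp: coeff_h)
        then show ?thesis using jbe by linarith
      qed
    qed (use Q \<open>R = 0\<close> jbe in \<open>auto simp: R_def D\<close>)
    then show False using coeff_h[of j b e] jbe by simp
  qed
  have finZ: "finite Z"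
  proof (rule finite_subset)
    have "Q > 1" using c c0 s by (cases s; cases c) auto
    then have "monom 1 Q + [:0, -1:] \<noteq> (0 :: 'k poly)"
      by (auto simp: poly_eq_iff coeff_pCons dest!: spec[of _ Q] split: nat.splits)
    then show "finite {x::'k. poly (monom 1 Q + [:0, -1:]) x = 0}" by (rule poly_roots_finite)
    show "Z \<subseteq> {x. poly (monom 1 Q + [:0, -1:]) x = 0}" by (auto simp: Z poly_monom)
  qed
  have "[:-x, 1:] ^ M dvd R" if x: "x \<in> Z" for x
  proof (rule linear_power_dvd_if_coeffs_eq_0)
    fix k assume k: "k < M"
    have xQ: "x ^ Q = x" and fx: "poly f x ^ c = a" using x by (auto simp: Z)
    have "poly f x \<noteq> 0" using fx a c0 by (auto simp: power_0_left)
    have pw: "poly f x ^ (c * j) = a ^ j" for j by (simp add: power_mult fx)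
    have "poly f x ^ k * coeff (pcompose R [:x, 1:]) k = 
        (\<Sum>(j, b, e)\<in>I. v (j, b, e) * (x ^ b * (poly f x ^ k * coeff (pcompose (monom 1 e * f ^ (c * j)) [:x, 1:]) k)))"
      by (simp add: R_eq pcompose_sum pcompose_smult coeff_sum sum_distrib_left split_beta
          coeff_pcompose_frobenius_mult[OF char xQ less_le_trans[OF k Q(2)]]) (simp only: mult_ac)
    also have "\<dots> = (\<Sum>i\<in>I. v i * poly (G k i) x)"
      by (intro sum.cong refl) (auto simp: G_def stepanov_coeff_eval pw poly_monom)
    also have "\<dots> = poly (\<Sum>i\<in>I. smult (v i) (G k i)) x" by (simp add: poly_sum)
    finally show "coeff (pcompose R [:x, 1:]) k = 0" using G0[OF k] \<open>poly f x \<noteq> 0\<close> by simp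
  qed
  then have "card Z * M \<le> degree R" by (intro card_linear_powers_le_degree \<open>R \<noteq> 0\<close> finZ)
  also have "degree R \<le> A + Q * B + Q * D"
    unfolding R_eq
  proof (intro degree_sum_le, goal_cases)
    case (2 i)
    then obtain j b e where i: "i = (j, b, e)" "j < s" "b < B" "e < A" by (auto simp: I_def)
    have "c * j \<le> Q" using c i(2) by (metis diff_le_self le_trans less_imp_le_nat mult_le_mono2)
    then have "c * j * D \<le> Q * D" by simp
    moreover have "Q * b \<le> Q * B" using i by simp
    moreover have "degree (monom 1 e * f ^ (c * j) * monom 1 (Q * b)) \<le> e + c * j * D + Q * b"
      using degree_power_le[of f "c * j"]
      by (intro order.trans[OF degree_mult_le] add_mono degree_monom_le) (simp add: D mult.commute)
    ultimately show ?case using i by (simp, intro impI) linarith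
  qed (auto simp: I_def)
  finally show ?thesis .
qed

text \<open>Only the independence of \<open>Q\<close> matters here, not the value.\<close>

definition stepanov_const :: "nat \<Rightarrow> nat \<Rightarrow> nat" where
  "stepanov_const s D = 6 * s * (1 + s * D) * (D + 2)"

text \<open>The bound of \<open>stepanov_count\<close> is near Q B / M, so M should be close to s B;
  with M = s B - 1 the condition on the parameters becomes M (B + M D) < A. As A is about Q / s,
  this allows B of order sqrt Q / L. The lower bound on Q gives B \<ge> 2 and thus M > 0.\<close>

lemma stepanov_parameters:
  fixes s D Q :: nat
  assumes s: "s > 0"
  defines "L \<equiv> 2 * s * (1 + s * D)"
  assumes Q: "Q \<ge> 4 * L ^ 2"
  obtains A B M where "s * A + s * D \<le> Q" "M \<le> Q" "M * (A + B + M * D) < s * A * B" "M > 0"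
    "real (A + Q * B + Q * D) / real M \<le> real Q / real s + real (stepanov_const s D) * sqrt (real Q)"
proof -
  define q where "q = sqrt (real Q)"
  define B where "B = nat \<lfloor>q / real L\<rfloor>"
  define A where "A = Q div s - D"
  define M where "M = s * B - 1"
  have "L > 0" "L \<ge> 2" using s by (auto simp: L_def Suc_le_eq)
  have qq: "q * q = real Q" by (simp add: q_def)
  have "q \<ge> 2 * real L"
  proof -
    have "(2 * real L)\<^sup>2 \<le> real Q" using Q
      by (simp flip: of_nat_le_iff[where ?'a = real] add: power_mult_distrib)
    then show ?thesis unfolding q_def by (rule real_le_rsqrt)
  qed
  then have ql: "q / real L \<ge> 2" using \<open>L > 0\<close> by (simp add: field_simps)
  have B1: "real B \<le> q / real L" and B2: "q / real L < real B + 1" and B3: "B \<ge> 2"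
    using ql unfolding B_def by linarith+
  have BL: "real B * real L \<le> q" using B1 \<open>L > 0\<close> by (simp add: field_simps)
  have "(real B * real L)\<^sup>2 \<le> q\<^sup>2" using BL by (intro power_mono) auto
  then have BL2: "real (B ^ 2 * L ^ 2) \<le> real Q" by (simp add: power2_eq_square qq mult_ac)
  then have BL2n: "B ^ 2 * L ^ 2 \<le> Q" by (simp only: of_nat_le_iff)
  have L2: "L ^ 2 = 4 * s ^ 2 * (1 + s * D) ^ 2" by (simp only: L_def power_mult_distrib) simp
  have Ql: "Q \<ge> 16 * s ^ 2 * (1 + s * D) ^ 2" using Q L2 by simp
  have "s * (D + 1) \<le> s * (1 + s * D) ^ 2"
  proof (rule mult_left_mono)
    have "D + 1 \<le> (1 + s * D) ^ 1" using s by simp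
    also have "\<dots> \<le> (1 + s * D) ^ 2" by (rule power_increasing) auto
    finally show "D + 1 \<le> (1 + s * D) ^ 2" .
  qed simp
  also have "\<dots> \<le> s ^ 2 * (1 + s * D) ^ 2" using s by (intro mult_right_mono) (auto simp: power2_eq_square)
  finally have Ds: "16 * (s * (D + 1)) \<le> Q" using Ql by linarith
  have Qs: "s * (Q div s) \<le> Q" "Q < s * (Q div s) + s"
    using s dividend_less_times_div[of s Q] by simp_all
  have "s * D + s \<le> Q" using Ds by (simp add: algebra_simps)
  then have "D \<le> Q div s" using s by (simp add: less_eq_div_iff_mult_less_eq mult.commute)
  then have As: "s * A + s * D \<le> Q" and sA: "Q < s * A + s * D + s"
    using Qs by (simp_all add: A_def diff_mult_distrib2)
  have sB: "s * B \<ge> 2" using s B3 by (metis One_nat_def Suc_leI le_trans mult_le_mono mult_1)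
  have M: "M + 1 = s * B" "M > 0" using sB by (auto simp: M_def)
  have MQ: "M \<le> Q"
  proof -
    have "s \<le> L" by (simp add: L_def)
    also have "L \<le> L ^ 2" using \<open>L > 0\<close> by (simp add: power2_eq_square)
    finally have "s \<le> L ^ 2" .
    then have "B * s \<le> B ^ 2 * L ^ 2" using B3 by (intro mult_mono) (auto simp: power2_eq_square)
    then show ?thesis using BL2n M by (simp add: mult.commute)
  qed
  have key: "M * (B + M * D) < A"
  proof -
    have "M * (B + M * D) \<le> (s * B) * (B + s * B * D)"
      using M by (intro mult_mono add_mono) auto
    also have "\<dots> = s * (1 + s * D) * B ^ 2" by (simp add: algebra_simps power2_eq_square)
    finally have 1: "s * (M * (B + M * D)) \<le> s * (s * (1 + s * D) * B ^ 2)" by (rule mult_left_mono) simp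
    have "4 * (s * (s * (1 + s * D) * B ^ 2)) * 1 \<le> 4 * (s * (s * (1 + s * D) * B ^ 2)) * (1 + s * D)"
      by (intro mult_left_mono) auto
    also have "\<dots> = B ^ 2 * L ^ 2" by (simp only: L2) (simp add: algebra_simps power2_eq_square)
    finally have "4 * (s * (M * (B + M * D))) \<le> Q" using 1 BL2n by linarith
    moreover have "s * D + s \<le> s * (D + 1)" by simp
    ultimately have "s * (M * (B + M * D)) < s * A" using sA Ds Ql by linarith
    then show ?thesis by simp
  qed
  have params: "M * (A + B + M * D) < s * A * B"
  proof -
    have "s * A * B = (M + 1) * A" unfolding M by (simp only: mult_ac)
    then show ?thesis using key by (simp add: algebra_simps)
  qed
  have Mr: "real M = real s * real B - 1" using arg_cong[OF M(1), of real] by simp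
  have "real A \<le> real Q / real s"
  proof -
    have "s * A \<le> Q" using As by linarith
    then have "real (s * A) \<le> real Q" by (simp only: of_nat_le_iff)
    then show ?thesis using s by (simp add: field_simps)
  qed
  then have "real (A + Q * B + Q * D) / real M \<le> (real Q / real s + real Q * real B + real Q * real D) / real M"
    by (intro divide_right_mono) auto
  \<comment> \<open>By s B = M + 1 the term Q B equals (Q / s) M + Q / s; the other Q / s comes from
    A.\<close>
  also have "\<dots> = real Q / real s + real Q * (2 / real s + real D) / real M"
  proof -
    have "real Q / real s + real Q * real B + real Q * real D =
        real Q / real s * real M + real Q * (2 / real s + real D)"
    proof -
      have e: "real Q * real B = real Q / real s * (real s * real B)"
        "real Q * (2 / real s) = 2 * (real Q / real s)" using s by simp_all
      show ?thesis unfolding Mr distrib_left right_diff_distrib e by simp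
    qed
    then show ?thesis using M(2) by (simp add: add_divide_distrib)
  qed
  \<comment> \<open>Since M \<ge> B - 1, the quotient Q / M is at most 3 L sqrt Q. With 2 / s \<le>
    2 this gives \<open>stepanov_const\<close> = 3 L (D + 2).\<close>
  also have "real Q * (2 / real s + real D) / real M \<le> real (stepanov_const s D) * q"
  proof -
    have "3 * (real B - 1) \<ge> real B + 1" using B3 by simp
    then have "q / real L < 3 * (real B - 1)" using B2 by linarith
    also have "real B - 1 \<le> real M"
    proof -
      have "1 * real B \<le> real s * real B" using s by (intro mult_right_mono) auto
      then show ?thesis by (simp add: Mr)
    qed
    finally have "q < 3 * real L * real M" using \<open>L > 0\<close> by (simp add: field_simps)
    then have "q * q \<le> q * (3 * real L * real M)" by (intro mult_left_mono) (auto simp: q_def)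
    then have 1: "real Q / real M \<le> 3 * real L * q" using M(2) by (simp add: qq field_simps)
    have "2 / real s \<le> 2" using s by (simp add: field_simps)
    then have "(real Q / real M) * (2 / real s + real D) \<le> (3 * real L * q) * (2 + real D)"
      using 1 by (intro mult_mono) (auto simp: q_def)
    also have "\<dots> = real (stepanov_const s D) * q" by (simp add: stepanov_const_def L_def algebra_simps)
    finally show ?thesis by simp
  qed
  finally show ?thesis using that[of A M B] As MQ params M(2) by (simp add: q_def)
qed


text \<open>For Q < 4 L^2 the trivial bound Q is at most 2 L sqrt Q and is absorbed by the constant.
  This makes the bound uniform, as it must hold for all powers Q = q^\<nu> at once.\<close>

lemma stepanov_bound:
  fixes f :: "'k::alg_closed_field poly" and a :: 'k
  assumes f: "f \<noteq> 0" and s: "of_nat s \<noteq> (0 :: 'k)"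
    and ord: "\<And>r. 0 < r \<Longrightarrow> r < s \<Longrightarrow> \<exists>t. \<not> s dvd r * order t f"
    and char: "prime CHAR('k)" "Q = CHAR('k) ^ r"
    and frob: "f ^ Q = pcompose f (monom 1 Q)" and c: "c * s = Q - 1" "c > 0" and a: "a \<noteq> 0"
  shows "real (card {x. x ^ Q = x \<and> poly f x ^ c = a}) \<le>
    real Q / real s + real (stepanov_const s (degree f)) * sqrt (real Q)"
proof -
  let ?Z = "{x. x ^ Q = x \<and> poly f x ^ c = a}"
  define D where "D = degree f"
  have s0: "s > 0" using s by (cases s) auto
  define L where "L = 2 * s * (1 + s * D)"
  show ?thesis
  proof (cases "Q \<ge> 4 * L ^ 2")
    case True
    from stepanov_parameters[OF s0 True[unfolded L_def]] obtain A B M where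
      AB: "s * A + s * D \<le> Q" "M \<le> Q" "M * (A + B + M * D) < s * A * B" "M > 0"
      and b: "real (A + Q * B + Q * D) / real M \<le> real Q / real s + real (stepanov_const s D) * sqrt (real Q)"
      by metis
    have "card ?Z * M \<le> A + Q * B + Q * D"
      by (rule stepanov_count[OF f s ord char frob c(1) a refl D_def AB(1,2) c(2) AB(3)])
    then have "real (card ?Z * M) \<le> real (A + Q * B + Q * D)" by (simp only: of_nat_le_iff)
    then have "real (card ?Z) \<le> real (A + Q * B + Q * D) / real M" using AB(4) by (simp add: field_simps)
    with b show ?thesis by (simp add: D_def)
  next
    case False
    have Q1: "Q > 1" using c s0 by (cases s; cases c) auto
    have "CHAR('k) dvd Q" using char Q1 by (cases r) auto
    then have Q0: "of_nat Q = (0 :: 'k)" by (simp add: of_nat_eq_0_iff_char_dvd)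
    have "card ?Z \<le> card {x::'k. x ^ Q = x}"
      by (intro card_mono card_ge_0_finite) (use card_fixed_points_power[OF Q0 Q1] Q1 in auto)
    then have "real (card ?Z) \<le> real Q" using card_fixed_points_power[OF Q0 Q1] by simp
    also have "\<dots> = sqrt (real Q) * sqrt (real Q)" by simp
    also have "\<dots> \<le> real (2 * L) * sqrt (real Q)"
    proof (intro mult_right_mono)
      have "real Q \<le> real (4 * L ^ 2)" using False by (simp only: of_nat_le_iff)
      then have "real Q \<le> (real (2 * L))\<^sup>2" by (simp add: power_mult_distrib)
      then show "sqrt (real Q) \<le> real (2 * L)" by (intro real_le_lsqrt) auto
    qed auto
    also have "\<dots> \<le> real (stepanov_const s D) * sqrt (real Q)"
    proof (intro mult_right_mono)
      have "L * 2 \<le> L * (3 * (D + 2))" by (intro mult_left_mono) auto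
      also have "\<dots> = stepanov_const s D" by (simp add: L_def stepanov_const_def algebra_simps)
      finally show "real (2 * L) \<le> real (stepanov_const s D)" by simp
    qed auto
    finally show ?thesis by (simp add: D_def add_increasing)
  qed
qed

text \<open>Stepanov's bound is only an upper bound. But the s classes f(x)^c = a cover all x except
  at most D zeros of f, so the upper bounds for s - 1 of them give a lower bound for the remaining
  one. As the values of \<Omega> over the classes sum to zero, the main term Q / s cancels.\<close>

lemma stepanov_character_sum:
  fixes f :: "'k::alg_closed_field poly" and \<Omega> :: "'k \<Rightarrow> complex"
  assumes f: "f \<noteq> 0" and s: "of_nat s \<noteq> (0 :: 'k)"
    and ord: "\<And>r. 0 < r \<Longrightarrow> r < s \<Longrightarrow> \<exists>t. \<not> s dvd r * order t f"
    and char: "prime CHAR('k)" "Q = CHAR('k) ^ r"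
    and frob: "f ^ Q = pcompose f (monom 1 Q)" and c: "c * s = Q - 1" "c > 0"
    and \<Omega>: "\<Omega> 0 = 0" "(\<Sum>a | a ^ s = 1. \<Omega> a) = 0" "\<And>a. a ^ s = 1 \<Longrightarrow> norm (\<Omega> a) \<le> 1"
  defines "D \<equiv> degree f"
  shows "norm (\<Sum>x | x ^ Q = x. \<Omega> (poly f x ^ c)) \<le>
    real (s * (D + s * stepanov_const s D)) * sqrt (real Q)"
proof -
  define q where "q = sqrt (real Q)"
  define C where "C = real (stepanov_const s D)"
  have s0: "s > 0" using s by (cases s) auto
  have Q1: "Q > 1" using c s0 by (cases s; cases c) auto
  have q1: "q \<ge> 1" using Q1 by (simp add: q_def)
  have "CHAR('k) dvd Q" using char Q1 by (cases r) auto
  then have Q0: "of_nat Q = (0 :: 'k)" by (simp add: of_nat_eq_0_iff_char_dvd)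
  define FQ where "FQ = {x::'k. x ^ Q = x}"
  define U where "U = {a::'k. a ^ s = 1}"
  define N where "N = (\<lambda>a. card {x. x \<in> FQ \<and> poly f x ^ c = a})"
  have cX: "card FQ = Q" unfolding FQ_def by (rule card_fixed_points_power[OF Q0 Q1])
  have cU: "card U = s" unfolding U_def by (rule card_roots_of_unity[OF s])
  have fin: "finite FQ" "finite U" using cX cU Q1 s0 by (auto intro: card_ge_0_finite)
  have "0 \<notin> U" using s0 by (auto simp: U_def power_0_left)
  have img: "poly f x ^ c \<in> insert 0 U" if x: "x \<in> FQ" for x
  proof (cases "poly f x = 0")
    case False
    have "poly f x ^ Q = poly f x"
      using x arg_cong[OF frob, of "\<lambda>p. poly p x"] by (simp add: poly_pcompose poly_monom FQ_def)
    then have "poly f x ^ (Q - 1) = 1" using False Q1 by (cases Q) auto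
    then show ?thesis by (simp add: U_def c flip: power_mult)
  qed (use c(2) in auto)
  have dec: "(\<Sum>x\<in>FQ. g (poly f x ^ c)) = of_nat (N 0) * g 0 + (\<Sum>a\<in>U. of_nat (N a) * g a)" for g :: "'k \<Rightarrow> complex"
  proof -
    have "(\<Sum>x\<in>FQ. g (poly f x ^ c)) = (\<Sum>a\<in>insert 0 U. \<Sum>x | x \<in> FQ \<and> poly f x ^ c = a. g (poly f x ^ c))"
      by (rule sum.group[symmetric]) (use fin in simp, use fin in simp, use img in blast)
    also have "\<dots> = (\<Sum>a\<in>insert 0 U. of_nat (N a) * g a)"
      by (intro sum.cong refl) (simp add: N_def)
    finally show ?thesis using fin \<open>0 \<notin> U\<close> by simp
  qed
  have total: "real (N 0) + (\<Sum>a\<in>U. real (N a)) = real Q"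
  proof -
    have "complex_of_real (real (N 0) + (\<Sum>a\<in>U. real (N a))) = complex_of_real (real Q)"
      using dec[of "\<lambda>_. 1"] by (simp add: cX)
    then show ?thesis by (simp only: of_real_eq_iff)
  qed
  have up: "real (N a) \<le> real Q / real s + C * q" if "a \<in> U" for a
  proof -
    have "N a = card {x. x ^ Q = x \<and> poly f x ^ c = a}" by (simp add: N_def FQ_def)
    then show ?thesis using stepanov_bound[OF f s ord char frob c, of a] that \<open>0 \<notin> U\<close>
      by (auto simp: C_def D_def q_def)
  qed
  have N0: "N 0 \<le> D"
  proof -
    have "N 0 \<le> card {x. poly f x = 0}"
      unfolding N_def using c(2) by (intro card_mono poly_roots_finite f) auto
    then show ?thesis using card_poly_roots_bound[OF f] by (simp add: D_def)
  qed
  have C0: "C * q \<ge> 0" using q1 by (simp add: C_def)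
  have low: "real (N a) \<ge> real Q / real s - (real D + real s * (C * q))" if a: "a \<in> U" for a
  proof -
    have "(\<Sum>b\<in>U - {a}. real (N b)) \<le> (\<Sum>b\<in>U - {a}. real Q / real s + C * q)"
      by (intro sum_mono up) auto
    also have "\<dots> = (real s - 1) * (real Q / real s + C * q)"
      using a fin cU s0 by (simp add: of_nat_diff)
    also have "\<dots> = real Q - real Q / real s + (real s - 1) * (C * q)" using s0 by (simp add: field_simps)
    also have "\<dots> \<le> real Q - real Q / real s + real s * (C * q)" using C0 by (simp add: algebra_simps)
    finally show ?thesis using total N0 sum.remove[OF fin(2) a, of "\<lambda>b. real (N b)"] by linarith
  qed
  define E where "E = real (D + s * stepanov_const s D) * q"
  have dev: "\<bar>real (N a) - real Q / real s\<bar> \<le> E" if a: "a \<in> U" for a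
  proof -
    have "real D * 1 \<le> real D * q" using q1 by (intro mult_left_mono) auto
    then have "real D + real s * (C * q) \<le> E" by (simp add: E_def C_def algebra_simps)
    moreover have "1 * (C * q) \<le> real s * (C * q)" using C0 s0 by (intro mult_right_mono) auto
    ultimately show ?thesis using up[OF a] low[OF a] by linarith
  qed
  have "(\<Sum>x\<in>FQ. \<Omega> (poly f x ^ c)) = (\<Sum>a\<in>U. of_nat (N a) * \<Omega> a) - of_real (real Q / real s) * (\<Sum>a\<in>U. \<Omega> a)"
    using \<Omega>(1,2) by (simp add: dec U_def)
  also have "\<dots> = (\<Sum>a\<in>U. of_real (real (N a) - real Q / real s) * \<Omega> a)"
    by (simp add: sum_distrib_left left_diff_distrib sum_subtractf)
  finally have "norm (\<Sum>x\<in>FQ. \<Omega> (poly f x ^ c)) \<le> (\<Sum>a\<in>U. norm (of_real (real (N a) - real Q / real s) * \<Omega> a))"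
    by (simp only: norm_sum)
  also have "\<dots> \<le> (\<Sum>a\<in>U. E * 1)"
    unfolding norm_mult norm_of_real
  proof (intro sum_mono mult_mono dev)
    fix a assume "a \<in> U"
    then show "0 \<le> E" using dev by force
  qed (use \<Omega>(3) in \<open>auto simp: U_def\<close>)
  also have "\<dots> = real (s * (D + s * stepanov_const s D)) * q" by (simp add: cU E_def)
  finally show ?thesis by (simp add: FQ_def q_def)
qed

subsection \<open>Frobenius orbits in the algebraic closure\<close>

lemma prime_CHAR_finite_field: "prime CHAR('a::{field,finite})"
  by (rule prime_CHAR_semidom) (rule finite_imp_CHAR_pos, simp)

lemma card_field_eq_CHAR_power:
  assumes "primepow (card (UNIV :: 'a::{field,finite} set))"
  shows "\<exists>k>0. card (UNIV :: 'a set) = CHAR('a) ^ k"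
proof -
  obtain r k where rk: "prime r" "k > 0" "card (UNIV :: 'a set) = r ^ k"
    using assms by (auto simp: primepow_def)
  have "CHAR('a) dvd r ^ k" using CHAR_dvd_CARD[where 'a = 'a] rk by simp
  then have "CHAR('a) dvd r" by (rule prime_dvd_power[OF prime_CHAR_finite_field])
  then have "CHAR('a) = r" using rk prime_CHAR_finite_field[where 'a = 'a]
    by (simp add: primes_dvd_imp_eq)
  with rk show ?thesis by auto
qed

lemma power_card_minus_1_eq_1:
  fixes x :: "'a::{field,finite}"
  assumes "x \<noteq> 0"
  shows "x ^ (card (UNIV :: 'a set) - 1) = 1"
proof -
  have "(\<lambda>y. x * y) ` (UNIV - {0}) = UNIV - {0}"
  proof (intro equalityI subsetI)
    fix y :: 'a assume "y \<in> UNIV - {0}"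
    then show "y \<in> (\<lambda>y. x * y) ` (UNIV - {0})" using assms by (intro image_eqI[of _ _ "y / x"]) auto
  qed (use assms in auto)
  then have "(\<Prod>y\<in>UNIV - {0}. y) = (\<Prod>y\<in>(\<lambda>y. x * y) ` (UNIV - {0}). y)" by simp
  also have "\<dots> = (\<Prod>y\<in>UNIV - {0}. x * y)"
    by (subst prod.reindex) (use assms in \<open>auto simp: inj_on_def\<close>)
  also have "\<dots> = x ^ (card (UNIV :: 'a set) - 1) * (\<Prod>y\<in>UNIV - {0}. y)"
    by (simp add: prod.distrib card_Diff_singleton)
  finally show ?thesis by (simp add: prod_zero_iff)
qed

lemma power_card_eq_same:
  fixes x :: "'a::{field,finite}"
  shows "x ^ card (UNIV :: 'a set) = x"
proof (cases "x = 0")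
  case False
  have "card (UNIV :: 'a set) = Suc (card (UNIV :: 'a set) - 1)" by (simp add: card_gt_0_iff)
  then show ?thesis using power_card_minus_1_eq_1[OF False] by (metis mult.right_neutral power_Suc)
qed (simp add: card_gt_0_iff power_0_left)

context
  fixes q :: nat
  assumes q_def: "q = card (UNIV :: 'a::{field,finite} set)" and ppow: "primepow q"
begin

lemma q_gt_1: "q > 1"
  using ppow by (simp add: primepow_gt_Suc_0)

lemma frobenius_add:
  fixes x y :: "'k::comm_ring_1"
  assumes "CHAR('k) = CHAR('a)"
  shows "(x + y) ^ (q ^ n) = x ^ (q ^ n) + y ^ (q ^ n)"
proof -
  obtain k where k: "q = CHAR('a) ^ k" using card_field_eq_CHAR_power[where 'a = 'a] ppow q_def by auto
  show ?thesis
    by (rule freshmans_dream'[of _ "k * n"]) (simp_all add: assms prime_CHAR_finite_field k power_mult)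
qed

lemma of_nat_q:
  assumes "CHAR('k::comm_ring_1) = CHAR('a)" "n > 0"
  shows "of_nat (q ^ n) = (0 :: 'k)"
proof -
  have "CHAR('k) dvd q" using CHAR_dvd_CARD[where 'a = 'a] assms by (simp add: q_def)
  then have "of_nat q = (0 :: 'k)" by (simp add: of_nat_eq_0_iff_char_dvd)
  then show ?thesis using assms by (simp add: power_0_left)
qed

lemma power_q_base: "(x :: 'a) ^ q = x"
  using power_card_eq_same[of x] by (simp add: q_def)

lemma to_ac_power_q_power: "to_ac (x :: 'a) ^ (q ^ j) = to_ac x"
  by (induction j) (simp_all add: power_mult power_q_base mult.commute[of q] flip: to_ac_power)

lemma of_nat_neq_0_if_dvd:
  assumes "s dvd q - 1"
  shows "of_nat s \<noteq> (0 :: 'a alg_closure)"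
proof
  assume "of_nat s = (0 :: 'a alg_closure)"
  then have "CHAR('a) dvd s" by (simp add: of_nat_eq_0_iff_char_dvd)
  then have *: "CHAR('a) dvd q - 1" using assms by (rule dvd_trans)
  have "CHAR('a) dvd q" using CHAR_dvd_CARD[where 'a = 'a] by (simp add: q_def)
  then have "CHAR('a) dvd q - (q - 1)" using * by (rule dvd_diff_nat)
  then show False using q_gt_1 prime_CHAR_finite_field[where 'a = 'a] by auto
qed

lemma card_frobenius_fixed:
  "n > 0 \<Longrightarrow> card {x :: 'a alg_closure. x ^ (q ^ n) = x} = q ^ n"
  by (rule card_fixed_points_power[OF of_nat_q]) (use one_less_power[OF q_gt_1] in auto)

lemma finite_frobenius_fixed:
  "n > 0 \<Longrightarrow> finite {x :: 'a alg_closure. x ^ (q ^ n) = x}"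
  using card_frobenius_fixed[of n] q_gt_1 by (intro card_ge_0_finite) auto

text \<open>The base field already provides all q roots of X^q - X.\<close>

lemma frobenius_fixed_imp_base:
  fixes y :: "'a alg_closure"
  assumes "y ^ q = y"
  shows "y \<in> range to_ac"
proof -
  have "range to_ac \<subseteq> {x :: 'a alg_closure. x ^ (q ^ 1) = x}"
    by (auto simp: power_q_base simp flip: to_ac_power)
  moreover have "card (range (to_ac :: 'a \<Rightarrow> _)) = q"
    by (subst card_image) (auto simp: inj_to_ac q_def)
  ultimately have "range to_ac = {x :: 'a alg_closure. x ^ (q ^ 1) = x}"
    using card_frobenius_fixed[of 1] finite_frobenius_fixed[of 1] by (intro card_subset_eq) auto
  then show ?thesis using assms by auto
qed

lemma frobenius_inj:
  fixes x y :: "'k::field"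
  assumes "CHAR('k) = CHAR('a)" "x ^ (q ^ n) = y ^ (q ^ n)"
  shows "x = y"
proof -
  have "x ^ (q ^ n) = (x - y) ^ (q ^ n) + y ^ (q ^ n)"
    using frobenius_add[OF assms(1), of "x - y" y n] by simp
  then have "(x - y) ^ (q ^ n) = 0" using assms(2) by simp
  then show ?thesis by simp
qed

text \<open>For Galois descent: the polynomials fixed by this map are those with coefficients in the
  base field.\<close>

definition frob_poly :: "'a alg_closure poly \<Rightarrow> 'a alg_closure poly" where
  "frob_poly = map_poly (\<lambda>a. a ^ q)"

lemma frob_poly_hom:
  "frob_poly (p * r) = frob_poly p * frob_poly r" "frob_poly 1 = 1"
  "frob_poly (prod g I) = (\<Prod>i\<in>I. frob_poly (g i))"
proof -
  have h: "(0 :: 'a alg_closure) ^ q = 0" "1 ^ q = (1 :: 'a alg_closure)"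
    "(a + b) ^ q = a ^ q + b ^ q" "(a * b) ^ q = a ^ q * b ^ q" for a b :: "'a alg_closure"
    using q_gt_1 frobenius_add[of a b 1] by (auto simp: power_mult_distrib power_0_left)
  show "frob_poly (p * r) = frob_poly p * frob_poly r"
    unfolding frob_poly_def by (rule map_poly_hom_mult[OF h(1,3,4)])
  show "frob_poly 1 = 1" unfolding frob_poly_def using h by (simp add: map_poly_1')
  show "frob_poly (prod g I) = (\<Prod>i\<in>I. frob_poly (g i))"
    unfolding frob_poly_def by (rule map_poly_hom_prod[OF h])
qed

lemma frob_poly_linear: "frob_poly [:- y, 1:] = [:- (y ^ q), 1:]"
proof -
  have "(y + (- y)) ^ (q ^ 1) = y ^ (q ^ 1) + (- y) ^ (q ^ 1)" by (rule frobenius_add) simp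
  then have "(- y) ^ q = - (y ^ q)" using q_gt_1 by (simp add: power_0_left add_eq_0_iff)
  then show ?thesis using q_gt_1 by (simp add: frob_poly_def map_poly_pCons)
qed

lemma frob_poly_base: "frob_poly (map_poly to_ac F) = map_poly to_ac F"
  using q_gt_1
  by (intro poly_eqI) (simp add: frob_poly_def coeff_map_poly power_q_base flip: to_ac_power)

lemma frob_poly_fixed_imp_base:
  assumes "frob_poly G = G"
  shows "\<exists>F. map_poly to_ac F = G"
proof -
  have "coeff G n ^ q = coeff G n" for n
    using arg_cong[OF assms, of "\<lambda>p. coeff p n"] q_gt_1 by (simp add: frob_poly_def coeff_map_poly)
  then have "coeff G n \<in> range to_ac" for n by (rule frobenius_fixed_imp_base)
  then have "to_ac (of_ac (coeff G n)) = coeff G n" for n by (rule to_ac_of_ac)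
  then have "map_poly to_ac (map_poly of_ac G) = G"
    by (intro poly_eqI) (simp add: coeff_map_poly)
  then show ?thesis by blast
qed

text \<open>Division with remainder survives field extension, and a remainder of smaller degree that
  \<open>P\<close> divides over the closure is zero.\<close>

lemma map_poly_to_ac_dvd_iff:
  fixes F P :: "'a poly"
  shows "map_poly to_ac P dvd map_poly to_ac F \<longleftrightarrow> P dvd F"
proof
  assume "P dvd F"
  then show "map_poly to_ac P dvd map_poly to_ac F" by (auto simp: map_poly_to_ac_mult elim!: dvdE)
next
  assume *: "map_poly to_ac P dvd map_poly to_ac F"
  show "P dvd F"
  proof (cases "P = 0")
    case False
    have "map_poly to_ac F = map_poly to_ac (P * (F div P) + F mod P)" by simp
    also have "\<dots> = map_poly to_ac P * map_poly to_ac (F div P) + map_poly to_ac (F mod P)"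
      by (simp only: map_poly_to_ac_add map_poly_to_ac_mult)
    finally have "map_poly to_ac P dvd map_poly to_ac (F mod P)"
      using * by (metis dvd_add_right_iff dvd_triv_left)
    moreover have "F mod P = 0 \<or> degree (F mod P) < degree P"
      using degree_mod_less[OF False] .
    ultimately have "F mod P = 0"
      by (metis degree_map_poly_to_ac dvd_imp_degree_le map_poly_to_ac_eq_0_iff not_le)
    then show ?thesis by (simp add: mod_eq_0_iff_dvd)
  qed (use * in simp)
qed

text \<open>The degree of \<open>y\<close> over the base field, read off as the length of its
  Frobenius orbit; meaningful under \<open>frob_periodic\<close>.\<close>

definition frob_period :: "'a alg_closure \<Rightarrow> nat" where
  "frob_period y = (LEAST r. r > 0 \<and> y ^ (q ^ r) = y)"

definition frob_periodic :: "'a alg_closure \<Rightarrow> bool" where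
  "frob_periodic y \<longleftrightarrow> (\<exists>r>0. y ^ (q ^ r) = y)"

lemma frob_period:
  assumes "frob_periodic y"
  shows "frob_period y > 0" "y ^ (q ^ frob_period y) = y"
  using LeastI_ex[of "\<lambda>r. r > 0 \<and> y ^ (q ^ r) = y"] assms
  unfolding frob_period_def frob_periodic_def by blast+

lemma finite_frob_period_le: "finite {y. frob_periodic y \<and> frob_period y \<le> n}"
proof (rule finite_subset)
  show "{y. frob_periodic y \<and> frob_period y \<le> n} \<subseteq> (\<Union>r\<in>{1..n}. {y. y ^ (q ^ r) = y})"
    using frob_period by (force simp: Suc_le_eq)
qed (use finite_frobenius_fixed in auto)

lemma frob_power_mod:
  fixes y :: "'a alg_closure"
  assumes y: "y ^ (q ^ r) = y"
  shows "y ^ (q ^ (r * m + j)) = y ^ (q ^ j)"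
proof -
  have "y ^ (q ^ (r * m)) = y"
    by (induction m) (auto simp: power_add power_mult y)
  then show ?thesis by (simp add: power_add power_mult)
qed

lemma frob_period_dvd_iff:
  assumes "frob_periodic y"
  shows "y ^ (q ^ n) = y \<longleftrightarrow> frob_period y dvd n"
proof
  let ?r = "frob_period y"
  note r = frob_period[OF assms]
  assume "y ^ (q ^ n) = y"
  moreover have "y ^ (q ^ n) = y ^ (q ^ (n mod ?r))"
    using frob_power_mod[OF r(2), of "n div ?r" "n mod ?r"] by simp
  ultimately have "y ^ (q ^ (n mod ?r)) = y" by simp
  moreover have "n mod ?r < (LEAST r. r > 0 \<and> y ^ (q ^ r) = y)"
    using r(1) unfolding frob_period_def by (intro mod_less_divisor)
  then have "\<not> (n mod ?r > 0 \<and> y ^ (q ^ (n mod ?r)) = y)" by (rule not_less_Least)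
  ultimately have "\<not> n mod ?r > 0" by metis
  then show "?r dvd n" by auto
next
  assume "frob_period y dvd n"
  then show "y ^ (q ^ n) = y"
    using frob_power_mod[OF frob_period(2)[OF assms], of _ 0] by (auto elim!: dvdE)
qed

lemma frob_conjugates_inj:
  assumes "frob_periodic y"
  shows "inj_on (\<lambda>j. y ^ (q ^ j)) {..<frob_period y}"
proof (rule linorder_inj_onI)
  fix i j :: nat assume ij: "i < j" "i \<in> {..<frob_period y}" "j \<in> {..<frob_period y}"
  show "y ^ (q ^ i) \<noteq> y ^ (q ^ j)"
  proof
    assume "y ^ (q ^ i) = y ^ (q ^ j)"
    also have "y ^ (q ^ j) = (y ^ (q ^ (j - i))) ^ (q ^ i)"
      using ij(1) by (simp flip: power_mult power_add)
    finally have "y = y ^ (q ^ (j - i))" by (rule frobenius_inj[OF CHAR_alg_closure])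
    then have "frob_period y dvd j - i" using frob_period_dvd_iff[OF assms] by metis
    then show False using ij by (auto dest: dvd_imp_le)
  qed
qed auto

text \<open>Frobenius shifts the linear factors cyclically, so the product is fixed and descends to
  the base field. It is the minimal polynomial of \<open>y\<close>.\<close>

lemma exists_conj_poly:
  assumes "frob_periodic y"
  shows "\<exists>P :: 'a poly. map_poly to_ac P = (\<Prod>j<frob_period y. [:- (y ^ (q ^ j)), 1:])"
proof (rule frob_poly_fixed_imp_base)
  let ?r = "frob_period y"
  note r = frob_period[OF assms]
  have "frob_poly (\<Prod>j<?r. [:- (y ^ (q ^ j)), 1:]) = (\<Prod>j<?r. [:- (y ^ (q ^ Suc j)), 1:])"
    by (simp add: frob_poly_hom frob_poly_linear mult.commute flip: power_mult)
  also have "\<dots> = (\<Prod>j\<in>Suc ` {..<?r}. [:- (y ^ (q ^ j)), 1:])"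
    by (subst prod.reindex) auto
  also have "Suc ` {..<?r} = insert ?r ({..<?r} - {0})"
    unfolding image_Suc_lessThan using r(1) by auto
  also have "(\<Prod>j\<in>insert ?r ({..<?r} - {0}). [:- (y ^ (q ^ j)), 1:]) =
      [:- (y ^ (q ^ ?r)), 1:] * (\<Prod>j\<in>{..<?r} - {0}. [:- (y ^ (q ^ j)), 1:])"
    by (subst prod.insert) auto
  also have "[:- (y ^ (q ^ ?r)), 1:] = [:- (y ^ (q ^ 0)), 1:]" using r by simp
  also have "\<dots> * (\<Prod>j\<in>{..<?r} - {0}. [:- (y ^ (q ^ j)), 1:]) = (\<Prod>j<?r. [:- (y ^ (q ^ j)), 1:])"
    using r(1) by (subst prod.remove[of "{..<?r}" 0]) auto
  finally show "frob_poly (\<Prod>j<?r. [:- (y ^ (q ^ j)), 1:]) = (\<Prod>j<?r. [:- (y ^ (q ^ j)), 1:])" .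
qed

definition conj_poly :: "'a alg_closure \<Rightarrow> 'a poly" where
  "conj_poly y = (SOME P. map_poly to_ac P = (\<Prod>j<frob_period y. [:- (y ^ (q ^ j)), 1:]))"

lemma map_conj_poly:
  "frob_periodic y \<Longrightarrow> map_poly to_ac (conj_poly y) = (\<Prod>j<frob_period y. [:- (y ^ (q ^ j)), 1:])"
  unfolding conj_poly_def by (rule someI_ex[OF exists_conj_poly])

lemma conj_poly_monic:
  assumes "frob_periodic y"
  shows "degree (conj_poly y) = frob_period y" "lead_coeff (conj_poly y) = 1"
proof -
  have "degree (map_poly to_ac (conj_poly y)) = frob_period y"
    unfolding map_conj_poly[OF assms] by (subst degree_prod_eq_sum_degree) auto
  then show d: "degree (conj_poly y) = frob_period y" by simp
  have "to_ac (lead_coeff (conj_poly y)) = lead_coeff (map_poly to_ac (conj_poly y))"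
    by (simp add: coeff_map_poly)
  also have "\<dots> = 1" unfolding map_conj_poly[OF assms] by (simp add: lead_coeff_prod)
  finally show "lead_coeff (conj_poly y) = 1" by (simp flip: to_ac_1)
qed

text \<open>Applying Frobenius to the coefficients shows that a polynomial over the base field
  vanishes to the same order at all conjugates of \<open>y\<close>. These are distinct, so the order
  at \<open>y\<close> decides.\<close>

lemma conj_poly_power_dvd_iff:
  assumes "frob_periodic y"
  shows "conj_poly y ^ k dvd F \<longleftrightarrow> [:- y, 1:] ^ k dvd map_poly to_ac F"
proof -
  let ?r = "frob_period y"
  note r = frob_period[OF assms]
  have pow: "map_poly to_ac (conj_poly y ^ k) = (\<Prod>j<?r. [:- (y ^ (q ^ j)), 1:] ^ k)"
  proof -
    have "map_poly to_ac (p ^ k) = map_poly to_ac p ^ k" for p :: "'a poly"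
      by (induction k) (auto simp: map_poly_to_ac_mult)
    then show ?thesis by (simp add: map_conj_poly[OF assms] prod_power_distrib)
  qed
  show ?thesis
  proof
    assume "conj_poly y ^ k dvd F"
    then have "(\<Prod>j<?r. [:- (y ^ (q ^ j)), 1:] ^ k) dvd map_poly to_ac F"
      unfolding pow[symmetric] map_poly_to_ac_dvd_iff .
    moreover have "[:- (y ^ (q ^ 0)), 1:] ^ k dvd (\<Prod>j<?r. [:- (y ^ (q ^ j)), 1:] ^ k)"
      using r(1) by (intro dvd_prodI) auto
    ultimately show "[:- y, 1:] ^ k dvd map_poly to_ac F" by (auto intro: dvd_trans)
  next
    assume y: "[:- y, 1:] ^ k dvd map_poly to_ac F"
    have conj: "[:- (y ^ (q ^ j)), 1:] ^ k dvd map_poly to_ac F" for j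
    proof (induction j)
      case (Suc j)
      then obtain G where G: "map_poly to_ac F = [:- (y ^ (q ^ j)), 1:] ^ k * G" by (auto elim!: dvdE)
      have powf: "frob_poly (p ^ k) = frob_poly p ^ k" for p
        by (induction k) (auto simp: frob_poly_hom)
      have "map_poly to_ac F = frob_poly ([:- (y ^ (q ^ j)), 1:] ^ k * G)"
        by (simp add: frob_poly_base flip: G)
      also have "\<dots> = [:- (y ^ (q ^ Suc j)), 1:] ^ k * frob_poly G"
        by (simp add: frob_poly_hom powf frob_poly_linear mult.commute flip: power_mult)
      finally show ?case by (metis dvd_triv_left)
    qed (use y in simp)
    let ?Z = "(\<lambda>j. y ^ (q ^ j)) ` {..<?r}"
    have "(\<Prod>x\<in>?Z. [:-x, 1:] ^ k) dvd map_poly to_ac F"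
      by (rule prod_linear_powers_dvd) (use conj in auto)
    also have "(\<Prod>x\<in>?Z. [:-x, 1:] ^ k) = (\<Prod>j<?r. [:- (y ^ (q ^ j)), 1:] ^ k)"
      by (subst prod.reindex[OF frob_conjugates_inj[OF assms]]) simp
    finally show "conj_poly y ^ k dvd F" unfolding pow[symmetric] map_poly_to_ac_dvd_iff .
  qed
qed

text \<open>Frobenius maps roots of F to roots, so two iterates of \<open>y\<close> agree;
  injectivity of Frobenius cancels their common part.\<close>

lemma root_frob_periodic:
  assumes "F \<noteq> 0" "poly (map_poly to_ac F) y = 0"
  shows "frob_periodic y"
proof -
  let ?R = "{z. poly (map_poly to_ac F) z = 0}"
  have "poly (map_poly to_ac F) (y ^ (q ^ j)) = 0" for j
  proof (induction j)
    case (Suc j)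
    have "poly (frob_poly p) (x ^ q) = poly p x ^ q" for p and x :: "'a alg_closure"
      unfolding frob_poly_def
      by (rule poly_map_poly_hom) (use q_gt_1 frobenius_add[where 'k = "'a alg_closure" and n = 1] in \<open>auto simp: power_mult_distrib\<close>)
    from this[of "map_poly to_ac F" "y ^ (q ^ j)"] show ?case
      using Suc q_gt_1 by (simp add: frob_poly_base mult.commute flip: power_mult)
  qed (use assms in simp)
  then have "range (\<lambda>j. y ^ (q ^ j)) \<subseteq> ?R" by auto
  moreover have "finite ?R" using assms by (intro poly_roots_finite) simp
  ultimately have "\<not> inj (\<lambda>j. y ^ (q ^ j))"
    using finite_subset range_inj_infinite by blast
  then obtain i j where ij: "i < j" "y ^ (q ^ i) = y ^ (q ^ j)"
    by (metis linorder_injI)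
  have "y ^ (q ^ j) = (y ^ (q ^ (j - i))) ^ (q ^ i)" using ij(1) by (simp flip: power_mult power_add)
  with ij(2) have "y ^ (q ^ i) = (y ^ (q ^ (j - i))) ^ (q ^ i)" by (rule trans)
  then have "y = y ^ (q ^ (j - i))" by (rule frobenius_inj[OF CHAR_alg_closure])
  moreover have "j - i > 0" using ij(1) by simp
  ultimately show ?thesis unfolding frob_periodic_def by metis
qed

end

subsection \<open>Newton's identities\<close>

lemma sum_order_eq_degree:
  fixes p :: "'k::alg_closed_field poly"
  assumes "p \<noteq> 0" "finite Y" "{y. poly p y = 0} \<subseteq> Y"
  shows "(\<Sum>y\<in>Y. order y p) = degree p"
proof -
  obtain A where A: "size A = degree p" "p = smult (lead_coeff p) (\<Prod>x\<in>#A. [:-x, 1:])"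
    using alg_closed_imp_factorization[OF assms(1)] by blast
  have ord: "order y (\<Prod>x\<in>#B. [:-x, 1:]) = count B y" for y and B :: "'k multiset"
  proof (induction B)
    case (add x B)
    have "(\<Prod>x\<in>#B. [:-x, 1:]) \<noteq> 0" by (auto simp: prod_mset_zero_iff)
    then have "order y ([:-x, 1:] * (\<Prod>x\<in>#B. [:-x, 1:])) =
        order y [:-x, 1:] + order y (\<Prod>x\<in>#B. [:-x, 1:])"
      by (intro order_mult no_zero_divisors) simp
    moreover have "order y [:-x, 1:] = (if x = y then 1 else 0)"
      using order_power_n_n[of y 1] order_0I[of "[:-x, 1:]" y] by auto
    ultimately show ?case using add by auto
  qed (simp add: order_0I)
  have ordp: "order y p = count A y" for y
    using ord[of y A] assms(1) by (subst A(2)) (simp add: order_smult)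
  have roots: "{y. poly p y = 0} = set_mset A"
    by (subst A(2)) (use assms(1) in \<open>auto simp: poly_prod_mset prod_mset_zero_iff\<close>)
  have "(\<Sum>y\<in>Y. order y p) = (\<Sum>y\<in>set_mset A. count A y)"
    unfolding ordp using assms roots by (intro sum.mono_neutral_right) (auto simp: count_eq_zero_iff)
  then show ?thesis using A(1) by (simp add: size_multiset_overloaded_eq)
qed

text \<open>Such a polynomial is the product of the 1 - z / \<rho> over its roots \<rho>, so the
  coefficient of z is minus the sum of the 1 / \<rho>, each of norm at most R.\<close>

lemma inverse_roots_bound:
  fixes p :: "complex poly"
  assumes "poly p 0 = 1" "R > 0" "\<And>z. poly p z = 0 \<Longrightarrow> norm z \<ge> 1 / R"
  shows "norm (coeff p 1) \<le> real (degree p) * R"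
  using assms(1,3)
proof (induction "degree p" arbitrary: p)
  case 0
  then show ?case by (simp add: coeff_eq_0)
next
  case (Suc n)
  then obtain z where z: "poly p z = 0" using alg_closed_imp_poly_has_root[of p] by auto
  have zR: "norm z \<ge> 1 / R" using Suc z by blast
  then have "norm z > 0" using \<open>R > 0\<close> by (meson less_le_trans zero_less_divide_1_iff)
  then have "z \<noteq> 0" by auto
  obtain r where r: "p = [:-z, 1:] * r" using z by (auto simp: poly_eq_0_iff_dvd elim: dvdE)
  define p2 where "p2 = smult (- z) r"
  have "smult (- z) [:1, - 1 / z:] = [:-z, 1:]" using \<open>z \<noteq> 0\<close> by simp
  then have p: "p = [:1, - 1 / z:] * p2" unfolding r p2_def by (metis mult_smult_left mult_smult_right)
  have "p2 \<noteq> 0" using Suc p by auto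
  then have "degree p = Suc (degree p2)"
    using \<open>z \<noteq> 0\<close> unfolding p by (subst degree_mult_eq) auto
  then have deg: "n = degree p2" using Suc.hyps by simp
  have "poly p2 0 = 1" using Suc.prems by (simp add: p)
  moreover have "norm w \<ge> 1 / R" if "poly p2 w = 0" for w using Suc.prems(2)[of w] that by (simp add: p)
  ultimately have IH: "norm (coeff p2 1) \<le> real (degree p2) * R"
    by (intro Suc.hyps(1)[OF deg])
  have "coeff p 1 = coeff p2 1 - 1 / z * coeff p2 0" by (simp add: p)
  also have "coeff p2 0 = 1" using \<open>poly p2 0 = 1\<close> by (simp add: poly_0_coeff_0)
  finally have "norm (coeff p 1) \<le> norm (coeff p2 1) + norm (1 / z)" by (simp add: norm_triangle_ineq4)
  also have "norm (1 / z) \<le> R" using zR \<open>R > 0\<close> \<open>norm z > 0\<close> by (simp add: norm_divide field_simps)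
  finally show ?case using IH Suc.hyps(2) deg by (simp add: algebra_simps flip: Suc.hyps(2))
qed

text \<open>
  Newton's identities say that \<open>L' = L \<cdot> \<Sum>\<nu>. S (\<nu> + 1) z\<^sup>\<nu>\<close>. The series converges for
  \<open>\<bar>z\<bar> < 1 / R\<close>, so the polynomial \<open>L\<close> has no zero there.
\<close>

lemma newton_identities_bound:
  fixes A S :: "nat \<Rightarrow> complex"
  assumes A: "A 0 = 1" "\<And>n. n \<ge> h \<Longrightarrow> A n = 0" and h: "h > 0"
    and newton: "\<And>n. of_nat n * A n = (\<Sum>\<nu>=1..n. S \<nu> * A (n - \<nu>))"
    and S: "\<And>n. n > 0 \<Longrightarrow> norm (S n) \<le> C * R ^ n" and R: "R > 0"
  shows "norm (A 1) \<le> real (h - 1) * R"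
proof -
  define L where "L = (\<Sum>n<h. monom (A n) n)"
  have coeff_L: "coeff L n = A n" for n
    using A(2)[of n] by (simp add: L_def coeff_sum sum.delta)
  have degL: "degree L \<le> h - 1"
    by (intro degree_le) (use A(2) h in \<open>auto simp: coeff_L\<close>)
  have L0: "poly L 0 = 1" by (simp add: poly_0_coeff_0 coeff_L A(1))
  then have "L \<noteq> 0" by auto
  define g where "g = (\<lambda>z. \<Sum>\<nu>. S (\<nu> + 1) * z ^ \<nu>)"
  have C: "C \<ge> 0"
  proof -
    have "0 \<le> C * R ^ 1" using order_trans[OF norm_ge_zero S[of 1]] by simp
    then show ?thesis using R by (simp add: zero_le_mult_iff)
  qed
  have Sb: "norm (S (\<nu> + 1) * z ^ \<nu>) \<le> (C * R) * (R * r) ^ \<nu>" if "norm z \<le> r" for z \<nu> r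
  proof -
    have "norm (S (\<nu> + 1)) * norm z ^ \<nu> \<le> (C * R ^ (\<nu> + 1)) * r ^ \<nu>"
      using S[of "\<nu> + 1"] that C R by (intro mult_mono power_mono) auto
    then show ?thesis by (simp add: norm_mult norm_power power_mult_distrib mult_ac)
  qed
  have geo: "summable (\<lambda>\<nu>. (C * R) * (R * r) ^ \<nu>)" if "r \<ge> 0" "R * r < 1" for r
    using that R by (intro summable_mult summable_geometric) auto
  have deriv: "poly (pderiv L) z = g z * poly L z" if z: "R * norm z < 1" for z
  proof -
    have s1: "summable (\<lambda>\<nu>. norm (S (\<nu> + 1) * z ^ \<nu>))"
      by (rule summable_comparison_test'[OF geo[OF _ z]]) (use Sb[of z "norm z"] in auto)
    have s2: "summable (\<lambda>n. norm (A n * z ^ n))"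
      by (rule summable_finite[of "{..<h}"]) (use A(2) in auto)
    have "(\<lambda>n. \<Sum>i\<le>n. (S (i + 1) * z ^ i) * (A (n - i) * z ^ (n - i))) sums
        ((\<Sum>\<nu>. S (\<nu> + 1) * z ^ \<nu>) * (\<Sum>n. A n * z ^ n))"
      by (rule Cauchy_product_sums[OF s1 s2])
    also have "(\<Sum>n. A n * z ^ n) = poly L z"
    proof -
      have "(\<Sum>n. A n * z ^ n) = (\<Sum>n<h. A n * z ^ n)"
        by (rule suminf_finite) (use A(2) in auto)
      then show ?thesis by (simp add: L_def poly_sum poly_monom)
    qed
    also have "(\<lambda>n. \<Sum>i\<le>n. (S (i + 1) * z ^ i) * (A (n - i) * z ^ (n - i))) =
        (\<lambda>n. coeff (pderiv L) n * z ^ n)"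
    proof
      fix n
      have "(\<Sum>i\<le>n. (S (i + 1) * z ^ i) * (A (n - i) * z ^ (n - i))) = (\<Sum>i\<le>n. S (i + 1) * A (n - i)) * z ^ n"
        unfolding sum_distrib_right
      proof (intro sum.cong refl)
        fix i assume "i \<in> {..n}"
        then have "z ^ n = z ^ i * z ^ (n - i)" by (simp flip: power_add)
        then show "(S (i + 1) * z ^ i) * (A (n - i) * z ^ (n - i)) = S (i + 1) * A (n - i) * z ^ n" by simp
      qed
      also have "(\<Sum>i\<le>n. S (i + 1) * A (n - i)) = (\<Sum>\<nu>=1..Suc n. S \<nu> * A (Suc n - \<nu>))"
        by (rule sum.reindex_bij_witness[of _ "\<lambda>\<nu>. \<nu> - 1" "\<lambda>i. i + 1"]) auto
      also have "\<dots> = coeff (pderiv L) n" using newton[of "Suc n"] by (simp add: coeff_pderiv coeff_L)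
      finally show "(\<Sum>i\<le>n. (S (i + 1) * z ^ i) * (A (n - i) * z ^ (n - i))) = coeff (pderiv L) n * z ^ n" .
    qed
    finally have "(\<lambda>n. coeff (pderiv L) n * z ^ n) sums (g z * poly L z)" by (simp add: g_def)
    moreover have "(\<lambda>n. coeff (pderiv L) n * z ^ n) sums poly (pderiv L) z"
      unfolding poly_altdef by (rule sums_finite) (auto intro: coeff_eq_0 simp: not_le)
    ultimately show ?thesis by (rule sums_unique2[symmetric])
  qed
  have "norm w \<ge> 1 / R" if w: "poly L w = 0" for w
  proof (rule ccontr)
    assume "\<not> norm w \<ge> 1 / R"
    then have "norm w < 1 / R" by simp
    then obtain r where r: "norm w < r" "r < 1 / R" using dense by blast
    have r0: "r \<ge> 0" using r(1) norm_ge_zero[of w] by linarith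
    have Rr: "R * r < 1" using r(2) R by (simp add: field_simps)
    define G where "G = (\<Sum>\<nu>. (C * R) * (R * r) ^ \<nu>)"
    have gG: "norm (g z) \<le> G" if "norm z \<le> r" for z
      unfolding g_def G_def
    proof (rule norm_suminf_le)
      show "summable (\<lambda>\<nu>. (C * R) * (R * r) ^ \<nu>)" by (rule geo[OF r0 Rr])
    qed (rule Sb[OF that])
    \<comment> \<open>At a zero of order k > 0 the quotient L' / L has a pole k / (z - w), whereas
      \<open>g\<close> is bounded by \<open>G\<close> near w. The function \<open>D\<close> below
      expresses this without quotients: D z \<le> 0 for z \<noteq> w near w, yet D w = k |M(w)| >
      0.\<close>
    define k where "k = order w L"
    have k: "k > 0" using w \<open>L \<noteq> 0\<close> by (simp add: k_def order_root)
    obtain M where M: "L = [:-w, 1:] ^ k * M" "\<not> [:-w, 1:] dvd M"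
      using order_decomp[OF \<open>L \<noteq> 0\<close>, of w] by (auto simp: k_def)
    have Mw: "poly M w \<noteq> 0" using M(2) by (simp add: poly_eq_0_iff_dvd)
    have eq: "of_nat k * poly M z + (z - w) * poly (pderiv M) z = g z * ((z - w) * poly M z)"
      if z: "z \<noteq> w" "norm z \<le> r" for z
    proof -
      have "R * norm z \<le> R * r" using z(2) R by simp
      then have d: "poly (pderiv L) z = g z * poly L z" using Rr by (intro deriv) linarith
      obtain m where m: "k = Suc m" using k by (cases k) auto
      have "poly (pderiv L) z = (z - w) ^ m * (of_nat k * poly M z + (z - w) * poly (pderiv M) z)"
        unfolding M(1) m pderiv_mult pderiv_power_Suc
        by (simp add: poly_power pderiv_pCons algebra_simps)
      moreover have "poly L z = (z - w) ^ m * ((z - w) * poly M z)"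
        unfolding M(1) m by (simp add: poly_power algebra_simps)
      ultimately have "(z - w) ^ m * (of_nat k * poly M z + (z - w) * poly (pderiv M) z) =
          (z - w) ^ m * (g z * ((z - w) * poly M z))" using d by (simp only: mult_ac)
      then show ?thesis using z(1) by simp
    qed
    define D where "D = (\<lambda>z. norm (of_nat k * poly M z + (z - w) * poly (pderiv M) z) - G * norm ((z - w) * poly M z))"
    have "(D \<longlongrightarrow> D w) (at w)" unfolding D_def by (intro tendsto_intros)
    moreover have "\<forall>\<^sub>F z in at w. D z \<le> 0"
    proof -
      have "\<forall>\<^sub>F z in at w. norm z < r"
        using order_tendstoD(2)[OF tendsto_norm[OF tendsto_ident_at] r(1)] .
      then show ?thesis
        using eventually_neq_at_within[of w w UNIV]
      proof eventually_elim
        case (elim z)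
        then have "norm (of_nat k * poly M z + (z - w) * poly (pderiv M) z) = norm (g z) * norm ((z - w) * poly M z)"
          using eq[of z] by (simp add: norm_mult)
        also have "\<dots> \<le> G * norm ((z - w) * poly M z)" using elim by (intro mult_right_mono gG) auto
        finally show ?case by (simp add: D_def)
      qed
    qed
    ultimately have "D w \<le> 0" by (rule tendsto_upperbound) simp
    then show False using Mw k by (simp add: D_def)
  qed
  then have "norm (coeff L 1) \<le> real (degree L) * R"
    by (intro inverse_roots_bound L0 R)
  also have "\<dots> \<le> real (h - 1) * R" using degL R by (intro mult_right_mono) auto
  finally show ?thesis by (simp add: coeff_L)
qed


section \<open>Multiplicative functions summed over monic polynomials\<close>

definition monic_polys :: "nat \<Rightarrow> 'a::comm_ring_1 poly set" where
  "monic_polys n = {F. degree F = n \<and> lead_coeff F = 1}"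

lemma finite_monic_polys: "finite (monic_polys n :: 'a::{field,finite} poly set)"
proof (rule finite_subset)
  show "monic_polys n \<subseteq> Poly ` {xs :: 'a list. set xs \<subseteq> UNIV \<and> length xs \<le> Suc n}"
  proof
    fix F :: "'a poly" assume F: "F \<in> monic_polys n"
    then have "F \<noteq> 0" by (auto simp: monic_polys_def)
    with F show "F \<in> Poly ` {xs :: 'a list. set xs \<subseteq> UNIV \<and> length xs \<le> Suc n}"
      by (intro image_eqI[of _ _ "coeffs F"]) (auto simp: monic_polys_def length_coeffs_degree[of F])
  qed
qed (intro finite_imageI finite_lists_length_le, simp)

lemma monic_polys_0: "monic_polys 0 = {1 :: 'a::{field,finite} poly}"
  by (auto simp: monic_polys_def elim!: degree_eq_zeroE)

context
  fixes q :: nat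
  assumes q_def: "q = card (UNIV :: 'a::{field,finite} set)" and ppow: "primepow q"
begin

text \<open>This counts the roots of F with multiplicity, the order at y being the number of k \<ge>
  1 for which the k-th power of the minimal polynomial of y divides F. A root has degree at most n,
  so the finite set Y contains all roots.\<close>

lemma degree_eq_card_conj_poly_powers:
  fixes F :: "'a poly"
  assumes F: "F \<in> monic_polys n"
  defines "Y \<equiv> {y. frob_periodic q y \<and> frob_period q y \<le> n}"
  shows "n = (\<Sum>y\<in>Y. \<Sum>k=1..n. if conj_poly q y ^ k dvd F then 1 else 0)"
proof -
  note fp = frob_period[OF q_def ppow] and cp = conj_poly_power_dvd_iff[OF q_def ppow]
    and cm = conj_poly_monic[OF q_def ppow]
  have F0: "F \<noteq> 0" and deg: "degree F = n" using F by (auto simp: monic_polys_def)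
  have finY: "finite Y" unfolding Y_def by (rule finite_frob_period_le[OF q_def ppow])
  have roots: "{y. poly (map_poly to_ac F) y = 0} \<subseteq> Y"
  proof
    fix y assume y: "y \<in> {y. poly (map_poly to_ac F) y = 0}"
    then have per: "frob_periodic q y" using root_frob_periodic[OF q_def ppow F0] by auto
    moreover have "conj_poly q y ^ 1 dvd F" using cp[OF per, of 1 F] y by (simp add: poly_eq_0_iff_dvd)
    then have "frob_period q y \<le> n" using dvd_imp_degree_le[OF _ F0] cm[OF per] deg by fastforce
    ultimately show "y \<in> Y" by (simp add: Y_def)
  qed
  have "n = degree (map_poly to_ac F)" by (simp add: deg)
  also have "\<dots> = (\<Sum>y\<in>Y. order y (map_poly to_ac F))"
    by (rule sum_order_eq_degree[symmetric]) (use F0 finY roots in auto)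
  also have "\<dots> = (\<Sum>y\<in>Y. \<Sum>k=1..n. if conj_poly q y ^ k dvd F then 1 else 0)"
  proof (intro sum.cong refl)
    fix y assume "y \<in> Y"
    then have per: "frob_periodic q y" by (simp add: Y_def)
    let ?o = "order y (map_poly to_ac F)"
    have le: "?o \<le> n" using order_degree[of "map_poly to_ac F" y] F0 by (simp add: deg)
    have "(\<Sum>k=1..n. if conj_poly q y ^ k dvd F then 1 else 0) = (\<Sum>k=1..n. if k \<le> ?o then 1 else 0 :: nat)"
      using F0 by (intro sum.cong refl) (simp add: cp[OF per] order_divides)
    also have "\<dots> = (\<Sum>k\<in>{1..?o}. 1)"
      by (rule sum.mono_neutral_cong_right) (use le in auto)
    finally show "?o = (\<Sum>k=1..n. if conj_poly q y ^ k dvd F then 1 else 0)" by simp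
  qed
  finally show ?thesis .
qed

text \<open>Weight the root count of each F by \<chi> F, sum over F, and split off the k-th power of
  the minimal polynomial of y. With \<nu> = k r, where r is the degree of y, a fixed \<nu> collects
  exactly the y with y^(q^\<nu>) = y. This replaces the logarithmic derivative of an Euler
  product.\<close>

lemma newton_identity_monic:
  fixes \<chi> :: "'a poly \<Rightarrow> complex"
  assumes \<chi>: "\<And>F G. \<chi> (F * G) = \<chi> F * \<chi> G" "\<chi> 1 = 1"
  defines "A \<equiv> \<lambda>n. \<Sum>F\<in>monic_polys n. \<chi> F"
    and "S \<equiv> \<lambda>\<nu>. \<Sum>y | y ^ (q ^ \<nu>) = y. \<chi> (conj_poly q y) ^ (\<nu> div frob_period q y)"
  shows "of_nat n * A n = (\<Sum>\<nu>=1..n. S \<nu> * A (n - \<nu>))"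
proof -
  note fp = frob_period[OF q_def ppow] and fd = frob_period_dvd_iff[OF q_def ppow]
    and cm = conj_poly_monic[OF q_def ppow]
  define r :: "'a alg_closure \<Rightarrow> nat" where "r = frob_period q"
  define P :: "'a alg_closure \<Rightarrow> 'a poly" where "P = conj_poly q"
  define Y where "Y = {y :: 'a alg_closure. frob_periodic q y \<and> frob_period q y \<le> n}"
  have finY: "finite Y" unfolding Y_def by (rule finite_frob_period_le[OF q_def ppow])
  have \<chi>_pow: "\<chi> (F ^ k) = \<chi> F ^ k" for F k by (induction k) (auto simp: \<chi>)
  have inner: "(\<Sum>F\<in>monic_polys n. if P y ^ k dvd F then \<chi> F else 0) =
      (if k * r y \<le> n then \<chi> (P y) ^ k * A (n - k * r y) else 0)" if per: "frob_periodic q y" for y k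
  proof -
    have "P y \<noteq> 0" using cm[OF per] by (auto simp: P_def)
    have "degree (P y ^ k) = k * degree (P y)"
      by (rule degree_power_eq) fact
    then have mon: "lead_coeff (P y ^ k) = 1" "P y \<noteq> 0" "degree (P y ^ k) = k * r y"
      using cm[OF per] \<open>P y \<noteq> 0\<close> lead_coeff_power[of "P y" k] by (simp_all add: P_def r_def)
    have lc: "lead_coeff (P y ^ k * G) = lead_coeff G" for G using mon by (simp add: lead_coeff_mult)
    have dg: "degree (P y ^ k * G) = k * r y + degree G" if "G \<noteq> 0" for G
      using mon that by (subst degree_mult_eq) auto
    show ?thesis
    proof (cases "k * r y \<le> n")
      case True
      have "(\<Sum>F\<in>monic_polys n. if P y ^ k dvd F then \<chi> F else 0) =
          (\<Sum>F\<in>{F \<in> monic_polys n. P y ^ k dvd F}. \<chi> F)"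
        by (simp add: sum.inter_filter finite_monic_polys)
      also have "\<dots> = (\<Sum>G\<in>monic_polys (n - k * r y). \<chi> (P y ^ k * G))"
      proof (rule sum.reindex_bij_witness[of _ "\<lambda>G. P y ^ k * G" "\<lambda>F. F div P y ^ k"])
        fix F :: "'a poly" assume F: "F \<in> {F \<in> monic_polys n. P y ^ k dvd F}"
        then obtain G where G: "F = P y ^ k * G" by auto
        have "G \<noteq> 0" using F G by (auto simp: monic_polys_def)
        have "F div P y ^ k = G" using mon(2) by (simp add: G)
        then show "P y ^ k * (F div P y ^ k) = F" "F div P y ^ k \<in> monic_polys (n - k * r y)"
          "\<chi> (P y ^ k * (F div P y ^ k)) = \<chi> F"
          using F dg[OF \<open>G \<noteq> 0\<close>] lc[of G] by (auto simp: G monic_polys_def)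
      next
        fix G :: "'a poly" assume G: "G \<in> monic_polys (n - k * r y)"
        then have "G \<noteq> 0" by (auto simp: monic_polys_def)
        show "P y ^ k * G div P y ^ k = G" using mon(2) by simp
        show "P y ^ k * G \<in> {F \<in> monic_polys n. P y ^ k dvd F}"
          using G True dg[OF \<open>G \<noteq> 0\<close>] lc[of G] by (auto simp: monic_polys_def)
      qed
      also have "\<dots> = \<chi> (P y) ^ k * A (n - k * r y)"
        by (simp add: \<chi> \<chi>_pow A_def sum_distrib_left)
      finally show ?thesis using True by simp
    next
      case False
      have "\<not> P y ^ k dvd F" if F: "F \<in> monic_polys n" for F
      proof
        assume "P y ^ k dvd F"
        moreover have "F \<noteq> 0" using F by (auto simp: monic_polys_def)
        ultimately have "degree (P y ^ k) \<le> degree F" by (rule dvd_imp_degree_le)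
        then show False using mon(3) False F by (simp add: monic_polys_def)
      qed
      then show ?thesis using False by simp
    qed
  qed
  have "of_nat n * A n = (\<Sum>F\<in>monic_polys n. of_nat n * \<chi> F)"
    by (simp add: A_def sum_distrib_left)
  also have "\<dots> = (\<Sum>F\<in>monic_polys n. \<Sum>y\<in>Y. \<Sum>k=1..n. if P y ^ k dvd F then \<chi> F else 0)"
  proof (intro sum.cong refl)
    fix F :: "'a poly" assume F: "F \<in> monic_polys n"
    have "of_nat n = (\<Sum>y\<in>Y. \<Sum>k=1..n. if P y ^ k dvd F then 1 else 0 :: complex)"
      using arg_cong[OF degree_eq_card_conj_poly_powers[OF F], of "of_nat :: nat \<Rightarrow> complex"]
      by (simp add: Y_def P_def if_distrib cong: if_cong)
    then show "of_nat n * \<chi> F = (\<Sum>y\<in>Y. \<Sum>k=1..n. if P y ^ k dvd F then \<chi> F else 0)"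
      by (simp add: sum_distrib_right if_distrib[of "\<lambda>x. x * _"] cong: if_cong)
  qed
  also have "\<dots> = (\<Sum>y\<in>Y. \<Sum>F\<in>monic_polys n. \<Sum>k=1..n. if P y ^ k dvd F then \<chi> F else 0)"
    by (rule sum.swap)
  also have "\<dots> = (\<Sum>y\<in>Y. \<Sum>k=1..n. \<Sum>F\<in>monic_polys n. if P y ^ k dvd F then \<chi> F else 0)"
    by (intro sum.cong refl sum.swap)
  also have "\<dots> = (\<Sum>y\<in>Y. \<Sum>k=1..n. if k * r y \<le> n then \<chi> (P y) ^ k * A (n - k * r y) else 0)"
    by (intro sum.cong refl inner) (auto simp: Y_def)
  also have "\<dots> = (\<Sum>(y, k)\<in>Y \<times> {1..n}. if k * r y \<le> n then \<chi> (P y) ^ k * A (n - k * r y) else 0)"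
    by (simp add: sum.cartesian_product)
  also have "\<dots> = (\<Sum>(y, k)\<in>{(y, k). y \<in> Y \<and> k \<in> {1..n} \<and> k * r y \<le> n}. \<chi> (P y) ^ k * A (n - k * r y))"
    by (rule sum.mono_neutral_cong_right) (use finY in \<open>auto split: if_splits\<close>)
  also have "\<dots> = (\<Sum>(\<nu>, y)\<in>(SIGMA \<nu>:{1..n}. {y. y ^ (q ^ \<nu>) = y}). \<chi> (P y) ^ (\<nu> div r y) * A (n - \<nu>))"
  proof (rule sum.reindex_bij_witness[of _ "\<lambda>(\<nu>, y). (y, \<nu> div r y)" "\<lambda>(y, k). (k * r y, y)"])
    fix a assume "a \<in> {(y, k). y \<in> Y \<and> k \<in> {1..n} \<and> k * r y \<le> n}"
    then obtain y k where a: "a = (y, k)" "frob_periodic q y" "k \<ge> 1" "k * r y \<le> n" by (auto simp: Y_def)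
    have "r y > 0" using fp[OF a(2)] by (simp add: r_def)
    then have k: "k * r y div r y = k" "k * r y \<ge> 1" using a(3) by auto
    show "(case case a of (y, k) \<Rightarrow> (k * r y, y) of (\<nu>, y) \<Rightarrow> (y, \<nu> div r y)) = a"
      "(case case a of (y, k) \<Rightarrow> (k * r y, y) of (\<nu>, y) \<Rightarrow> \<chi> (P y) ^ (\<nu> div r y) * A (n - \<nu>)) =
        (case a of (y, k) \<Rightarrow> \<chi> (P y) ^ k * A (n - k * r y))"
      using k(1) by (simp_all add: a)
    have "y ^ (q ^ (k * r y)) = y" using fd[OF a(2), of "k * r y"] by (simp add: r_def)
    then show "(case a of (y, k) \<Rightarrow> (k * r y, y)) \<in> (SIGMA \<nu>:{1..n}. {y. y ^ (q ^ \<nu>) = y})"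
      using k a by simp
  next
    fix b assume "b \<in> (SIGMA \<nu>:{1..n}. {y :: 'a alg_closure. y ^ (q ^ \<nu>) = y})"
    then obtain \<nu> y where b: "b = (\<nu>, y)" "1 \<le> \<nu>" "\<nu> \<le> n" "y ^ (q ^ \<nu>) = y" by auto
    have per: "frob_periodic q y" unfolding frob_periodic_def[OF q_def ppow] using b(2,4) by (auto intro!: exI[of _ \<nu>])
    have dvd: "r y dvd \<nu>" using fd[OF per, of \<nu>] b(4) by (simp add: r_def)
    have r: "r y > 0" "r y \<le> \<nu>" using fp[OF per] dvd b(2) by (auto simp: r_def dvd_imp_le)
    then have "\<nu> div r y \<ge> 1" "\<nu> div r y \<le> n" "\<nu> div r y * r y = \<nu>"
      using dvd b(3) by (auto simp: div_greater_zero_iff Suc_le_eq intro: le_trans[OF div_le_dividend])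
    then show "(case case b of (\<nu>, y) \<Rightarrow> (y, \<nu> div r y) of (y, k) \<Rightarrow> (k * r y, y)) = b"
      "(case b of (\<nu>, y) \<Rightarrow> (y, \<nu> div r y)) \<in> {(y, k). y \<in> Y \<and> k \<in> {1..n} \<and> k * r y \<le> n}"
      using b(1,3) r per by (simp_all add: Y_def r_def)
  qed
  also have "\<dots> = (\<Sum>\<nu>=1..n. \<Sum>y | y ^ (q ^ \<nu>) = y. \<chi> (P y) ^ (\<nu> div r y) * A (n - \<nu>))"
    by (rule sum.Sigma[symmetric]) (use finite_frobenius_fixed[OF q_def ppow] in auto)
  also have "\<dots> = (\<Sum>\<nu>=1..n. S \<nu> * A (n - \<nu>))"
    by (simp add: S_def P_def r_def sum_distrib_right)
  finally show ?thesis .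
qed

end

subsection \<open>Weil's bound for products of linear factors\<close>

text \<open>\<open>W\<close> is an injective character of the d-th roots of unity, extended by 0 at
  0, and y \<mapsto> W(y^u) is the resulting character of the base field. \<open>W\<close> lives on
  the closure because the sums over extension fields apply it to powers of their elements.\<close>

locale residue_character =
  fixes q d u :: nat and W :: "'a::{field,finite} alg_closure \<Rightarrow> complex"
  assumes q_card: "q = card (UNIV :: 'a set)" and q_primepow: "primepow q"
    and du: "d * u = q - 1"
    and W_0: "W 0 = 0" and W_1: "W 1 = 1"
    and W_mult: "\<And>a b. a ^ d = 1 \<Longrightarrow> b ^ d = 1 \<Longrightarrow> W (a * b) = W a * W b"
    and W_inj: "\<And>a. a ^ d = 1 \<Longrightarrow> W a = 1 \<Longrightarrow> a = 1"
    and norm_W: "\<And>a. a ^ d = 1 \<Longrightarrow> norm (W a) = 1"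
begin

lemmas q_gt_1 = q_gt_1[OF q_card q_primepow]

lemma d_pos: "d > 0" and u_pos: "u > 0"
  using du q_gt_1 by (cases d; cases u; auto)+

definition residue_char :: "'a \<Rightarrow> complex" where
  "residue_char y = W (to_ac (y ^ u))"

lemma power_u_d: "(y :: 'a) \<noteq> 0 \<Longrightarrow> (y ^ u) ^ d = (1 :: 'a)"
  using power_card_minus_1_eq_1[of y] du by (simp add: q_card mult.commute flip: power_mult)

lemma W_mult':
  assumes "a = 0 \<or> a ^ d = 1" "b = 0 \<or> b ^ d = 1"
  shows "W (a * b) = W a * W b"
  using assms W_mult W_0 by auto

lemma zero_or_root_power:
  fixes a :: "'a alg_closure"
  assumes "a = 0 \<or> a ^ d = 1" "n > 0"
  shows "a ^ n = 0 \<or> (a ^ n) ^ d = 1"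
proof (cases "a = 0")
  case False
  have "(a ^ n) ^ d = (a ^ d) ^ n" by (simp only: mult.commute flip: power_mult)
  then show ?thesis using assms False by simp
qed (use assms in simp)

lemma W_power:
  assumes "a = 0 \<or> a ^ d = 1" "n > 0"
  shows "W (a ^ n) = W a ^ n"
  using assms(2)
proof (induction n rule: nat_induct_non_zero)
  case (Suc n)
  have "a ^ n = 0 \<or> (a ^ n) ^ d = 1"
    by (rule zero_or_root_power[OF assms(1) Suc.hyps])
  then show ?case using assms(1) Suc.IH by (simp add: W_mult')
qed simp

lemma W_prod:
  assumes "finite I" "\<And>t. t \<in> I \<Longrightarrow> a t = 0 \<or> a t ^ d = 1"
  shows "W (prod a I) = (\<Prod>t\<in>I. W (a t)) \<and> (prod a I = 0 \<or> prod a I ^ d = 1)"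
  using assms
proof (induction I rule: finite_induct)
  case (insert x I)
  have "a x = 0 \<or> a x ^ d = 1" using insert.prems by simp
  moreover have "W (prod a I) = (\<Prod>t\<in>I. W (a t)) \<and> (prod a I = 0 \<or> prod a I ^ d = 1)"
    using insert by simp
  ultimately show ?case using insert.hyps W_mult'[of "a x" "prod a I"] by (auto simp: power_mult_distrib)
qed (simp add: W_1)

lemma residue_char_0 [simp]: "residue_char 0 = 0"
  using u_pos by (simp add: residue_char_def W_0 power_0_left)

lemma residue_char_1 [simp]: "residue_char 1 = 1"
  by (simp add: residue_char_def W_1)

lemma to_ac_power_u: "to_ac (y ^ u :: 'a) = 0 \<or> to_ac (y ^ u) ^ d = 1"
  using power_u_d[of y] u_pos by (cases "y = 0") (auto simp: power_0_left simp flip: to_ac_power)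

lemma residue_char_mult: "residue_char (x * y) = residue_char x * residue_char y"
  using W_mult'[OF to_ac_power_u to_ac_power_u, of x y] by (simp add: residue_char_def power_mult_distrib)

text \<open>Completely multiplicative in F, and equal to the summand of Weil's sum for F = X -
  x.\<close>

definition poly_char :: "'a set \<Rightarrow> ('a \<Rightarrow> nat) \<Rightarrow> 'a poly \<Rightarrow> complex" where
  "poly_char I e F = (\<Prod>t\<in>I. residue_char (poly F t) ^ e t)"

lemma poly_char_mult: "poly_char I e (F * G) = poly_char I e F * poly_char I e G"
  by (simp add: poly_char_def residue_char_mult power_mult_distrib prod.distrib)

lemma poly_char_1: "poly_char I e 1 = 1"
  by (simp add: poly_char_def)

lemma sum_residue_char_power:
  assumes "y0 \<noteq> 0" "residue_char y0 ^ e \<noteq> 1"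
  shows "(\<Sum>y\<in>UNIV. residue_char y ^ e) = 0"
proof -
  have "(\<Sum>y\<in>UNIV. residue_char y ^ e) = (\<Sum>y\<in>UNIV. residue_char (y0 * y) ^ e)"
    by (rule sum.reindex_bij_witness[of _ "\<lambda>y. y0 * y" "\<lambda>y. y / y0"]) (use assms in auto)
  also have "\<dots> = residue_char y0 ^ e * (\<Sum>y\<in>UNIV. residue_char y ^ e)"
    by (simp add: residue_char_mult power_mult_distrib sum_distrib_left)
  finally show ?thesis using assms by (metis mult_cancel_right1)
qed

text \<open>Translating \<open>F\<close> by multiples of a polynomial that vanishes at all points of \<open>I\<close> but one
  moves its value there through the whole field.\<close>

lemma sum_poly_char_monic_eq_0:
  assumes I: "finite I" "t0 \<in> I" and n: "n \<ge> card I"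
    and nontriv: "y0 \<noteq> 0" "residue_char y0 ^ e t0 \<noteq> 1"
  shows "(\<Sum>F\<in>monic_polys n. poly_char I e F) = 0"
proof -
  define E where "E = (\<Prod>t\<in>I - {t0}. [:-t, 1:])"
  have degE: "degree E = card I - 1"
    unfolding E_def using I by (subst degree_prod_eq_sum_degree) auto
  have "card I > 0" using I by (auto simp: card_gt_0_iff)
  then have degE': "degree (smult c E) < n" for c
    using degree_smult_le[of c E] degE n by linarith
  have Et: "poly E t = 0" if "t \<in> I - {t0}" for t
    unfolding E_def poly_prod using I that by (intro prod_zero) auto
  have Et0: "poly E t0 \<noteq> 0" unfolding E_def poly_prod using I by (auto simp: prod_zero_iff)
  have mem: "F + smult c E \<in> monic_polys n \<longleftrightarrow> F \<in> monic_polys n" for F c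
  proof -
    have *: "G + smult c E \<in> monic_polys n" if "G \<in> monic_polys n" for G c
    proof -
      have "degree (smult c E) < degree G" using that degE' by (simp add: monic_polys_def)
      moreover have "coeff (smult c E) n = 0" by (rule coeff_eq_0[OF degE'])
      ultimately show ?thesis using that
        by (auto simp: monic_polys_def degree_add_eq_left)
    qed
    from *[of F c] *[of "F + smult c E" "- c"] show ?thesis by auto
  qed
  have inner: "(\<Sum>c\<in>UNIV. poly_char I e (F + smult c E)) = 0" for F
  proof -
    have "(\<Sum>c\<in>UNIV. poly_char I e (F + smult c E)) =
        (\<Sum>c\<in>UNIV. residue_char (poly F t0 + c * poly E t0) ^ e t0 * (\<Prod>t\<in>I - {t0}. residue_char (poly F t) ^ e t))"
      unfolding poly_char_def using I Et by (simp add: prod.remove)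
    also have "\<dots> = (\<Sum>c\<in>UNIV. residue_char (poly F t0 + c * poly E t0) ^ e t0) *
        (\<Prod>t\<in>I - {t0}. residue_char (poly F t) ^ e t)" by (simp add: sum_distrib_right)
    also have "(\<Sum>c\<in>UNIV. residue_char (poly F t0 + c * poly E t0) ^ e t0) = (\<Sum>y\<in>UNIV. residue_char y ^ e t0)"
      by (rule sum.reindex_bij_witness[of _ "\<lambda>y. (y - poly F t0) / poly E t0" "\<lambda>c. poly F t0 + c * poly E t0"])
        (use Et0 in auto)
    also have "\<dots> = 0" by (rule sum_residue_char_power[OF nontriv])
    finally show ?thesis by simp
  qed
  have "of_nat q * (\<Sum>F\<in>monic_polys n. poly_char I e F) = (\<Sum>c\<in>(UNIV :: 'a set). \<Sum>F\<in>monic_polys n. poly_char I e F)"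
    by (simp add: q_card)
  also have "\<dots> = (\<Sum>c\<in>UNIV. \<Sum>F\<in>monic_polys n. poly_char I e (F + smult c E))"
  proof (rule sum.cong[OF refl])
    fix c :: 'a
    have "F - smult c E \<in> monic_polys n" if "F \<in> monic_polys n" for F
      using mem[of F "- c"] that by simp
    then show "(\<Sum>F\<in>monic_polys n. poly_char I e F) = (\<Sum>F\<in>monic_polys n. poly_char I e (F + smult c E))"
      by (intro sum.reindex_bij_witness[of _ "\<lambda>F. F + smult c E" "\<lambda>F. F - smult c E"]) (auto simp: mem)
  qed
  also have "\<dots> = (\<Sum>F\<in>monic_polys n. \<Sum>c\<in>UNIV. poly_char I e (F + smult c E))" by (rule sum.swap)
  finally show ?thesis using q_gt_1 by (simp add: inner)
qed

lemma sum_poly_char_linear: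
  "(\<Sum>F\<in>monic_polys 1. poly_char I e F) = (\<Sum>x\<in>UNIV. \<Prod>t\<in>I. residue_char (t - x) ^ e t)"
proof -
  have *: "F = [:coeff F 0, 1:]" if F: "F \<in> monic_polys 1" for F :: "'a poly"
  proof (rule poly_eqI)
    fix n
    show "coeff F n = coeff [:coeff F 0, 1:] n"
      using F coeff_eq_0[of F n] by (cases n; cases "n - 1") (auto simp: monic_polys_def coeff_pCons)
  qed
  have "poly F t = t + coeff F 0" if "F \<in> monic_polys 1" for F and t :: 'a
    by (subst *[OF that]) simp
  then show ?thesis using *
    by (intro sum.reindex_bij_witness[of _ "\<lambda>x. [:-x, 1:]" "\<lambda>F. - coeff F 0"])
      (auto simp: monic_polys_def poly_char_def)
qed

text \<open>The exponent of the norm map from the field of order q^\<nu> to the base field.\<close>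

definition norm_exponent :: "nat \<Rightarrow> nat" where
  "norm_exponent \<nu> = (\<Sum>j<\<nu>. q ^ j)"

lemma norm_exponent: "norm_exponent \<nu> * (d * u) = q ^ \<nu> - 1"
proof -
  have "norm_exponent \<nu> * (q - 1) = q ^ \<nu> - 1"
    using q_gt_1 by (induction \<nu>) (auto simp: norm_exponent_def algebra_simps diff_mult_distrib2)
  then show ?thesis by (simp add: du)
qed

text \<open>The minimal polynomial of y at t is the norm of t - y from the field generated by y, of
  degree r say. In the norm from the field of order q^\<nu> each conjugate occurs \<nu> / r
  times.\<close>

lemma conj_poly_norm:
  fixes y :: "'a alg_closure"
  assumes y: "y ^ (q ^ \<nu>) = y" and \<nu>: "\<nu> > 0"
  shows "to_ac (poly (conj_poly q y) t) ^ (\<nu> div frob_period q y) = (to_ac t - y) ^ norm_exponent \<nu>"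
proof -
  note fp = frob_period[OF q_card q_primepow]
  have per: "frob_periodic q y" unfolding frob_periodic_def[OF q_card q_primepow] using y \<nu> by blast
  let ?r = "frob_period q y"
  define m where "m = \<nu> div ?r"
  have \<nu>_eq: "\<nu> = ?r * m" using frob_period_dvd_iff[OF q_card q_primepow per, of \<nu>] y by (simp add: m_def)
  have frob: "to_ac t - y ^ (q ^ j) = (to_ac t - y) ^ (q ^ j)" for j
  proof -
    have tt: "to_ac t ^ (q ^ j) = to_ac t" by (rule to_ac_power_q_power[OF q_card q_primepow])
    have "to_ac t ^ (q ^ j) = ((to_ac t - y) + y) ^ (q ^ j)" by simp
    also have "\<dots> = (to_ac t - y) ^ (q ^ j) + y ^ (q ^ j)"
      by (rule frobenius_add[OF q_card q_primepow]) simp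
    finally show ?thesis using tt by (simp add: algebra_simps)
  qed
  have "to_ac (poly (conj_poly q y) t) = poly (map_poly to_ac (conj_poly q y)) (to_ac t)"
    by (simp add: poly_map_poly_to_ac)
  also have "\<dots> = (\<Prod>j<?r. (to_ac t - y ^ (q ^ j)))"
    by (simp add: map_conj_poly[OF q_card q_primepow per] poly_prod)
  finally have 1: "to_ac (poly (conj_poly q y) t) = (\<Prod>j<?r. (to_ac t - y ^ (q ^ j)))" .
  have "(\<Prod>j<?r * k. (to_ac t - y ^ (q ^ j))) = (\<Prod>j<?r. (to_ac t - y ^ (q ^ j))) ^ k" for k
  proof (induction k)
    case (Suc k)
    have "(\<Prod>j<?r * Suc k. (to_ac t - y ^ (q ^ j))) =
        (\<Prod>j<?r * k. (to_ac t - y ^ (q ^ j))) * (\<Prod>j\<in>{?r * k..<?r * k + ?r}. (to_ac t - y ^ (q ^ j)))"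
      by (subst prod.union_disjoint[symmetric]) (auto intro!: prod.cong)
    also have "(\<Prod>j\<in>{?r * k..<?r * k + ?r}. (to_ac t - y ^ (q ^ j))) = (\<Prod>j<?r. (to_ac t - y ^ (q ^ j)))"
      by (rule prod.reindex_bij_witness[of _ "\<lambda>j. ?r * k + j" "\<lambda>j. j - ?r * k"])
        (auto simp: frob_power_mod[OF q_card q_primepow fp(2)[OF per]] dest: le_Suc_ex)
    finally show ?case using Suc.IH by simp
  qed simp
  from this[of m] have "to_ac (poly (conj_poly q y) t) ^ m = (\<Prod>j<\<nu>. (to_ac t - y ^ (q ^ j)))"
    by (simp add: 1 \<nu>_eq)
  also have "\<dots> = (\<Prod>j<\<nu>. (to_ac t - y) ^ (q ^ j))" by (simp add: frob)
  also have "\<dots> = (to_ac t - y) ^ norm_exponent \<nu>" by (simp add: norm_exponent_def power_sum)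
  finally show ?thesis by (simp add: m_def)
qed


text \<open>
  Dividing the exponents by their common divisor with \<open>d\<close> turns \<open>S\<^sub>\<nu>\<close> into a complete sum of a
  character of exact order \<open>s\<close> over the field with \<open>q\<^sup>\<nu>\<close> elements, with \<open>s\<close> independent of \<open>\<nu>\<close>.
\<close>

lemma newton_sum_bound:
  assumes I: "finite I" "t0 \<in> I" and e: "\<And>t. t \<in> I \<Longrightarrow> 0 < e t \<and> e t < d"
  shows "\<exists>C. \<forall>\<nu>>0. norm (\<Sum>y | y ^ (q ^ \<nu>) = y. poly_char I e (conj_poly q y) ^ (\<nu> div frob_period q y))
    \<le> C * sqrt (real q) ^ \<nu>"
proof -
  define e0 where "e0 = gcd d (Gcd (e ` I))"
  define s where "s = d div e0"
  define e' where "e' = (\<lambda>t. e t div e0)"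
  have e0: "e0 > 0" using d_pos by (simp add: e0_def)
  have sd: "d = e0 * s" by (simp add: s_def e0_def)
  have et: "e t = e0 * e' t" if "t \<in> I" for t
    using that by (simp add: e'_def e0_def) (metis Gcd_dvd dvd_mult_div_cancel gcd_dvd2 dvd_trans imageI)
  have "s > 1"
  proof -
    have "e0 dvd e t0" using et I by simp
    then have "e0 \<le> e t0" using e[OF I(2)] by (intro dvd_imp_le) auto
    also have "\<dots> < d" using e I by auto
    finally have "e0 < e0 * s" using sd by simp
    then show ?thesis by simp
  qed
  have coprime: "gcd s (Gcd (e' ` I)) = 1"
  proof -
    have "e ` I = (*) e0 ` (e' ` I)" using et by (force simp: image_image)
    then have "Gcd (e ` I) = Gcd ((*) e0 ` (e' ` I))" by (rule arg_cong)
    also have "\<dots> = e0 * Gcd (e' ` I)" by (simp add: Gcd_mult)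
    finally have "e0 = gcd d (e0 * Gcd (e' ` I))" using e0_def by simp
    also have "gcd d (e0 * Gcd (e' ` I)) = gcd (e0 * s) (e0 * Gcd (e' ` I))" by (simp only: sd)
    finally have "e0 = gcd (e0 * s) (e0 * Gcd (e' ` I))" .
    then have "e0 * 1 = e0 * gcd s (Gcd (e' ` I))" by (simp add: gcd_mult_distrib_nat)
    then show ?thesis using e0 by (metis mult_left_cancel nat_neq_iff)
  qed
  define f :: "'a alg_closure poly" where "f = (\<Prod>t\<in>I. [:to_ac t, -1:] ^ e' t)"
  define D where "D = degree f"
  define C where "C = real (s * (D + s * stepanov_const s D))"
  have "f \<noteq> 0" using I by (simp add: f_def prod_zero_iff)
  have ord: "order (to_ac t) f = e' t" if t: "t \<in> I" for t
  proof -
    let ?G = "\<Prod>t\<in>I - {t}. [:to_ac t, -1:] ^ e' t"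
    have fe: "f = [:to_ac t, -1:] ^ e' t * ?G"
      unfolding f_def by (rule prod.remove[OF I(1) t])
    then have "[:to_ac t, -1:] ^ e' t * ?G \<noteq> 0" using \<open>f \<noteq> 0\<close> by (simp only: not_False_eq_True)
    then have "order (to_ac t) f = order (to_ac t) ([:to_ac t, -1:] ^ e' t) +
        order (to_ac t) ?G"
      unfolding fe by (rule order_mult)
    also have "order (to_ac t) (\<Prod>t\<in>I - {t}. [:to_ac t, -1:] ^ e' t) = 0"
      by (rule order_0I) (use I in \<open>auto simp: poly_prod prod_zero_iff\<close>)
    also have "order (to_ac t) ([:to_ac t, -1:] ^ e' t) = e' t"
    proof -
      have "order (to_ac t) (smult (-1) ([:- to_ac t, 1:] ^ 1)) = 1"
        by (subst order_smult) (simp_all only: order_power_n_n, simp)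
      then have "order (to_ac t) [:to_ac t, -1:] = 1" by simp
      then show ?thesis by (simp add: order_power_poly)
    qed
    finally show ?thesis by simp
  qed
  have nondvd: "\<exists>t. \<not> s dvd r * order t f" if r: "0 < r" "r < s" for r
  proof (rule ccontr)
    assume "\<not> ?thesis"
    then have "s dvd r * e' t" if "t \<in> I" for t using ord[OF that] by metis
    then have "s dvd Gcd ((*) r ` (e' ` I))" by (auto intro: Gcd_greatest)
    then have "s dvd r * Gcd (e' ` I)" by (simp add: Gcd_mult)
    moreover have "coprime s (Gcd (e' ` I))" using coprime by (simp add: coprime_iff_gcd_eq_1)
    ultimately have "s dvd r" by (simp add: coprime_dvd_mult_left_iff)
    then show False using r by (auto dest: dvd_imp_le)
  qed
  have s0: "of_nat s \<noteq> (0 :: 'a alg_closure)"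
  proof (rule of_nat_neq_0_if_dvd[OF q_card q_primepow])
    show "s dvd q - 1" unfolding du[symmetric] sd by simp
  qed
  have sub: "a ^ d = 1" if "a ^ s = 1" for a :: "'a alg_closure"
    using that sd by (metis mult.commute power_mult power_one)
  have W_sum: "(\<Sum>a | a ^ s = 1. W a) = 0"
  proof -
    have fin: "finite {a :: 'a alg_closure. a ^ s = 1}"
      using card_roots_of_unity[OF s0] \<open>s > 1\<close> by (intro card_ge_0_finite) auto
    have "\<not> {a :: 'a alg_closure. a ^ s = 1} \<subseteq> {1}"
      using card_mono[of "{1}" "{a :: 'a alg_closure. a ^ s = 1}"] card_roots_of_unity[OF s0] \<open>s > 1\<close> by auto
    then obtain b :: "'a alg_closure" where b: "b ^ s = 1" "b \<noteq> 1" by auto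
    then have "b \<noteq> 0" using \<open>s > 1\<close> by (auto simp: power_0_left)
    have "(\<Sum>a | a ^ s = 1. W a) = (\<Sum>a | a ^ s = 1. W (b * a))"
      by (rule sum.reindex_bij_witness[of _ "\<lambda>a. b * a" "\<lambda>a. a / b"])
        (use b \<open>b \<noteq> 0\<close> in \<open>auto simp: power_mult_distrib power_divide\<close>)
    also have "\<dots> = W b * (\<Sum>a | a ^ s = 1. W a)"
      using W_mult[OF sub[OF b(1)] sub] by (simp add: sum_distrib_left)
    finally show ?thesis using W_inj[OF sub[OF b(1)]] b(2) by (metis mult_cancel_right1)
  qed
  obtain k where k: "q = CHAR('a) ^ k" using card_field_eq_CHAR_power[where 'a = 'a] q_primepow q_card by auto
  show ?thesis
  proof (intro exI[of _ C] allI impI)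
    fix \<nu> :: nat assume \<nu>: "\<nu> > 0"
    define Q where "Q = q ^ \<nu>"
    \<comment> \<open>Norm, u-th power and the common divisor \<open>e0\<close> in one exponent.
      Only \<open>Q\<close> and \<open>c\<close> depend on \<nu>; s, f and hence \<open>C\<close> do
      not.\<close>
    define c where "c = norm_exponent \<nu> * u * e0"
    have cs: "c * s = Q - 1" using norm_exponent[of \<nu>] by (simp add: c_def Q_def sd mult_ac)
    have "norm_exponent \<nu> > 0" using \<nu> q_gt_1 by (auto simp: norm_exponent_def intro!: sum_pos)
    then have c: "c > 0" using u_pos e0 by (simp add: c_def)
    have frob: "f ^ Q = pcompose f (monom 1 Q)"
    proof -
      have lin: "[:to_ac t, -1:] ^ Q = pcompose [:to_ac t, -1:] (monom 1 Q)" for t :: 'a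
      proof -
        have tt: "to_ac t ^ Q = to_ac t"
          unfolding Q_def by (rule to_ac_power_q_power[OF q_card q_primepow])
        have "[:to_ac t:] ^ Q = ([:to_ac t, -1:] + monom 1 1) ^ Q" by (simp add: monom_altdef)
        also have "\<dots> = [:to_ac t, -1:] ^ Q + monom 1 1 ^ Q"
          unfolding Q_def by (rule frobenius_add[OF q_card q_primepow]) simp
        finally show ?thesis using tt by (simp add: monom_power poly_const_pow pcompose_pCons algebra_simps)
      qed
      have "f ^ Q = (\<Prod>t\<in>I. ([:to_ac t, -1:] ^ Q) ^ e' t)"
        by (simp add: f_def prod_power_distrib mult.commute flip: power_mult)
      also have "\<dots> = pcompose f (monom 1 Q)"
        by (simp only: lin f_def pcompose_prod pcompose_power)
      finally show ?thesis .
    qed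
    have val: "poly_char I e (conj_poly q y) ^ (\<nu> div frob_period q y) = W (poly f y ^ c)"
      if y: "y ^ Q = y" for y
    proof -
      define m where "m = \<nu> div frob_period q y"
      define a where "a = (\<lambda>t. (to_ac t - y) ^ (norm_exponent \<nu> * u))"
      have fper: "frob_periodic q y" unfolding frob_periodic_def[OF q_card q_primepow]
        using y \<nu> by (auto simp: Q_def)
      have "frob_period q y dvd \<nu>" using frob_period_dvd_iff[OF q_card q_primepow fper, of \<nu>] y by (simp add: Q_def)
      then have "m > 0" using \<nu> by (auto simp: m_def div_greater_zero_iff dvd_imp_le
            frob_period[OF q_card q_primepow fper])
      have at: "to_ac (poly (conj_poly q y) t ^ u) ^ m = a t" for t
        using conj_poly_norm[OF y[unfolded Q_def] \<nu>, of t]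
        by (simp add: a_def m_def power_mult mult.commute flip: power_mult) (metis mult.commute power_mult)
      have am: "a t = 0 \<or> a t ^ d = 1" for t
        unfolding at[symmetric] by (rule zero_or_root_power[OF to_ac_power_u \<open>m > 0\<close>])
      have "poly_char I e (conj_poly q y) ^ m = (\<Prod>t\<in>I. (residue_char (poly (conj_poly q y) t) ^ m) ^ e t)"
        by (simp add: poly_char_def prod_power_distrib mult.commute flip: power_mult)
      also have "\<dots> = (\<Prod>t\<in>I. W (a t) ^ e t)"
        using W_power[OF to_ac_power_u \<open>m > 0\<close>] by (simp add: residue_char_def flip: at)
      also have "\<dots> = (\<Prod>t\<in>I. W (a t ^ e t))"
        using e am by (intro prod.cong refl W_power[symmetric]) auto
      also have "\<dots> = W (\<Prod>t\<in>I. a t ^ e t)"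
      proof -
        have "a t ^ e t = 0 \<or> (a t ^ e t) ^ d = 1" if "t \<in> I" for t
          by (rule zero_or_root_power[OF am]) (use e[OF that] in simp)
        then show ?thesis using W_prod[OF I(1), of "\<lambda>t. a t ^ e t"] by simp
      qed
      also have "(\<Prod>t\<in>I. a t ^ e t) = poly f y ^ c"
      proof -
        have "a t ^ e t = ((to_ac t - y) ^ e' t) ^ c" if "t \<in> I" for t
          unfolding a_def et[OF that] c_def by (simp add: mult_ac flip: power_mult)
        then have "(\<Prod>t\<in>I. a t ^ e t) = (\<Prod>t\<in>I. ((to_ac t - y) ^ e' t) ^ c)" by (rule prod.cong[OF refl])
        then show ?thesis by (simp add: f_def poly_prod prod_power_distrib)
      qed
      finally show ?thesis by (simp add: m_def)
    qed
    have "norm (\<Sum>y | y ^ Q = y. W (poly f y ^ c)) \<le> C * sqrt (real Q)"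
      unfolding C_def D_def
    proof (rule stepanov_character_sum[where f = f and s = s and c = c and \<Omega> = W and r = "k * \<nu>"])
      show "f \<noteq> 0" "of_nat s \<noteq> (0 :: 'a alg_closure)" by fact+
      show "\<exists>t. \<not> s dvd r * order t f" if "0 < r" "r < s" for r by (rule nondvd[OF that])
      show "f ^ Q = pcompose f (monom 1 Q)" "c * s = Q - 1" "c > 0" by fact+
      show "W 0 = 0" "(\<Sum>a | a ^ s = 1. W a) = 0" by (rule W_0, rule W_sum)
      show "norm (W a) \<le> 1" if "a ^ s = 1" for a using norm_W[OF sub[OF that]] by simp
      show "prime CHAR('a alg_closure)" using prime_CHAR_finite_field by simp
      show "Q = CHAR('a alg_closure) ^ (k * \<nu>)" by (simp add: Q_def k power_mult)
    qed
    also have "sqrt (real Q) = sqrt (real q) ^ \<nu>" by (simp add: Q_def real_sqrt_power)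
    finally show "norm (\<Sum>y | y ^ (q ^ \<nu>) = y. poly_char I e (conj_poly q y) ^ (\<nu> div frob_period q y))
        \<le> C * sqrt (real q) ^ \<nu>"
      using val by (simp add: Q_def)
  qed
qed

lemma weil_bound:
  assumes I: "finite I" "I \<noteq> {}" and e: "\<And>t. t \<in> I \<Longrightarrow> 0 < e t \<and> e t < d"
    and nontriv: "\<And>j. 0 < j \<Longrightarrow> j < d \<Longrightarrow> \<exists>y\<noteq>0. residue_char y ^ j \<noteq> 1"
  shows "norm (\<Sum>x\<in>UNIV. \<Prod>t\<in>I. residue_char (t - x) ^ e t) \<le> real (card I - 1) * sqrt (real q)"
proof -
  obtain t0 where t0: "t0 \<in> I" using I by auto
  obtain y0 where y0: "y0 \<noteq> 0" "residue_char y0 ^ e t0 \<noteq> 1" using nontriv e[OF t0] by blast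
  obtain C where C: "\<And>\<nu>. \<nu> > 0 \<Longrightarrow> norm (\<Sum>y | y ^ (q ^ \<nu>) = y.
      poly_char I e (conj_poly q y) ^ (\<nu> div frob_period q y)) \<le> C * sqrt (real q) ^ \<nu>"
    using newton_sum_bound[of I t0 e] I(1) t0 e by blast
  have "norm (\<Sum>F\<in>monic_polys 1. poly_char I e F) \<le> real (card I - 1) * sqrt (real q)"
  proof (rule newton_identities_bound[of "\<lambda>n. \<Sum>F\<in>monic_polys n. poly_char I e F"])
    show "(\<Sum>F\<in>monic_polys 0. poly_char I e F) = 1" by (simp add: monic_polys_0 poly_char_1)
    show "(\<Sum>F\<in>monic_polys n. poly_char I e F) = 0" if "card I \<le> n" for n
      using sum_poly_char_monic_eq_0[of I t0 n y0 e] I(1) t0 that y0 by blast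
    show "of_nat n * (\<Sum>F\<in>monic_polys n. poly_char I e F) = (\<Sum>\<nu>=1..n.
        (\<Sum>y | y ^ (q ^ \<nu>) = y. poly_char I e (conj_poly q y) ^ (\<nu> div frob_period q y)) *
        (\<Sum>F\<in>monic_polys (n - \<nu>). poly_char I e F))" for n
      by (rule newton_identity_monic[OF q_card q_primepow poly_char_mult poly_char_1])
  qed (use I C q_gt_1 in \<open>auto simp: card_gt_0_iff\<close>)
  then show ?thesis by (simp only: sum_poly_char_linear)
qed

end

subsection \<open>Prescribed power residues\<close>

lemma exists_field_generator:
  "\<exists>g :: 'a::{field,finite}. \<forall>n. g ^ n = 1 \<longleftrightarrow> (card (UNIV :: 'a set) - 1) dvd n"
proof -
  let ?R = "ring_of_type_algebra :: 'a ring"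
  let ?N = "card (UNIV :: 'a set) - 1"
  have "field ?R" by (rule field_from_type_algebra)
  moreover have "finite (carrier ?R)" by (simp add: ring_of_type_algebra_def)
  ultimately obtain g where
    g: "g \<in> carrier (Multiplicative_Group.mult_of ?R)"
    "carrier (Multiplicative_Group.mult_of ?R) = {g [^]\<^bsub>?R\<^esub> i |i. i \<in> (UNIV :: nat set)}"
    using field.finite_field_mult_group_has_gen by blast
  have car: "carrier (Multiplicative_Group.mult_of ?R) = UNIV - {0}"
    by (simp add: Multiplicative_Group.mult_of_def ring_of_type_algebra_def)
  have pow: "g [^]\<^bsub>?R\<^esub> i = g ^ i" for i :: nat
    by (induction i) (simp_all add: nat_pow_def ring_of_type_algebra_def)
  have gen: "UNIV - {0} = range (\<lambda>i. g ^ i)" using g(2) unfolding car pow by auto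
  have "g \<noteq> 0" using g(1) car by auto
  have "card (UNIV :: 'a set) > 1" using card_mono[of UNIV "{0, 1 :: 'a}"] by simp
  then have N: "?N > 0" by simp
  have "?N dvd n" if n: "g ^ n = 1" for n
  proof (rule ccontr)
    assume nd: "\<not> ?N dvd n"
    define m where "m = n mod ?N"
    have m: "m > 0" "m < ?N" using nd N by (auto simp: m_def mod_greater_zero_iff_not_dvd)
    have gm: "g ^ m = 1"
    proof -
      have "g ^ n = (g ^ ?N) ^ (n div ?N) * g ^ m"
        unfolding m_def by (metis power_add power_mult mult_div_mod_eq)
      then show ?thesis using n power_card_minus_1_eq_1[OF \<open>g \<noteq> 0\<close>] by simp
    qed
    have "range (\<lambda>i. g ^ i) \<subseteq> (\<lambda>i. g ^ i) ` {..<m}"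
    proof
      fix y assume "y \<in> range (\<lambda>i. g ^ i)"
      then obtain i where "y = g ^ i" by auto
      also have "g ^ i = (g ^ m) ^ (i div m) * g ^ (i mod m)"
        by (metis power_add power_mult mult_div_mod_eq)
      finally show "y \<in> (\<lambda>i. g ^ i) ` {..<m}" using gm m by auto
    qed
    then have "card (range (\<lambda>i. g ^ i)) \<le> card ((\<lambda>i. g ^ i) ` {..<m})" by (intro card_mono) auto
    also have "\<dots> \<le> m" using card_image_le[of "{..<m}" "\<lambda>i. g ^ i"] by simp
    finally have "?N \<le> m" unfolding gen[symmetric] by (simp add: card_Diff_singleton)
    then show False using m by simp
  qed
  moreover have "g ^ n = 1" if "?N dvd n" for n
    using that power_card_minus_1_eq_1[OF \<open>g \<noteq> 0\<close>] by (auto simp: power_mult elim!: dvdE)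
  ultimately show ?thesis by blast
qed

lemma exists_residue_character:
  assumes q: "q = card (UNIV :: 'a::{field,finite} set)" "primepow q" and du: "d * u = q - 1"
  shows "\<exists>W :: 'a alg_closure \<Rightarrow> complex. residue_character q d u W"
proof -
  have q1: "q > 1" using q by (simp add: primepow_gt_Suc_0)
  then have d: "d > 0" and u: "u > 0" using du by (cases d; cases u; auto)+
  obtain g :: 'a where g: "\<And>n. g ^ n = 1 \<longleftrightarrow> (q - 1) dvd n" using exists_field_generator q by blast
  define \<theta> where "\<theta> = to_ac (g ^ u)"
  define z where "z = cis (2 * pi / real d)"
  have \<theta>1: "\<theta> ^ i = 1 \<longleftrightarrow> d dvd i" for i
  proof -
    have "\<theta> ^ i = 1 \<longleftrightarrow> to_ac (g ^ (u * i)) = to_ac 1" by (simp add: \<theta>_def power_mult)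
    also have "\<dots> \<longleftrightarrow> u * d dvd u * i" unfolding to_ac_eq_iff g du[symmetric] by (simp add: mult.commute)
    finally show ?thesis using u by simp
  qed
  have z_pow: "z ^ i = cis (2 * pi * real i / real d)" for i by (simp add: z_def DeMoivre mult_ac)
  have z1: "z ^ i = 1 \<longleftrightarrow> d dvd i" for i
  proof
    assume "z ^ i = 1"
    have zd: "z ^ d = 1" using d by (simp add: z_pow)
    have "z ^ i = (z ^ d) ^ (i div d) * z ^ (i mod d)" by (metis power_add power_mult mult_div_mod_eq)
    then have "z ^ (i mod d) = z ^ 0" using zd \<open>z ^ i = 1\<close> by simp
    moreover have "inj_on (\<lambda>k. z ^ k) {..<d}"
      using bij_betw_roots_unity[OF d] unfolding z_pow bij_betw_def by blast
    ultimately have "i mod d = 0" using d by (metis inj_onD lessThan_iff mod_less_divisor)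
    then show "d dvd i" by auto
  next
    assume "d dvd i"
    moreover have "z ^ d = 1" using d by (simp add: z_pow)
    ultimately show "z ^ i = 1" by (auto simp: power_mult elim!: dvdE)
  qed
  have "\<theta> \<noteq> 0"
  proof
    assume "\<theta> = 0"
    then have "\<theta> ^ d = 0" using d by (simp add: power_0_left)
    moreover have "\<theta> ^ d = 1" by (simp add: \<theta>1)
    ultimately show False by simp
  qed
  have eq_iff: "\<theta> ^ i = \<theta> ^ j \<longleftrightarrow> z ^ i = z ^ j" if "i \<le> j" for i j
  proof -
    have "\<theta> ^ j = \<theta> ^ i * \<theta> ^ (j - i)" "z ^ j = z ^ i * z ^ (j - i)" using that by (simp_all flip: power_add)
    moreover have "z \<noteq> 0" by (simp add: z_def)
    ultimately have "\<theta> ^ i = \<theta> ^ j \<longleftrightarrow> \<theta> ^ (j - i) = 1" "z ^ i = z ^ j \<longleftrightarrow> z ^ (j - i) = 1"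
      using \<open>\<theta> \<noteq> 0\<close> by auto
    then show ?thesis by (simp add: \<theta>1 z1)
  qed
  then have eq_iff': "\<theta> ^ i = \<theta> ^ j \<longleftrightarrow> z ^ i = z ^ j" for i j
    by (metis le_cases)
  have d0: "of_nat d \<noteq> (0 :: 'a alg_closure)"
    by (rule of_nat_neq_0_if_dvd[OF q], unfold du[symmetric]) (rule dvd_triv_left)
  have roots: "{b :: 'a alg_closure. b ^ d = 1} = (\<lambda>i. \<theta> ^ i) ` {..<d}"
  proof (rule card_subset_eq[symmetric])
    show "finite {b :: 'a alg_closure. b ^ d = 1}"
      using card_roots_of_unity[OF d0] d by (intro card_ge_0_finite) auto
    show "(\<lambda>i. \<theta> ^ i) ` {..<d} \<subseteq> {b. b ^ d = 1}" by (auto simp: \<theta>1 simp flip: power_mult)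
    have "inj_on (\<lambda>k. z ^ k) {..<d}"
      using bij_betw_roots_unity[OF d] unfolding z_pow bij_betw_def by blast
    then have "inj_on (\<lambda>k. \<theta> ^ k) {..<d}" by (auto simp: inj_on_def eq_iff')
    then show "card ((\<lambda>i. \<theta> ^ i) ` {..<d}) = card {b :: 'a alg_closure. b ^ d = 1}"
      using card_roots_of_unity[OF d0] by (simp add: card_image)
  qed
  \<comment> \<open>Any exponent i may be chosen, because \<theta>^i = \<theta>^j exactly when z^i =
    z^j.\<close>
  define W where "W = (\<lambda>b. if b ^ d = 1 then z ^ (SOME i. b = \<theta> ^ i) else 0)"
  have W: "W (\<theta> ^ i) = z ^ i" for i
  proof -
    have "\<theta> ^ i = \<theta> ^ (SOME j. \<theta> ^ i = \<theta> ^ j)" by (rule someI[of _ i]) simp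
    moreover have "(\<theta> ^ i) ^ d = 1" by (simp add: \<theta>1 flip: power_mult)
    ultimately show ?thesis by (simp add: W_def eq_iff'[symmetric])
  qed
  have ex: "\<exists>i. a = \<theta> ^ i" if "a ^ d = 1" for a using that roots by auto
  have "residue_character q d u W"
  proof
    show "W 0 = 0" using d by (simp add: W_def power_0_left)
    show "W 1 = 1" using W[of 0] by simp
    show "W (a * b) = W a * W b" if "a ^ d = 1" "b ^ d = 1" for a b
      using ex[OF that(1)] ex[OF that(2)] W by (metis power_add)
    show "a = 1" if "a ^ d = 1" "W a = 1" for a
      using ex[OF that(1)] that(2) W \<theta>1 z1 by metis
    show "norm (W a) = 1" if "a ^ d = 1" for a
      using ex[OF that] W by (auto simp: norm_power z_def)
  qed (use q du in auto)
  then show ?thesis by blast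
qed

section \<open>Character expansions and the bound \<open>Q_bound\<close>\<close>

lemma prod_one_plus:
  fixes h :: "'b \<Rightarrow> 'c::comm_ring_1"
  assumes "finite T"
  shows "(\<Prod>t\<in>T. 1 + h t) = (\<Sum>I\<in>Pow T. \<Prod>t\<in>I. h t)"
  using assms
proof (induction T rule: finite_induct)
  case (insert x T)
  have "(\<Sum>I\<in>Pow (insert x T). \<Prod>t\<in>I. h t) =
      (\<Sum>I\<in>Pow T. \<Prod>t\<in>I. h t) + (\<Sum>I\<in>insert x ` Pow T. \<Prod>t\<in>I. h t)"
    unfolding Pow_insert using insert.hyps by (intro sum.union_disjoint) auto
  also have "(\<Sum>I\<in>insert x ` Pow T. \<Prod>t\<in>I. h t) = (\<Sum>I\<in>Pow T. \<Prod>t\<in>insert x I. h t)"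
    by (subst sum.reindex) (use insert.hyps in \<open>auto simp: inj_on_def\<close>)
  also have "\<dots> = h x * (\<Sum>I\<in>Pow T. \<Prod>t\<in>I. h t)"
    unfolding sum_distrib_left
    by (intro sum.cong refl prod.insert) (use insert.hyps in \<open>auto intro: finite_subset\<close>)
  finally show ?case using insert by (simp add: algebra_simps)
qed simp

lemma sum_Pow_card:
  fixes \<phi> :: "nat \<Rightarrow> real"
  assumes "finite T"
  shows "(\<Sum>I\<in>Pow T. \<phi> (card I)) = (\<Sum>h\<le>card T. real (card T choose h) * \<phi> h)"
proof -
  have "(\<Sum>I\<in>Pow T. \<phi> (card I)) = (\<Sum>h\<le>card T. \<Sum>I\<in>{I \<in> Pow T. card I = h}. \<phi> (card I))"
    by (rule sum.group[symmetric]) (use assms in \<open>auto intro: card_mono\<close>)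
  also have "\<dots> = (\<Sum>h\<le>card T. real (card T choose h) * \<phi> h)"
  proof (intro sum.cong refl)
    fix h
    have "{I \<in> Pow T. card I = h} = {B. B \<subseteq> T \<and> card B = h}" by auto
    then have "card {I \<in> Pow T. card I = h} = card T choose h" using n_subsets[OF assms] by simp
    then show "(\<Sum>I\<in>{I \<in> Pow T. card I = h}. \<phi> (card I)) = real (card T choose h) * \<phi> h" by simp
  qed
  finally show ?thesis .
qed

lemma U_bound_nonneg: "d > 0 \<Longrightarrow> U_bound d m \<ge> 0"
  unfolding U_bound_def by (intro sum_nonneg mult_nonneg_nonneg) auto

text \<open>Guarantees that a field with more than \<open>Q_bound d m\<close> elements has room for
  m distinct points.\<close>

lemma Q_bound_ge:
  assumes "d > 0"
  shows "Q_bound d m \<ge> real m"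
proof -
  let ?U = "U_bound d m" and ?P = "real d ^ (m - 1) * real m"
  have "real m \<le> ?P" using assms by (intro mult_le_cancel_right1[THEN iffD2]) auto
  then have "4 * real m \<le> ?U\<^sup>2 + 4 * ?P" by (simp add: add_increasing)
  also have "\<dots> = (sqrt (?U\<^sup>2 + 4 * ?P))\<^sup>2" by simp
  also have "\<dots> \<le> (?U + sqrt (?U\<^sup>2 + 4 * ?P))\<^sup>2"
    using U_bound_nonneg[OF assms, of m] by (intro power_mono) auto
  finally show ?thesis by (simp add: Q_bound_def mult_ac)
qed

text \<open>\<open>Q_bound\<close> is the square of the positive root of r^2 - U r - d^(m-1) m; the
  claim is positivity of this quadratic at r = sqrt q.\<close>

lemma Q_bound_less_imp:
  assumes "d > 0" "real q > Q_bound d m"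
  shows "real q - U_bound d m * sqrt (real q) > real d ^ (m - 1) * real m"
proof -
  let ?U = "U_bound d m" and ?P = "real d ^ (m - 1) * real m" and ?r = "sqrt (real q)"
  define S where "S = sqrt (?U\<^sup>2 + 4 * ?P)"
  have U: "?U \<ge> 0" using U_bound_nonneg[OF assms(1)] .
  have S: "S \<ge> 0" "S\<^sup>2 = ?U\<^sup>2 + 4 * ?P" by (simp_all add: S_def)
  have "((?U + S) / 2)\<^sup>2 < real q"
    using assms(2) by (simp add: Q_bound_def S_def power_divide mult_ac)
  then have r: "(?U + S) / 2 < ?r" by (rule real_less_rsqrt)
  then have "S < 2 * ?r - ?U" by simp
  then have "S\<^sup>2 < (2 * ?r - ?U)\<^sup>2" using S(1) by (intro power_strict_mono) auto
  also have "\<dots> = 4 * (real q - ?U * ?r) + ?U\<^sup>2" by (simp add: power2_eq_square algebra_simps)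
  finally show ?thesis using S(2) by simp
qed


context residue_character
begin

lemma residue_char_power_nontrivial:
  assumes "0 < j" "j < d"
  shows "\<exists>y\<noteq>0. residue_char y ^ j \<noteq> 1"
proof (rule ccontr)
  assume *: "\<not> ?thesis"
  obtain g :: 'a where g: "\<And>n. g ^ n = 1 \<longleftrightarrow> (q - 1) dvd n" using exists_field_generator q_card by blast
  have "g \<noteq> 0"
  proof
    assume "g = 0"
    moreover have "(0 :: 'a) ^ (q - 1) = 0" using q_gt_1 by (intro zero_power) simp
    moreover have "g ^ (q - 1) = 1" unfolding g by (rule dvd_refl)
    ultimately show False by (metis zero_neq_one)
  qed
  then have gu: "to_ac (g ^ u) ^ d = 1" using power_u_d[of g] by (metis to_ac_1 to_ac_power)
  have "W (to_ac (g ^ u) ^ j) = residue_char g ^ j"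
    unfolding residue_char_def by (rule W_power) (use gu assms in auto)
  also have "\<dots> = 1" using * \<open>g \<noteq> 0\<close> by blast
  finally have W1: "W (to_ac (g ^ u) ^ j) = 1" .
  have "(to_ac (g ^ u) ^ j) ^ d = (to_ac (g ^ u) ^ d) ^ j"
    by (simp only: mult.commute flip: power_mult)
  then have "(to_ac (g ^ u) ^ j) ^ d = 1" unfolding gu by simp
  then have "to_ac (g ^ u) ^ j = 1" using W1 by (rule W_inj)
  then have "to_ac (g ^ (u * j)) = to_ac 1" by (simp add: power_mult)
  then have "u * d dvd u * j" unfolding to_ac_eq_iff g du[symmetric] by (simp add: mult.commute)
  then show False using u_pos assms by (auto dest: dvd_imp_le)
qed

text \<open>Summing all powers of the character detects the class of y. At y = 0 only the term j = 0
  survives, since 0^0 = 1; such points are treated as an error term later.\<close>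

lemma residue_char_orthogonality:
  assumes "\<gamma> ^ d = (1 :: 'a)"
  shows "(\<Sum>j<d. (residue_char y / W (to_ac \<gamma>)) ^ j) =
    (if y = 0 then 1 else if y ^ u = \<gamma> then of_nat d else 0)"
proof (cases "y = 0")
  case True
  have "(\<Sum>j<d. (0 :: complex) ^ j) = 1" using d_pos by (simp add: power_0_left sum.delta)
  then show ?thesis using True by simp
next
  case False
  have \<gamma>: "to_ac \<gamma> ^ d = 1" using assms by (metis to_ac_1 to_ac_power)
  have y: "to_ac (y ^ u) ^ d = 1" using power_u_d[OF False] by (metis to_ac_1 to_ac_power)
  define b where "b = to_ac (y ^ u) / to_ac \<gamma>"
  have b: "b ^ d = 1" using \<gamma> y by (simp add: b_def power_divide)
  have "\<gamma> \<noteq> 0" using assms d_pos by (auto simp: power_0_left)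
  have W\<gamma>: "W (to_ac \<gamma>) \<noteq> 0" using norm_W[OF \<gamma>] by auto
  have "W b * W (to_ac \<gamma>) = residue_char y"
    using W_mult[OF b \<gamma>] \<open>\<gamma> \<noteq> 0\<close> by (simp add: b_def residue_char_def)
  then have z: "residue_char y / W (to_ac \<gamma>) = W b" using W\<gamma> by (simp add: field_simps)
  have zd: "W b ^ d = 1" using W_power[of b d] b d_pos W_1 by simp
  show ?thesis
  proof (cases "y ^ u = \<gamma>")
    case True
    then have "b = 1" using \<open>\<gamma> \<noteq> 0\<close> by (simp add: b_def)
    then show ?thesis using True False by (simp add: z W_1)
  next
    case neq: False
    have "b \<noteq> 1" using neq \<open>\<gamma> \<noteq> 0\<close> by (simp add: b_def del: to_ac_power)
    then have "W b \<noteq> 1" using W_inj[OF b] by blast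
    then have "(\<Sum>j<d. W b ^ j) = 0" using zd by (simp add: geometric_sum)
    then show ?thesis using neq False by (simp add: z)
  qed
qed

text \<open>Splitting off j = 0 makes each factor 1 + \<open>h x t\<close>. In the expansion the
  empty set gives q, and a set of i > 0 factors gives (d - 1)^i sums with nontrivial exponents, each
  at most (i - 1) sqrt q. Added over all sets these bounds give \<open>U_bound\<close>.\<close>

lemma sum_prod_residue_char_bound:
  assumes T: "finite T" and \<gamma>: "\<And>t. t \<in> T \<Longrightarrow> \<gamma> t ^ d = (1 :: 'a)"
  shows "real q - U_bound d (card T) * sqrt (real q) \<le>
    norm (\<Sum>x\<in>UNIV. \<Prod>t\<in>T. \<Sum>j<d. (residue_char (t - x) / W (to_ac (\<gamma> t))) ^ j)"
proof -
  let ?w = "\<lambda>t. W (to_ac (\<gamma> t))" and ?r = "sqrt (real q)"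
  define h where "h = (\<lambda>x t. \<Sum>j\<in>{1..<d}. (residue_char (t - x) / ?w t) ^ j)"
  define N where "N = (\<lambda>I. \<Sum>x\<in>UNIV. \<Prod>t\<in>I. h x t)"
  have nw: "norm (?w t) = 1" if "t \<in> T" for t
    using \<gamma>[OF that] by (intro norm_W) (metis to_ac_1 to_ac_power)
  have split: "(\<Sum>j<d. (residue_char (t - x) / ?w t) ^ j) = 1 + h x t" for x t
  proof -
    have "{..<d} = insert 0 {1..<d}" using d_pos by auto
    then show ?thesis by (simp add: h_def)
  qed
  have total: "(\<Sum>x\<in>UNIV. \<Prod>t\<in>T. \<Sum>j<d. (residue_char (t - x) / ?w t) ^ j) = (\<Sum>I\<in>Pow T. N I)"
    unfolding split prod_one_plus[OF T] N_def by (rule sum.swap)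
  have N_empty: "N {} = of_nat q" by (simp add: N_def q_card)
  have N_bound: "norm (N I) \<le> (real d - 1) ^ card I * (real (card I) - 1) * ?r" if I: "I \<subseteq> T" "I \<noteq> {}" for I
  proof -
    have finI: "finite I" using I T finite_subset by blast
    then have cI: "card I > 0" using I by (simp add: card_gt_0_iff)
    have "N I = (\<Sum>x\<in>UNIV. \<Sum>e\<in>Pi\<^sub>E I (\<lambda>_. {1..<d}). \<Prod>t\<in>I. (residue_char (t - x) / ?w t) ^ e t)"
      unfolding N_def h_def by (subst prod_sum_PiE[OF finI]) auto
    also have "\<dots> = (\<Sum>e\<in>Pi\<^sub>E I (\<lambda>_. {1..<d}). \<Sum>x\<in>UNIV. \<Prod>t\<in>I. (residue_char (t - x) / ?w t) ^ e t)"
      by (rule sum.swap)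
    finally have "norm (N I) \<le> (\<Sum>e\<in>Pi\<^sub>E I (\<lambda>_. {1..<d}).
        norm (\<Sum>x\<in>UNIV. \<Prod>t\<in>I. (residue_char (t - x) / ?w t) ^ e t))"
      by (simp only: norm_sum)
    also have "\<dots> \<le> (\<Sum>e\<in>Pi\<^sub>E I (\<lambda>_. {1..<d}). real (card I - 1) * ?r)"
    proof (rule sum_mono)
      fix e assume e: "e \<in> Pi\<^sub>E I (\<lambda>_. {1..<d})"
      have "(\<Sum>x\<in>UNIV. \<Prod>t\<in>I. (residue_char (t - x) / ?w t) ^ e t) =
          (\<Sum>x\<in>UNIV. \<Prod>t\<in>I. residue_char (t - x) ^ e t) / (\<Prod>t\<in>I. ?w t ^ e t)"
        by (simp add: power_divide prod_dividef sum_divide_distrib)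
      moreover have "norm (\<Prod>t\<in>I. ?w t ^ e t) = 1"
        using nw I by (simp add: prod_norm[symmetric] norm_power subset_eq)
      ultimately have "norm (\<Sum>x\<in>UNIV. \<Prod>t\<in>I. (residue_char (t - x) / ?w t) ^ e t) =
          norm (\<Sum>x\<in>UNIV. \<Prod>t\<in>I. residue_char (t - x) ^ e t)"
        by (simp add: norm_divide)
      also have "\<dots> \<le> real (card I - 1) * ?r"
        by (rule weil_bound[OF finI I(2)]) (use e residue_char_power_nontrivial in \<open>auto simp: PiE_iff Suc_le_eq\<close>)
      finally show "norm (\<Sum>x\<in>UNIV. \<Prod>t\<in>I. (residue_char (t - x) / ?w t) ^ e t) \<le> real (card I - 1) * ?r" .
    qed
    also have "\<dots> = (real d - 1) ^ card I * (real (card I) - 1) * ?r"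
      using cI d_pos by (simp add: card_PiE[OF finI] of_nat_diff Suc_le_eq)
    finally show ?thesis .
  qed
  have U: "(\<Sum>I\<in>Pow T - {{}}. (real d - 1) ^ card I * (real (card I) - 1)) = U_bound d (card T)"
  proof -
    define \<phi> where "\<phi> = (\<lambda>h::nat. if h = 0 then 0 else (real d - 1) ^ h * (real h - 1))"
    have "(\<Sum>I\<in>Pow T - {{}}. (real d - 1) ^ card I * (real (card I) - 1)) = (\<Sum>I\<in>Pow T. \<phi> (card I))"
    proof (rule sum.mono_neutral_cong_left)
      show "(real d - 1) ^ card I * (real (card I) - 1) = \<phi> (card I)" if "I \<in> Pow T - {{}}" for I
        using that T finite_subset[of I T] by (auto simp: \<phi>_def)
    qed (use T in \<open>auto simp: \<phi>_def\<close>)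
    also have "\<dots> = (\<Sum>h\<le>card T. real (card T choose h) * \<phi> h)" by (rule sum_Pow_card[OF T])
    also have "\<dots> = U_bound d (card T)"
      unfolding U_bound_def by (rule sum.mono_neutral_cong_right) (auto simp: \<phi>_def)
    finally show ?thesis .
  qed
  have "real q = norm ((\<Sum>I\<in>Pow T. N I) - (\<Sum>I\<in>Pow T - {{}}. N I))"
    using T N_empty sum.remove[of "Pow T" "{}" N] by simp
  also have "\<dots> \<le> norm (\<Sum>I\<in>Pow T. N I) + norm (\<Sum>I\<in>Pow T - {{}}. N I)" by (rule norm_triangle_ineq4)
  also have "norm (\<Sum>I\<in>Pow T - {{}}. N I) \<le> (\<Sum>I\<in>Pow T - {{}}. (real d - 1) ^ card I * (real (card I) - 1) * ?r)"
    by (rule sum_norm_le) (use N_bound in auto)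
  also have "\<dots> = U_bound d (card T) * ?r" by (simp add: U flip: sum_distrib_right)
  finally show ?thesis by (simp add: total)
qed

text \<open>\<open>T\<close> is padded to exactly m points with class 1. Without a solution,
  \<open>G\<close> vanishes off T' and is at most d^(m-1) at each of the m points of T', where one
  of the m factors is 1. This contradicts the lower bound for the sum of \<open>G\<close>.\<close>

lemma exists_prescribed_residues:
  assumes T: "finite T" "card T \<le> m" and \<gamma>: "\<And>t. t \<in> T \<Longrightarrow> \<gamma> t ^ d = (1 :: 'a)"
    and q: "real q > Q_bound d m"
  shows "\<exists>x. \<forall>t\<in>T. (t - x) ^ u = \<gamma> t"
proof -
  have "real m \<le> real q" using Q_bound_ge[OF d_pos, of m] q by linarith
  then have "m \<le> card (UNIV :: 'a set)" by (simp add: q_card)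
  then obtain T' where T': "T \<subseteq> T'" "card T' = m"
    using exists_subset_between[of T m UNIV] T by auto
  have finT': "finite T'" by simp
  define \<gamma>' where "\<gamma>' = (\<lambda>t. if t \<in> T then \<gamma> t else 1)"
  have \<gamma>': "\<gamma>' t ^ d = 1" for t using \<gamma> by (simp add: \<gamma>'_def)
  define G where "G = (\<lambda>x. \<Prod>t\<in>T'. \<Sum>j<d. (residue_char (t - x) / W (to_ac (\<gamma>' t))) ^ j)"
  have G: "G x = (\<Prod>t\<in>T'. if t = x then 1 else if (t - x) ^ u = \<gamma>' t then of_nat d else 0)" for x
    unfolding G_def by (intro prod.cong refl) (simp add: residue_char_orthogonality[OF \<gamma>'])
  have "\<exists>x. \<forall>t\<in>T'. (t - x) ^ u = \<gamma>' t"
  proof (rule ccontr)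
    assume none: "\<not> ?thesis"
    have G_out: "G x = 0" if x: "x \<notin> T'" for x
    proof -
      obtain t where "t \<in> T'" "(t - x) ^ u \<noteq> \<gamma>' t" using none by blast
      then show ?thesis unfolding G using x by (intro prod_zero[OF finT']) auto
    qed
    have G_in: "norm (G x) \<le> real d ^ (m - 1)" if x: "x \<in> T'" for x
    proof -
      have "G x = (\<Prod>t\<in>T' - {x}. if t = x then 1 else if (t - x) ^ u = \<gamma>' t then of_nat d else 0)"
        unfolding G using x by (subst prod.remove[OF finT' x]) simp
      then have "norm (G x) \<le> (\<Prod>t\<in>T' - {x}. real d)"
        using d_pos by (simp only: prod_norm[symmetric]) (intro prod_mono, auto)
      then show ?thesis using x T' by (simp add: card_Diff_singleton)
    qed
    have "real q - U_bound d m * sqrt (real q) \<le> norm (\<Sum>x\<in>UNIV. G x)"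
      using sum_prod_residue_char_bound[OF finT', of \<gamma>'] \<gamma>' T' by (simp add: G_def)
    also have "(\<Sum>x\<in>UNIV. G x) = (\<Sum>x\<in>T'. G x)"
      by (rule sum.mono_neutral_right) (use G_out in auto)
    also have "norm (\<Sum>x\<in>T'. G x) \<le> (\<Sum>x\<in>T'. real d ^ (m - 1))"
      by (rule sum_norm_le) (use G_in in auto)
    also have "\<dots> = real d ^ (m - 1) * real m" using T' by simp
    finally show False using Q_bound_less_imp[OF d_pos q] by linarith
  qed
  then obtain x where x: "\<And>t. t \<in> T' \<Longrightarrow> (t - x) ^ u = \<gamma>' t" by blast
  have "(t - x) ^ u = \<gamma> t" if "t \<in> T" for t
    using x[of t] that T'(1) by (auto simp: \<gamma>'_def)
  then show ?thesis by blast
qed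

end

subsection \<open>Symmetric colourings and odd functions\<close>

lemma two_neq_0_odd_card:
  assumes "odd (card (UNIV :: 'a::{field,finite} set))"
  shows "(2 :: 'a) \<noteq> 0"
proof
  assume "(2 :: 'a) = 0"
  then have "of_nat 2 = (0 :: 'a)" by simp
  then have "CHAR('a) dvd 2" by (simp only: of_nat_eq_0_iff_char_dvd)
  moreover have "CHAR('a) > 1" using prime_CHAR_finite_field[where 'a = 'a] by (rule prime_gt_1_nat)
  ultimately have "CHAR('a) = 2" using dvd_imp_le[of "CHAR('a)" 2] by simp
  then show False using CHAR_dvd_CARD[where 'a = 'a] assms by simp
qed

lemma neg_neq_self:
  fixes x :: "'a::field"
  assumes "(2 :: 'a) \<noteq> 0" "x \<noteq> 0"
  shows "- x \<noteq> x"
proof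
  assume "- x = x"
  then have "2 * x = 0" by (metis mult_2 add.left_inverse)
  then show False using assms by simp
qed

lemma exists_half_system:
  assumes "(2 :: 'a::field) \<noteq> 0"
  shows "\<exists>H :: 'a set. 0 \<notin> H \<and> (\<forall>x. x \<noteq> 0 \<longrightarrow> (- x \<in> H \<longleftrightarrow> x \<notin> H))"
proof -
  \<comment> \<open>The choice depends only on the set {x, -x}, so it is the same at x and at
    -x.\<close>
  define c where "c = (\<lambda>x :: 'a. SOME y. y \<in> {x, - x})"
  define H where "H = {x. x \<noteq> 0 \<and> c x = x}"
  have c: "c x \<in> {x, - x}" for x unfolding c_def by (rule someI[of _ x]) simp
  have c_neg: "c (- x) = c x" for x unfolding c_def by (simp only: minus_minus insert_commute)
  have "- x \<in> H \<longleftrightarrow> x \<notin> H" if x: "x \<noteq> 0" for x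
    using c[of x] x neg_neq_self[OF assms x] by (auto simp: H_def c_neg)
  then show ?thesis by (intro exI[of _ H]) (auto simp: H_def)
qed

lemma card_half_system:
  assumes H: "0 \<notin> H" "\<And>x :: 'a::{field,finite}. x \<noteq> 0 \<Longrightarrow> (- x \<in> H \<longleftrightarrow> x \<notin> H)"
  shows "card (UNIV :: 'a set) = 2 * card H + 1"
proof -
  have univ: "UNIV = insert 0 (H \<union> uminus ` H)"
  proof (intro equalityI subsetI)
    fix x :: 'a
    show "x \<in> insert 0 (H \<union> uminus ` H)"
    proof (cases "x = 0 \<or> x \<in> H")
      case False
      then have "- x \<in> H" using H(2)[of x] by blast
      then have "- (- x) \<in> uminus ` H" by (rule imageI)
      then show ?thesis by simp
    qed auto
  qed simp
  have "0 \<notin> H \<union> uminus ` H" using H(1) by auto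
  moreover have "H \<inter> uminus ` H = {}" 
  proof -
    have "- y \<notin> H" if "y \<in> H" for y using that H(1) H(2)[of y] by metis
    then show ?thesis by auto
  qed
  moreover have "card (uminus ` H) = card H" by (intro card_image) (auto simp: inj_on_def)
  ultimately have "card (insert 0 (H \<union> uminus ` H)) = 2 * card H + 1" by (simp add: card_Un_disjoint)
  then show ?thesis unfolding univ[symmetric] .
qed

text \<open>Greedy: while a point is uncoloured, fewer than l card R points are coloured, so some
  colour is below its quota l. Once all are coloured, counting shows that every quota is
  met.\<close>

lemma balanced_extension:
  fixes c0 :: "'a \<Rightarrow> 'b"
  assumes "finite X1" "finite R" "card X1 = l * card R" "Y \<subseteq> X1"
    and "\<And>x. x \<in> Y \<Longrightarrow> c0 x \<in> R" "\<And>\<gamma>. \<gamma> \<in> R \<Longrightarrow> card {x \<in> Y. c0 x = \<gamma>} \<le> l"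
  shows "\<exists>c. (\<forall>x\<in>X1. c x \<in> R) \<and> (\<forall>x\<in>Y. c x = c0 x) \<and> (\<forall>\<gamma>\<in>R. card {x \<in> X1. c x = \<gamma>} = l)"
  using assms(4-6)
proof (induction "card (X1 - Y)" arbitrary: Y c0)
  case 0
  then have Y: "Y = X1" using assms(1) by auto
  have sum: "(\<Sum>\<gamma>\<in>R. card {x \<in> X1. c0 x = \<gamma>}) = card X1"
    using 0 Y assms(1,2) sum.group[of X1 R c0 "\<lambda>_. 1 :: nat"] by auto
  have "card {x \<in> X1. c0 x = \<gamma>} = l" if \<gamma>: "\<gamma> \<in> R" for \<gamma>
  proof (rule ccontr)
    assume "card {x \<in> X1. c0 x = \<gamma>} \<noteq> l"
    then have "card {x \<in> X1. c0 x = \<gamma>} < l" using 0(4)[OF \<gamma>] Y by simp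
    then have "(\<Sum>\<gamma>\<in>R. card {x \<in> X1. c0 x = \<gamma>}) < (\<Sum>\<gamma>\<in>R. l)"
      using 0(4) Y \<gamma> by (intro sum_strict_mono_ex1 assms(2)) auto
    then show False using sum assms(3) by (simp add: mult.commute)
  qed
  then show ?case using 0 Y by (intro exI[of _ c0]) auto
next
  case (Suc k)
  have finY: "finite Y" using Suc.prems(1) assms(1) finite_subset by blast
  have "X1 - Y \<noteq> {}" using Suc.hyps(2) by (metis card.empty nat.distinct(1))
  then obtain x where x: "x \<in> X1" "x \<notin> Y" by auto
  have "card Y < card X1" using x Suc.prems(1) assms(1) by (intro psubset_card_mono) auto
  moreover have "(\<Sum>\<gamma>\<in>R. card {x \<in> Y. c0 x = \<gamma>}) = card Y"
    using Suc.prems finY assms(2) sum.group[of Y R c0 "\<lambda>_. 1 :: nat"] by auto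
  ultimately have "\<exists>\<gamma>\<in>R. card {x \<in> Y. c0 x = \<gamma>} < l"
    using sum_mono[of R "\<lambda>_. l" "\<lambda>\<gamma>. card {x \<in> Y. c0 x = \<gamma>}"] assms(3)
    by (force simp: not_less mult.commute)
  then obtain \<gamma> where \<gamma>: "\<gamma> \<in> R" "card {x \<in> Y. c0 x = \<gamma>} < l" by blast
  define c1 where "c1 = c0(x := \<gamma>)"
  have c1: "{y \<in> insert x Y. c1 y = \<delta>} = (if \<delta> = \<gamma> then insert x {y \<in> Y. c0 y = \<delta>} else {y \<in> Y. c0 y = \<delta>})" for \<delta>
    using x by (auto simp: c1_def)
  have "\<exists>c. (\<forall>y\<in>X1. c y \<in> R) \<and> (\<forall>y\<in>insert x Y. c y = c1 y) \<and> (\<forall>\<gamma>\<in>R. card {y \<in> X1. c y = \<gamma>} = l)"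
  proof (rule Suc.hyps(1))
    have "X1 - insert x Y = (X1 - Y) - {x}" by auto
    then show "k = card (X1 - insert x Y)" using Suc.hyps(2) x assms(1) by simp
    show "c1 y \<in> R" if "y \<in> insert x Y" for y using that Suc.prems(2) \<gamma> by (auto simp: c1_def)
    show "card {y \<in> insert x Y. c1 y = \<delta>} \<le> l" if "\<delta> \<in> R" for \<delta>
      unfolding c1 using Suc.prems(3)[OF that] \<gamma> x finY by auto
  qed (use x Suc.prems in auto)
  then obtain c where "\<forall>y\<in>X1. c y \<in> R" "\<forall>y\<in>insert x Y. c y = c1 y" "\<forall>\<gamma>\<in>R. card {y \<in> X1. c y = \<gamma>} = l"
    by blast
  then show ?case using x by (intro exI[of _ c]) (auto simp: c1_def split: if_splits)
qed

text \<open>By x^2 - y^2 = (x + y) (x - y), the solutions are parametrised by the nonzero value x +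
  y.\<close>

lemma card_square_differences:
  fixes g :: "'a::{field,finite}"
  assumes two: "(2 :: 'a) \<noteq> 0" and "g \<noteq> 0"
  shows "card {(x, y). x ^ 2 - y ^ 2 = g} = card (UNIV :: 'a set) - 1"
proof -
  have fac: "x ^ 2 - y ^ 2 = (x + y) * (x - y)" for x y :: 'a
    by (simp add: power2_eq_square square_diff_square_factored)
  have halves: "(u + v) / 2 + (u - v) / 2 = u" "(u + v) / 2 - (u - v) / 2 = v" for u v :: 'a
    using two by (simp_all flip: add_divide_distrib diff_divide_distrib)
  define \<phi> :: "'a \<times> 'a \<Rightarrow> 'a" where "\<phi> = (\<lambda>(x, y). x + y)"
  define \<psi> where "\<psi> = (\<lambda>u. ((u + g / u) / 2, (u - g / u) / 2))"
  have "bij_betw \<phi> {(x, y). x ^ 2 - y ^ 2 = g} (UNIV - {0})"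
  proof (rule bij_betw_byWitness[where f' = \<psi>])
    show "\<forall>a\<in>{(x, y). x ^ 2 - y ^ 2 = g}. \<psi> (\<phi> a) = a"
    proof
      fix a assume "a \<in> {(x, y). x ^ 2 - y ^ 2 = g}"
      then obtain x y where a: "a = (x, y)" and g: "g = (x + y) * (x - y)" by (auto simp: fac)
      then have "x + y \<noteq> 0" using \<open>g \<noteq> 0\<close> by auto
      then have "g / (x + y) = x - y" by (simp add: g)
      moreover have "x + y + (x - y) = 2 * x" "x + y - (x - y) = 2 * y" by simp_all
      ultimately show "\<psi> (\<phi> a) = a" using two by (simp add: a \<phi>_def \<psi>_def)
    qed
  qed (use \<open>g \<noteq> 0\<close> in \<open>auto simp: \<phi>_def \<psi>_def fac halves\<close>)
  then have "card {(x, y). x ^ 2 - y ^ 2 = g} = card (UNIV - {0 :: 'a})" by (rule bij_betw_same_card)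
  then show ?thesis by (simp add: card_Diff_singleton)
qed


definition square_diffs :: "'a::field \<Rightarrow> ('a \<times> 'a) set" where
  "square_diffs g = {(x, y). x ^ 2 - y ^ 2 = g}"

text \<open>For g \<noteq> 0, representatives under (x, y) \<mapsto> (-x, -y), selected by the first
  nonzero coordinate.\<close>

definition half_square_diffs :: "'a set \<Rightarrow> 'a::field \<Rightarrow> ('a \<times> 'a) set" where
  "half_square_diffs H g = {(x, y) \<in> square_diffs g. x \<in> H \<or> x = 0 \<and> y \<in> H}"

lemma neg_mem_half_square_diffs_iff:
  fixes H :: "'a::field set"
  assumes H: "0 \<notin> H" "\<And>x. x \<noteq> 0 \<Longrightarrow> (- x \<in> H \<longleftrightarrow> x \<notin> H)"
    and "x\<^sup>2 - y\<^sup>2 = g" "g \<noteq> 0"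
  shows "(- x, - y) \<in> half_square_diffs H g \<longleftrightarrow> (x, y) \<notin> half_square_diffs H g"
proof (cases "x = 0")
  case True
  then have "y \<noteq> 0" using assms(3,4) by auto
  then show ?thesis using True H(1) H(2)[of y] assms(3) by (simp add: half_square_diffs_def square_diffs_def)
next
  case False
  then show ?thesis using H(2)[of x] assms(3) by (simp add: half_square_diffs_def square_diffs_def)
qed

text \<open>A pair with a zero coordinate has the forced colour \<open>c0\<close> of the other one.
  The sum x + y embeds these pairs into H, where \<open>c0\<close> takes every value l times, so the
  forced part respects the quotas and extends. E contains half of the solutions, which is as many as
  H has elements.\<close>

lemma exists_half_coloring:
  fixes H :: "'p::{field,finite} set" and c0 :: "'p \<Rightarrow> 'b"
  assumes two: "(2 :: 'p) \<noteq> 0"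
    and H: "0 \<notin> H" "\<And>x. x \<noteq> 0 \<Longrightarrow> (- x \<in> H \<longleftrightarrow> x \<notin> H)"
    and R: "finite R" "card H = l * card R"
    and c0: "\<And>x. x \<in> H \<Longrightarrow> c0 x \<in> R" "\<And>\<gamma>. \<gamma> \<in> R \<Longrightarrow> card {x \<in> H. c0 x = \<gamma>} = l"
    and g: "g \<noteq> 0"
  defines "E \<equiv> half_square_diffs H g"
  shows "\<exists>c. (\<forall>a\<in>E. c a \<in> R) \<and> (\<forall>x y. (x, y) \<in> E \<longrightarrow> x = 0 \<or> y = 0 \<longrightarrow> c (x, y) = c0 (x + y)) \<and>
    (\<forall>\<gamma>\<in>R. card {a \<in> E. c a = \<gamma>} = l)"
proof -
  define Y where "Y = {(x, y) \<in> E. x = 0 \<or> y = 0}"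
  have finE: "finite E" by simp
  have E_sub: "E \<subseteq> square_diffs g" by (auto simp: E_def half_square_diffs_def)
  have E_neg: "- a \<in> E \<longleftrightarrow> a \<notin> E" if "a \<in> square_diffs g" for a
    using that neg_mem_half_square_diffs_iff[OF H _ g] by (cases a) (simp add: E_def square_diffs_def)
  have sq_neg: "- a \<in> square_diffs g \<longleftrightarrow> a \<in> square_diffs g" for a :: "'p \<times> 'p"
    by (cases a) (simp add: square_diffs_def)
  have neg: "uminus ` E = square_diffs g - E"
  proof (intro equalityI subsetI)
    fix a assume "a \<in> uminus ` E"
    then have "- a \<in> E" by auto
    then show "a \<in> square_diffs g - E" using E_sub sq_neg[of a] E_neg[of a] by blast
  next
    fix a assume "a \<in> square_diffs g - E"
    then have "- a \<in> E" using E_neg by blast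
    then have "- (- a) \<in> uminus ` E" by (rule imageI)
    then show "a \<in> uminus ` E" by simp
  qed
  have "card (square_diffs g - E) = card E"
    unfolding neg[symmetric] by (intro card_image) (auto simp: inj_on_def)
  moreover have "card (square_diffs g) = card (square_diffs g - E) + card E"
  proof -
    have "(square_diffs g - E) \<union> E = square_diffs g" using E_sub by blast
    then show ?thesis using card_Un_disjoint[of "square_diffs g - E" E] by (simp add: Int_commute)
  qed
  moreover have "card (square_diffs g) = 2 * card H"
    using card_square_differences[OF two g] card_half_system[OF H] by (simp add: square_diffs_def)
  ultimately have cE: "card E = l * card R" using R(2) by simp
  have inj: "inj_on (\<lambda>(x, y). x + y) Y"
  proof (rule inj_onI)
    fix a b assume a: "a \<in> Y" and b: "b \<in> Y" and eq: "(case a of (x, y) \<Rightarrow> x + y) = (case b of (x, y) \<Rightarrow> x + y)"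
    obtain x y x' y' where xy: "a = (x, y)" "b = (x', y')" by (cases a; cases b)
    \<comment> \<open>(z, 0) and (0, z) cannot both be solutions, as this would give g = z^2 =
      -g.\<close>
    have "z\<^sup>2 \<noteq> g \<or> - (z\<^sup>2) \<noteq> g" for z :: 'p
    proof (rule ccontr)
      assume "\<not> ?thesis"
      then have "- g = g" by auto
      then show False using neg_neq_self[OF two g] by simp
    qed
    from this[of "x + y"] show "a = b"
      using a b eq unfolding xy Y_def E_def half_square_diffs_def square_diffs_def by auto
  qed
  have sub: "(\<lambda>(x, y). x + y) ` Y \<subseteq> H"
    using H(1) by (auto simp: Y_def E_def half_square_diffs_def square_diffs_def)
  have "\<exists>c. (\<forall>a\<in>E. c a \<in> R) \<and> (\<forall>a\<in>Y. c a = (case a of (x, y) \<Rightarrow> c0 (x + y))) \<and> (\<forall>\<gamma>\<in>R. card {a \<in> E. c a = \<gamma>} = l)"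
  proof (rule balanced_extension[OF finE R(1) cE])
    show "Y \<subseteq> E" by (auto simp: Y_def)
    show "(case a of (x, y) \<Rightarrow> c0 (x + y)) \<in> R" if "a \<in> Y" for a
      using c0(1)[of "case a of (x, y) \<Rightarrow> x + y"] sub that by (cases a) auto
    show "card {a \<in> Y. (case a of (x, y) \<Rightarrow> c0 (x + y)) = \<gamma>} \<le> l" if "\<gamma> \<in> R" for \<gamma>
    proof -
      have "card {a \<in> Y. (case a of (x, y) \<Rightarrow> c0 (x + y)) = \<gamma>} =
          card ((\<lambda>(x, y). x + y) ` {a \<in> Y. (case a of (x, y) \<Rightarrow> c0 (x + y)) = \<gamma>})"
        by (rule card_image[symmetric], rule inj_on_subset[OF inj]) auto
      also have "\<dots> \<le> card {x \<in> H. c0 x = \<gamma>}"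
        by (rule card_mono) (use sub in auto)
      finally show ?thesis using c0(2)[OF that] by simp
    qed
  qed
  then obtain c where c: "\<forall>a\<in>E. c a \<in> R" "\<forall>a\<in>Y. c a = (case a of (x, y) \<Rightarrow> c0 (x + y))"
    "\<forall>\<gamma>\<in>R. card {a \<in> E. c a = \<gamma>} = l" by blast
  then show ?thesis by (intro exI[of _ c]) (auto simp: Y_def)
qed

text \<open>
  The target for the residue class of \<open>F x - F y\<close>, where \<open>F\<close> is the odd second coordinate of a
  block \<open>{(x\<^sup>2, F x)}\<close>. Colours are chosen on the pairs with \<open>x\<^sup>2 - y\<^sup>2 = g\<close> for one \<open>g\<close> of every pair
  \<open>\<plusminus>g\<close>, up to a common sign of \<open>x\<close> and \<open>y\<close>, and carried to all pairs by symmetry.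
\<close>

lemma exists_symmetric_coloring:
  fixes H :: "'p::{field,finite} set" and c0 :: "'p \<Rightarrow> 'b"
  assumes two: "(2 :: 'p) \<noteq> 0"
    and H: "0 \<notin> H" "\<And>x. x \<noteq> 0 \<Longrightarrow> (- x \<in> H \<longleftrightarrow> x \<notin> H)"
    and R: "finite R" "card H = l * card R"
    and c0: "\<And>x. x \<in> H \<Longrightarrow> c0 x \<in> R" "\<And>\<gamma>. \<gamma> \<in> R \<Longrightarrow> card {x \<in> H. c0 x = \<gamma>} = l"
      "\<And>x. c0 (- x) = c0 x"
  shows "\<exists>C :: 'p \<Rightarrow> 'p \<Rightarrow> 'b. (\<forall>x y. x\<^sup>2 \<noteq> y\<^sup>2 \<longrightarrow> C x y \<in> R \<and> C y x = C x y \<and> C (- x) (- y) = C x y) \<and>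
    (\<forall>x. x \<noteq> 0 \<longrightarrow> C x 0 = c0 x) \<and>
    (\<forall>g \<gamma>. g \<noteq> 0 \<longrightarrow> \<gamma> \<in> R \<longrightarrow> card {(x, y). x\<^sup>2 - y\<^sup>2 = g \<and> C x y = \<gamma>} = 2 * l)"
proof -
  define E where "E = half_square_diffs H"
  have "\<forall>g. \<exists>c. g \<noteq> 0 \<longrightarrow> (\<forall>a\<in>E g. c a \<in> R) \<and>
      (\<forall>x y. (x, y) \<in> E g \<longrightarrow> x = 0 \<or> y = 0 \<longrightarrow> c (x, y) = c0 (x + y)) \<and>
      (\<forall>\<gamma>\<in>R. card {a \<in> E g. c a = \<gamma>} = l)" (is "\<forall>g. \<exists>c. ?P g c")
    unfolding E_def using exists_half_coloring[OF two H R c0(1,2)] by blast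
  from choice[OF this] obtain c where cP: "\<forall>g. ?P g (c g)" by blast
  have c: "\<And>g a. g \<noteq> 0 \<Longrightarrow> a \<in> E g \<Longrightarrow> c g a \<in> R"
    "\<And>g x y. g \<noteq> 0 \<Longrightarrow> (x, y) \<in> E g \<Longrightarrow> x = 0 \<or> y = 0 \<Longrightarrow> c g (x, y) = c0 (x + y)"
    "\<And>g \<gamma>. g \<noteq> 0 \<Longrightarrow> \<gamma> \<in> R \<Longrightarrow> card {a \<in> E g. c g a = \<gamma>} = l"
    using cP by blast+
  have E_eq: "x\<^sup>2 - y\<^sup>2 = g" if "(x, y) \<in> E g" for x y g
    using that by (simp add: E_def half_square_diffs_def square_diffs_def)
  define D where "D = (\<lambda>x y. let g = x\<^sup>2 - y\<^sup>2 in if (x, y) \<in> E g then c g (x, y) else c g (- x, - y))"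
  define C where "C = (\<lambda>x y. if x\<^sup>2 - y\<^sup>2 \<in> H then D x y else D y x)"
  have E_neg: "(- x, - y) \<in> E g \<longleftrightarrow> (x, y) \<notin> E g" if "x\<^sup>2 - y\<^sup>2 = g" "g \<noteq> 0" for x y g
    unfolding E_def by (rule neg_mem_half_square_diffs_iff[OF H that])
  have D_neg: "D (- x) (- y) = D x y" if "x\<^sup>2 \<noteq> y\<^sup>2" for x y
    using E_neg[of x y "x\<^sup>2 - y\<^sup>2"] that by (simp add: D_def Let_def)
  have D_R: "D x y \<in> R" if "x\<^sup>2 \<noteq> y\<^sup>2" for x y
    using E_neg[of x y "x\<^sup>2 - y\<^sup>2"] that c(1) by (auto simp: D_def Let_def)
  have D_0: "D x 0 = c0 x" "D 0 x = c0 x" if x: "x \<noteq> 0" for x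
    using E_neg[of x 0 "x\<^sup>2"] E_neg[of 0 x "- (x\<^sup>2)"] x c(2)[of "x\<^sup>2" x 0] c(2)[of "x\<^sup>2" "- x" 0]
      c(2)[of "- (x\<^sup>2)" 0 x] c(2)[of "- (x\<^sup>2)" 0 "- x"] c0(3)
    by (auto simp: D_def Let_def)
  have D_card: "card {(x, y). x\<^sup>2 - y\<^sup>2 = g \<and> D x y = \<gamma>} = 2 * l" if g: "g \<noteq> 0" and \<gamma>: "\<gamma> \<in> R" for g \<gamma>
  proof -
    let ?A = "{a \<in> E g. c g a = \<gamma>}"
    have DE: "D x y = c g (x, y)" if "(x, y) \<in> E g" for x y
      using that E_eq[OF that] by (simp add: D_def Let_def)
    have eq: "{(x, y). x\<^sup>2 - y\<^sup>2 = g \<and> D x y = \<gamma>} = ?A \<union> uminus ` ?A"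
    proof (intro equalityI subsetI)
      fix a assume "a \<in> {(x, y). x\<^sup>2 - y\<^sup>2 = g \<and> D x y = \<gamma>}"
      then obtain x y where a: "a = (x, y)" "x\<^sup>2 - y\<^sup>2 = g" "D x y = \<gamma>" by auto
      show "a \<in> ?A \<union> uminus ` ?A"
      proof (cases "(x, y) \<in> E g")
        case False
        then have "(- x, - y) \<in> E g" using E_neg[OF a(2) g] by simp
        moreover have "D (- x) (- y) = \<gamma>" using D_neg[of x y] a g by auto
        ultimately have "(- x, - y) \<in> ?A" using DE by simp
        then have "- (- x, - y) \<in> uminus ` ?A" by (rule imageI)
        then show ?thesis by (simp add: a)
      qed (use a DE in simp)
    next
      fix a assume "a \<in> ?A \<union> uminus ` ?A"
      then obtain b where b: "b \<in> ?A" "a = b \<or> a = - b" by blast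
      obtain x y where "b = (x, y)" by (cases b)
      with b have xy: "(x, y) \<in> ?A" "a = (x, y) \<or> a = (- x, - y)" by simp_all
      then have "x\<^sup>2 - y\<^sup>2 = g" "D x y = \<gamma>" using DE E_eq by auto
      moreover have "D (- x) (- y) = D x y" using D_neg[of x y] g calculation(1) by auto
      ultimately show "a \<in> {(x, y). x\<^sup>2 - y\<^sup>2 = g \<and> D x y = \<gamma>}" using xy(2) by auto
    qed
    have "?A \<inter> uminus ` ?A = {}"
    proof -
      have "- a \<notin> E g" if "a \<in> E g" for a
        using that E_neg[OF E_eq g] by (cases a) auto
      then show ?thesis by auto
    qed
    moreover have "card (uminus ` ?A) = card ?A" by (intro card_image) (auto simp: inj_on_def)
    ultimately show ?thesis unfolding eq using c(3)[OF g \<gamma>] by (simp add: card_Un_disjoint)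
  qed
  have sgn: "- g \<in> H \<longleftrightarrow> g \<notin> H" if "g \<noteq> 0" for g using H(2)[OF that] .
  have C_sym: "C y x = C x y" if "x\<^sup>2 \<noteq> y\<^sup>2" for x y
    using sgn[of "x\<^sup>2 - y\<^sup>2"] that by (auto simp: C_def)
  have C_neg: "C (- x) (- y) = C x y" if "x\<^sup>2 \<noteq> y\<^sup>2" for x y
    using D_neg[of x y] D_neg[of y x] that by (simp add: C_def)
  have C_R: "C x y \<in> R" if "x\<^sup>2 \<noteq> y\<^sup>2" for x y
    using D_R[of x y] D_R[of y x] that by (auto simp: C_def)
  have C_0: "C x 0 = c0 x" if "x \<noteq> 0" for x using D_0[OF that] by (simp add: C_def)
  have C_card: "card {(x, y). x\<^sup>2 - y\<^sup>2 = g \<and> C x y = \<gamma>} = 2 * l" if g: "g \<noteq> 0" and \<gamma>: "\<gamma> \<in> R" for g \<gamma>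
  proof (cases "g \<in> H")
    case True
    then have "{(x, y). x\<^sup>2 - y\<^sup>2 = g \<and> C x y = \<gamma>} = {(x, y). x\<^sup>2 - y\<^sup>2 = g \<and> D x y = \<gamma>}"
      by (auto simp: C_def)
    then show ?thesis using D_card[OF g \<gamma>] by simp
  next
    case False
    have "{(x, y). x\<^sup>2 - y\<^sup>2 = g \<and> C x y = \<gamma>} = {(x, y). x\<^sup>2 - y\<^sup>2 = g \<and> D y x = \<gamma>}"
      using False by (auto simp: C_def)
    also have "\<dots> = {(x, y). y\<^sup>2 - x\<^sup>2 = - g \<and> D y x = \<gamma>}"
    proof -
      have "x\<^sup>2 - y\<^sup>2 = g \<longleftrightarrow> y\<^sup>2 - x\<^sup>2 = - g" for x y by (metis minus_diff_eq minus_minus)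
      then show ?thesis by simp
    qed
    also have "\<dots> = prod.swap ` {(x, y). x\<^sup>2 - y\<^sup>2 = - g \<and> D x y = \<gamma>}"
      by (auto simp: image_iff)
    finally have "card {(x, y). x\<^sup>2 - y\<^sup>2 = g \<and> C x y = \<gamma>} = card {(x, y). x\<^sup>2 - y\<^sup>2 = - g \<and> D x y = \<gamma>}"
      by (simp add: card_image)
    then show ?thesis using D_card[of "- g" \<gamma>] g \<gamma> by simp
  qed
  show ?thesis
    using C_sym C_neg C_R C_0 C_card by (intro exI[of _ C]) blast
qed


section \<open>Odd functions with prescribed classes of differences\<close>

lemma card_roots_of_unity_base:
  assumes q: "q = card (UNIV :: 'a::{field,finite} set)" "primepow q" and du: "d * u = q - 1"
  shows "card {\<gamma> :: 'a. \<gamma> ^ d = 1} = d"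
proof -
  have q1: "q > 1" using q by (simp add: primepow_gt_Suc_0)
  have d0: "of_nat d \<noteq> (0 :: 'a alg_closure)"
    by (rule of_nat_neq_0_if_dvd[OF q], unfold du[symmetric]) (rule dvd_triv_left)
  have "{b :: 'a alg_closure. b ^ d = 1} = to_ac ` {\<gamma> :: 'a. \<gamma> ^ d = 1}"
  proof (intro equalityI subsetI)
    fix b :: "'a alg_closure" assume "b \<in> {b. b ^ d = 1}"
    then have b: "b ^ d = 1" by simp
    have "q = Suc (d * u)" using du q1 by simp
    then have "b ^ q = b * (b ^ d) ^ u" by (simp add: power_mult)
    then have "b ^ q = b" using b by simp
    then obtain \<gamma> where \<gamma>: "b = to_ac \<gamma>" using frobenius_fixed_imp_base[OF q] by blast
    then have "to_ac (\<gamma> ^ d) = to_ac 1" using b by simp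
    then show "b \<in> to_ac ` {\<gamma> :: 'a. \<gamma> ^ d = 1}" unfolding to_ac_eq_iff using \<gamma> by blast
  qed (auto simp flip: to_ac_power)
  then have "d = card (to_ac ` {\<gamma> :: 'a. \<gamma> ^ d = 1})" using card_roots_of_unity[OF d0] by simp
  also have "\<dots> = card {\<gamma> :: 'a. \<gamma> ^ d = 1}"
    by (intro card_image inj_on_subset[OF inj_to_ac]) simp
  finally show ?thesis by simp
qed

text \<open>The arguments are added in pairs \<plusminus>x. The value v at x has one condition for
  each earlier argument, and the conditions on -v follow from oddness, even u and the symmetries of
  C. Between x and -x nothing is required, as their squares agree.\<close>

lemma exists_odd_function_prescribed:
  fixes H :: "'p::{field,finite} set" and C :: "'p \<Rightarrow> 'p \<Rightarrow> 'q::{field,finite}"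
  assumes two: "(2 :: 'p) \<noteq> 0" "(2 :: 'q) \<noteq> 0"
    and H: "0 \<notin> H" "\<And>x. x \<noteq> 0 \<Longrightarrow> (- x \<in> H \<longleftrightarrow> x \<notin> H)"
    and C: "\<And>x y. x\<^sup>2 \<noteq> y\<^sup>2 \<Longrightarrow> C x y ^ d = 1 \<and> C y x = C x y \<and> C (- x) (- y) = C x y"
    and q: "q = card (UNIV :: 'q set)" "primepow q" and ud: "d * u = q - 1" and even_u: "even u"
    and large: "real q > Q_bound d (card (UNIV :: 'p set) - 2)"
    and T: "T \<subseteq> H"
  shows "\<exists>F :: 'p \<Rightarrow> 'q. (\<forall>z. F (- z) = - F z) \<and>
    (\<forall>x\<in>insert 0 (T \<union> uminus ` T). \<forall>y\<in>insert 0 (T \<union> uminus ` T). x\<^sup>2 \<noteq> y\<^sup>2 \<longrightarrow> (F x - F y) ^ u = C x y)"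
proof -
  have "finite T" by simp
  then show ?thesis using T
  proof (induction T rule: finite_induct)
    case empty
    show ?case by (intro exI[of _ "\<lambda>_. 0"]) auto
  next
    case (insert x T)
    obtain W :: "'q alg_closure \<Rightarrow> complex" where "residue_character q d u W"
      using exists_residue_character[OF q ud] by blast
    then interpret residue_character q d u W .
    let ?J = "insert 0 (T \<union> uminus ` T)"
    have "T \<subseteq> H" using insert.prems by simp
    from insert.IH[OF this] obtain F :: "'p \<Rightarrow> 'q" where odd': "\<forall>z. F (- z) = - F z"
      and F': "\<forall>x\<in>?J. \<forall>y\<in>?J. x\<^sup>2 \<noteq> y\<^sup>2 \<longrightarrow> (F x - F y) ^ u = C x y" by blast
    have odd: "F (- z) = - F z" for z using odd' by blast
    have F: "(F x - F y) ^ u = C x y" if "x \<in> ?J" "y \<in> ?J" "x\<^sup>2 \<noteq> y\<^sup>2" for x y using F' that by blast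
    have "x \<in> H" "x \<noteq> 0" using insert.prems H(1) by auto
    then have x: "x \<in> H" "x \<noteq> 0" "- x \<noteq> x" "T \<subseteq> H"
      using neg_neq_self[OF two(1), of x] \<open>T \<subseteq> H\<close> by simp_all
    have F0: "F 0 = 0"
    proof -
      have "F 0 = - F 0" using odd[of 0] unfolding minus_zero .
      then show ?thesis using neg_neq_self[OF two(2), of "F 0"] by metis
    qed
    have J_neg: "- z \<in> ?J" if "z \<in> ?J" for z using that by auto
    have neg_u: "(- a) ^ u = a ^ u" for a :: 'q using even_u by simp
    have nz: "F z \<noteq> F w" if "z \<in> ?J" "w \<in> ?J" "z\<^sup>2 \<noteq> w\<^sup>2" for z w
    proof
      assume "F z = F w"
      then have "C z w = 0" using F[OF that] u_pos by (simp add: power_0_left)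
      then show False using C[OF that(3)] d_pos by (simp add: power_0_left)
    qed
    \<comment> \<open>The conditions sit at the points t = F z, so distinct z must give distinct t.
      A nonzero class separates z from w if z^2 \<noteq> w^2; z and -z are separated because F z
      \<noteq> F 0 = 0.\<close>
    have inj: "inj_on F ?J"
    proof (rule inj_onI, rule ccontr)
      fix z w assume zw: "z \<in> ?J" "w \<in> ?J" "F z = F w" "z \<noteq> w"
      then have "z\<^sup>2 = w\<^sup>2" using nz by blast
      then have w: "w = - z" "z \<noteq> 0" using zw(4) by (auto simp: power2_eq_iff)
      then have "F z = - F z" using zw(3) odd[of z] by metis
      then have "F z = F 0" unfolding F0 using neg_neq_self[OF two(2), of "F z"] by metis
      then show False using nz[of z 0] zw(1) w(2) by simp
    qed
    have xJ: "x\<^sup>2 \<noteq> z\<^sup>2" "z \<noteq> x" "z \<noteq> - x" if "z \<in> ?J" for z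
    proof -
      have "x \<notin> ?J"
        using x insert.hyps H(2)[OF x(2)] by auto
      then have "z \<noteq> x \<and> z \<noteq> - x" using that J_neg[OF that] by auto
      then show "x\<^sup>2 \<noteq> z\<^sup>2" "z \<noteq> x" "z \<noteq> - x" by (auto simp: power2_eq_iff)
    qed
    \<comment> \<open>\<open>?J\<close> has at most 2 card T + 1 elements, and x leaves T at most
      card H - 1 elements; so the bound is 2 card H - 1 = p - 2.\<close>
    have cardJ: "card (F ` ?J) \<le> card (UNIV :: 'p set) - 2"
    proof -
      have "card (F ` ?J) \<le> card ?J" by (rule card_image_le) simp
      also have "\<dots> \<le> Suc (card T + card (uminus ` T))"
        by (intro order.trans[OF card_insert_le_m1] Suc_leI) (auto intro: le_imp_less_Suc card_Un_le)
      also have "card (uminus ` T) \<le> card T" by (rule card_image_le) simp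
      finally have "card (F ` ?J) \<le> Suc (2 * card T)" by simp
      moreover have "Suc (card T) \<le> card H"
        using card_mono[of H "insert x T"] insert.hyps insert.prems by simp
      ultimately show ?thesis using card_half_system[OF H] by simp
    qed
    have "\<exists>v. \<forall>t\<in>F ` ?J. (t - v) ^ u = C x (inv_into ?J F t)"
    proof (rule exists_prescribed_residues[OF _ cardJ _ large])
      fix t assume "t \<in> F ` ?J"
      then have "inv_into ?J F t \<in> ?J" by (rule inv_into_into)
      then show "C x (inv_into ?J F t) ^ d = 1" using C[OF xJ(1)] by blast
    qed simp
    then obtain v where "\<And>t. t \<in> F ` ?J \<Longrightarrow> (t - v) ^ u = C x (inv_into ?J F t)" by blast
    then have v: "(F z - v) ^ u = C x z" if "z \<in> ?J" for z using that inv_into_f_f[OF inj that] by force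
    have v1: "(v - F z) ^ u = C x z" if "z \<in> ?J" for z
      using v[OF that] neg_u[of "v - F z"] by simp
    have v2: "(- v - F z) ^ u = C (- x) z" "(F z - (- v)) ^ u = C (- x) z" if "z \<in> ?J" for z
    proof -
      have "(F z - (- v)) ^ u = (v - F (- z)) ^ u" by (simp add: odd add.commute)
      also have "\<dots> = C x (- z)" by (rule v1[OF J_neg[OF that]])
      also have "\<dots> = C (- x) z" using C[of x "- z"] xJ(1)[OF that] by simp
      finally show "(F z - (- v)) ^ u = C (- x) z" .
      moreover have "- v - F z = - (F z - (- v))" by simp
      ultimately show "(- v - F z) ^ u = C (- x) z" by (simp only: neg_u)
    qed
    define G where "G = F(x := v, - x := - v)"
    have GJ: "G z = F z" if "z \<in> ?J" for z using xJ[OF that] by (simp add: G_def)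
    have Gx: "G x = v" "G (- x) = - v" using x(3) by (auto simp: G_def)
    have "G (- z) = - G z" for z
    proof -
      consider "z = x" | "z = - x" | "z \<noteq> x" "z \<noteq> - x" by blast
      then show ?thesis
      proof cases
        case 3
        then have "- z \<noteq> x" "- z \<noteq> - x" by (metis minus_minus)+
        with 3 show ?thesis using odd[of z] by (simp add: G_def)
      qed (simp_all add: Gx)
    qed
    moreover have "(G y - G z) ^ u = C y z"
      if yz: "y \<in> insert 0 (insert x T \<union> uminus ` insert x T)" "z \<in> insert 0 (insert x T \<union> uminus ` insert x T)"
        and ne: "y\<^sup>2 \<noteq> z\<^sup>2" for y z
    proof -
      have cy: "y \<in> ?J \<or> y = x \<or> y = - x" and cz: "z \<in> ?J \<or> z = x \<or> z = - x" using yz by auto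
      show ?thesis
      proof (cases "y \<in> ?J")
        case yJ: True
        show ?thesis
        proof (cases "z \<in> ?J")
          case True
          then show ?thesis using F[OF yJ True ne] by (simp only: GJ[OF yJ] GJ[OF True])
        next
          case False
          then show ?thesis using cz v[OF yJ] v2(2)[OF yJ] C[OF ne] by (auto simp only: GJ[OF yJ] Gx)
        qed
      next
        case False
        then have y: "y = x \<or> y = - x" using cy by blast
        then have zJ: "z \<in> ?J" using cz ne by auto
        show ?thesis using y v1[OF zJ] v2(1)[OF zJ] by (auto simp only: GJ[OF zJ] Gx)
      qed
    qed
    ultimately show ?case by blast
  qed
qed

subsection \<open>The difference family\<close>

text \<open>For g \<noteq> 0 this is the balance of C. For g = 0 the pairs are (x, -x), and F x - F
  (-x) = 2 F x has class 2^u \<open>c0 x\<close>; multiplication by 2^u permutes the classes, so the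
  balance of \<open>c0\<close> suffices.\<close>

lemma exists_balanced_odd_function:
  fixes p q l d :: nat
  assumes two: "(2 :: 'p::{field,finite}) \<noteq> 0" "(2 :: 'q::{field,finite}) \<noteq> 0"
    and p: "card (UNIV :: 'p set) = 2 * l * d + 1"
    and q: "q = card (UNIV :: 'q set)" "primepow q" and ud: "d * u = q - 1" and even_u: "even u"
    and large: "real q > Q_bound d (card (UNIV :: 'p set) - 2)"
  shows "\<exists>F :: 'p \<Rightarrow> 'q. (\<forall>z. F (- z) = - F z) \<and> inj F \<and>
    (\<forall>g \<gamma>. \<gamma> ^ d = 1 \<longrightarrow> card {(x, y). x \<noteq> y \<and> x\<^sup>2 - y\<^sup>2 = g \<and> (F x - F y) ^ u = \<gamma>} = 2 * l)"
proof -
  define R where "R = {\<gamma> :: 'q. \<gamma> ^ d = 1}"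
  have q1: "q > 1" using q by (simp add: primepow_gt_Suc_0)
  then have d0: "d > 0" and u0: "u > 0" using ud by (cases d; cases u; auto)+
  have finR: "finite R" by simp
  have cardR: "card R = d" unfolding R_def by (rule card_roots_of_unity_base[OF q ud])
  obtain H :: "'p set" where H: "0 \<notin> H" and Hs: "\<And>x. x \<noteq> 0 \<Longrightarrow> (- x \<in> H \<longleftrightarrow> x \<notin> H)"
    using exists_half_system[OF two(1)] by blast
  have cardH: "card H = l * card R" using card_half_system[OF H Hs] p cardR by simp
  \<comment> \<open>Extending the empty colouring yields an arbitrary balanced one.\<close>
  have "\<exists>c. (\<forall>x\<in>H. c x \<in> R) \<and> (\<forall>x\<in>{}. c x = undefined) \<and> (\<forall>\<gamma>\<in>R. card {x \<in> H. c x = \<gamma>} = l)"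
    by (rule balanced_extension[OF _ finR cardH]) simp_all
  then obtain b where b: "\<forall>x\<in>H. b x \<in> R" "\<forall>\<gamma>\<in>R. card {x \<in> H. b x = \<gamma>} = l" by blast
  define c0 where "c0 = (\<lambda>x. if x \<in> H then b x else b (- x))"
  have c0: "c0 x \<in> R" if "x \<in> H" for x using b(1) that by (simp add: c0_def)
  have c0_card: "card {x \<in> H. c0 x = \<gamma>} = l" if "\<gamma> \<in> R" for \<gamma>
  proof -
    have "{x \<in> H. c0 x = \<gamma>} = {x \<in> H. b x = \<gamma>}" by (auto simp: c0_def)
    then show ?thesis using b(2) that by simp
  qed
  have c0_neg: "c0 (- x) = c0 x" for x
    using Hs[of x] by (cases "x = 0") (auto simp: c0_def)
  obtain C :: "'p \<Rightarrow> 'p \<Rightarrow> 'q" where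
    C: "\<And>x y. x\<^sup>2 \<noteq> y\<^sup>2 \<Longrightarrow> C x y \<in> R \<and> C y x = C x y \<and> C (- x) (- y) = C x y"
    and C0: "\<And>x. x \<noteq> 0 \<Longrightarrow> C x 0 = c0 x"
    and C_card: "\<And>g \<gamma>. g \<noteq> 0 \<Longrightarrow> \<gamma> \<in> R \<Longrightarrow> card {(x, y). x\<^sup>2 - y\<^sup>2 = g \<and> C x y = \<gamma>} = 2 * l"
    using exists_symmetric_coloring[OF two(1) H Hs finR cardH c0 c0_card c0_neg] by blast
  have C': "C x y ^ d = 1 \<and> C y x = C x y \<and> C (- x) (- y) = C x y" if "x\<^sup>2 \<noteq> y\<^sup>2" for x y
    using C[OF that] by (simp add: R_def)
  have J: "insert 0 (H \<union> uminus ` H) = UNIV"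
  proof (intro equalityI subsetI)
    fix x :: 'p
    show "x \<in> insert 0 (H \<union> uminus ` H)"
    proof (cases "x = 0 \<or> x \<in> H")
      case False
      then have "- (- x) \<in> uminus ` H" using Hs[of x] by blast
      then show ?thesis by simp
    qed auto
  qed simp
  obtain F :: "'p \<Rightarrow> 'q" where odd: "\<And>z. F (- z) = - F z"
    and F: "\<And>x y. x\<^sup>2 \<noteq> y\<^sup>2 \<Longrightarrow> (F x - F y) ^ u = C x y"
    using exists_odd_function_prescribed[where C = C and T = H, OF two H Hs C' q ud even_u large subset_refl]
    unfolding J by blast
  have "F 0 = - F 0" using odd[of 0] unfolding minus_zero .
  then have F0: "F 0 = 0" using neg_neq_self[OF two(2), of "F 0"] by metis
  have Fx: "F x ^ u = c0 x" if "x \<noteq> 0" for x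
    using F[of x 0] C0[OF that] that by (simp add: F0)
  have C_nz: "C x y \<noteq> 0" if "x\<^sup>2 \<noteq> y\<^sup>2" for x y
    using C'[OF that] d0 by (auto simp: power_0_left)
  have sq_ne: "F x \<noteq> F y" if "x\<^sup>2 \<noteq> y\<^sup>2" for x y
    using F[OF that] C_nz[OF that] u0 by (auto simp: power_0_left)
  have F_ne: "F x \<noteq> F y" if "x \<noteq> y" for x y
  proof (cases "x\<^sup>2 = y\<^sup>2")
    case True
    then have y: "y = - x" "x \<noteq> 0" using that by (auto simp: power2_eq_iff)
    have "F x \<noteq> F 0" using sq_ne[of x 0] y(2) by simp
    then show ?thesis using neg_neq_self[OF two(2), of "F x"] by (simp add: y(1) odd F0)
  qed (use sq_ne in blast)
  have card_c0: "card {x. x \<noteq> 0 \<and> c0 x = \<gamma>} = 2 * l" if "\<gamma> \<in> R" for \<gamma>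
  proof -
    let ?A = "{x \<in> H. c0 x = \<gamma>}"
    have eq: "{x. x \<noteq> 0 \<and> c0 x = \<gamma>} = ?A \<union> uminus ` ?A"
    proof (intro equalityI subsetI)
      fix x assume x: "x \<in> {x. x \<noteq> 0 \<and> c0 x = \<gamma>}"
      show "x \<in> ?A \<union> uminus ` ?A"
      proof (cases "x \<in> H")
        case False
        then have "- x \<in> ?A" using x Hs[of x] by (simp add: c0_neg)
        then have "- (- x) \<in> uminus ` ?A" by (rule imageI)
        then show ?thesis by simp
      qed (use x in simp)
    qed (use H in \<open>auto simp: c0_neg\<close>)
    have "- x \<notin> H" if "x \<in> H" for x using Hs[of x] H that by metis
    then have "?A \<inter> uminus ` ?A = {}" by auto
    moreover have "card (uminus ` ?A) = card ?A" by (intro card_image) (auto simp: inj_on_def)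
    ultimately show ?thesis unfolding eq using c0_card[OF that] by (simp add: card_Un_disjoint)
  qed
  have "card {(x, y). x \<noteq> y \<and> x\<^sup>2 - y\<^sup>2 = g \<and> (F x - F y) ^ u = \<gamma>} = 2 * l" if \<gamma>: "\<gamma> ^ d = 1" for g \<gamma>
  proof (cases "g = 0")
    case False
    then have "{(x, y). x \<noteq> y \<and> x\<^sup>2 - y\<^sup>2 = g \<and> (F x - F y) ^ u = \<gamma>} = {(x, y). x\<^sup>2 - y\<^sup>2 = g \<and> C x y = \<gamma>}"
      using F by auto
    then show ?thesis using C_card[OF False, of \<gamma>] \<gamma> by (simp add: R_def)
  next
    case True
    have two_d: "((2 :: 'q) ^ u) ^ d = 1"
      using power_card_minus_1_eq_1[OF two(2)] ud q(1) by (simp add: mult.commute flip: power_mult)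
    have "{(x, y). x \<noteq> y \<and> x\<^sup>2 - y\<^sup>2 = g \<and> (F x - F y) ^ u = \<gamma>} = (\<lambda>x. (x, - x)) ` {x. x \<noteq> 0 \<and> c0 x = \<gamma> / 2 ^ u}"
    proof (intro equalityI subsetI)
      fix a assume "a \<in> {(x, y). x \<noteq> y \<and> x\<^sup>2 - y\<^sup>2 = g \<and> (F x - F y) ^ u = \<gamma>}"
      then obtain x y where a: "a = (x, y)" "x \<noteq> y" "x\<^sup>2 = y\<^sup>2" "(F x - F y) ^ u = \<gamma>" using True by auto
      then have y: "y = - x" "x \<noteq> 0" by (auto simp: power2_eq_iff)
      have "F x - F y = 2 * F x" by (simp add: y(1) odd)
      then have "\<gamma> = (2 * F x) ^ u" using a(4) by metis
      then have "\<gamma> = 2 ^ u * c0 x" by (simp only: power_mult_distrib Fx[OF y(2)])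
      then have "c0 x = \<gamma> / 2 ^ u" using two(2) by simp
      then show "a \<in> (\<lambda>x. (x, - x)) ` {x. x \<noteq> 0 \<and> c0 x = \<gamma> / 2 ^ u}" using a(1) y by blast
    next
      fix a assume "a \<in> (\<lambda>x. (x, - x)) ` {x. x \<noteq> 0 \<and> c0 x = \<gamma> / 2 ^ u}"
      then obtain x where x: "a = (x, - x)" "x \<noteq> 0" "c0 x = \<gamma> / 2 ^ u" by blast
      have "(F x - F (- x)) ^ u = (2 * F x) ^ u" by (simp add: odd)
      also have "\<dots> = \<gamma>" using two(2) by (simp add: power_mult_distrib Fx[OF x(2)] x(3))
      finally show "a \<in> {(x, y). x \<noteq> y \<and> x\<^sup>2 - y\<^sup>2 = g \<and> (F x - F y) ^ u = \<gamma>}"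
        using x(1) neg_neq_self[OF two(1) x(2)] True by auto
    qed
    then have "card {(x, y). x \<noteq> y \<and> x\<^sup>2 - y\<^sup>2 = g \<and> (F x - F y) ^ u = \<gamma>} = card {x. x \<noteq> 0 \<and> c0 x = \<gamma> / 2 ^ u}"
      by (simp add: card_image inj_on_def)
    also have "\<dots> = 2 * l" by (rule card_c0) (simp add: R_def power_divide \<gamma> two_d)
    finally show ?thesis .
  qed
  moreover have "inj F" using F_ne by (auto simp: inj_on_def)
  ultimately show ?thesis using odd by blast
qed

section \<open>From the balanced odd function to the blocks\<close>

lemma count_differences:
  assumes "finite B"
  shows "count (differences B) e = card {(x, y). x \<in> B \<and> y \<in> B \<and> x \<noteq> y \<and> x - y = e}"
proof -
  have fin: "finite {(x, y). x \<in> B \<and> y \<in> B \<and> x \<noteq> y}"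
    by (rule finite_subset[of _ "B \<times> B"]) (use assms in auto)
  have "count (differences B) e = card {a \<in> {(x, y). x \<in> B \<and> y \<in> B \<and> x \<noteq> y}. (case a of (x, y) \<Rightarrow> x - y) = e}"
    unfolding differences_def using fin by (simp add: count_image_mset' Collect_conj_eq) (rule arg_cong[of _ _ card], auto)
  also have "{a \<in> {(x, y). x \<in> B \<and> y \<in> B \<and> x \<noteq> y}. (case a of (x, y) \<Rightarrow> x - y) = e} =
      {(x, y). x \<in> B \<and> y \<in> B \<and> x \<noteq> y \<and> x - y = e}" by auto
  finally show ?thesis .
qed

lemma count_differences_graph:
  fixes F :: "'p::{field,finite} \<Rightarrow> 'q::{field,finite}"
  assumes inj: "inj F" and "s \<noteq> 0"
  shows "count (differences (range (\<lambda>x. (x\<^sup>2, s * F x)))) (g, w) =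
    card {(x, y). x \<noteq> y \<and> x\<^sup>2 - y\<^sup>2 = g \<and> s * (F x - F y) = w}"
proof -
  let ?b = "\<lambda>x. (x\<^sup>2, s * F x)"
  have b: "?b x = ?b y \<longleftrightarrow> x = y" for x y using \<open>s \<noteq> 0\<close> inj by (auto simp: inj_def)
  have "{(a, a'). a \<in> range ?b \<and> a' \<in> range ?b \<and> a \<noteq> a' \<and> a - a' = (g, w)} =
      (\<lambda>(x, y). (?b x, ?b y)) ` {(x, y). x \<noteq> y \<and> x\<^sup>2 - y\<^sup>2 = g \<and> s * (F x - F y) = w}" (is "?L = ?f ` ?R")
  proof (intro equalityI subsetI)
    fix e assume "e \<in> ?L"
    moreover obtain a a' where e: "e = (a, a')" by (cases e)
    ultimately have *: "a \<in> range ?b" "a' \<in> range ?b" "a \<noteq> a'" "a - a' = (g, w)" by simp_all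
    from *(1,2) obtain x y where xy: "a = ?b x" "a' = ?b y" by blast
    have "x \<noteq> y" using *(3) xy by blast
    then have "e = ?f (x, y)" "(x, y) \<in> ?R" using *(4) by (simp_all add: e xy right_diff_distrib)
    then show "e \<in> ?f ` ?R" by (rule image_eqI)
  next
    fix e assume "e \<in> ?f ` ?R"
    then obtain x y where e: "e = (?b x, ?b y)" "x \<noteq> y" "x\<^sup>2 - y\<^sup>2 = g" "s * (F x - F y) = w" by auto
    then have "?b x \<noteq> ?b y" using b by blast
    then show "e \<in> ?L" using e by (auto simp: right_diff_distrib)
  qed
  moreover have "inj_on ?f ?R" using b by (auto simp: inj_on_def)
  ultimately show ?thesis by (simp only: count_differences[OF finite_imageI[OF finite]] card_image)
qed

text \<open>For w \<noteq> 0 and x \<noteq> y the equation s (F x - F y) = w has exactly one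
  solution s, which lies in \<open>K\<close> exactly when F x - F y has the class of w. So
  \<open>K\<close> accounts for 2 l differences. Negating x and y exchanges s and -s, hence the half
  \<open>S\<close> accounts for l. Injectivity of F excludes w = 0.\<close>

lemma relative_difference_family_graphs:
  fixes F :: "'p::{field,finite} \<Rightarrow> 'q::{field,finite}"
  assumes two: "(2 :: 'q) \<noteq> 0" and even_u: "even u" and u: "u > 0"
    and odd: "\<And>z. F (- z) = - F z" and inj: "inj F"
    and w_u: "\<And>w :: 'q. w \<noteq> 0 \<Longrightarrow> (w ^ u) ^ d = 1"
    and bal: "\<And>g \<gamma>. \<gamma> ^ d = 1 \<Longrightarrow> card {(x, y). x \<noteq> y \<and> x\<^sup>2 - y\<^sup>2 = g \<and> (F x - F y) ^ u = \<gamma>} = 2 * l"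
  shows "\<exists>Bs. relative_difference_family (UNIV \<times> UNIV :: ('p \<times> 'q) set) (UNIV \<times> {0}) (card (UNIV :: 'p set)) l Bs"
proof -
  obtain H :: "'q set" where H: "0 \<notin> H" and Hs: "\<And>x. x \<noteq> 0 \<Longrightarrow> (- x \<in> H \<longleftrightarrow> x \<notin> H)"
    using exists_half_system[OF two] by blast
  define K where "K = {s :: 'q. s ^ u = 1}"
  define S where "S = K \<inter> H"
  define B where "B = (\<lambda>s. range (\<lambda>x :: 'p. (x\<^sup>2, s * F x)))"
  define N where "N = (\<lambda>g w s. card {(x, y). x \<noteq> y \<and> x\<^sup>2 - y\<^sup>2 = g \<and> s * (F x - F y) = w})"
  have K0: "s \<noteq> 0" if "s \<in> K" for s using that u by (auto simp: K_def power_0_left)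
  have S0: "s \<noteq> 0" if "s \<in> S" for s using that K0 by (simp add: S_def)
  have neg_u: "(- a) ^ u = a ^ u" for a :: 'q using even_u by simp
  have K_eq: "K = S \<union> uminus ` S"
  proof (intro equalityI subsetI)
    fix s assume s: "s \<in> K"
    show "s \<in> S \<union> uminus ` S"
    proof (cases "s \<in> H")
      case False
      then have "- s \<in> S" using s K0[OF s] Hs[of s] by (simp add: S_def K_def neg_u)
      then have "- (- s) \<in> uminus ` S" by (rule imageI)
      then show ?thesis by simp
    qed (use s in \<open>simp add: S_def\<close>)
  qed (auto simp: S_def K_def neg_u)
  have neg_H: "- s \<notin> H" if "s \<in> H" for s using Hs[of s] H that by metis
  have disj: "S \<inter> uminus ` S = {}" using neg_H by (auto simp: S_def)
  have N_neg: "N g w (- s) = N g w s" for g w s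
  proof -
    have "{(x, y). x \<noteq> y \<and> x\<^sup>2 - y\<^sup>2 = g \<and> - s * (F x - F y) = w} =
        uminus ` {(x, y). x \<noteq> y \<and> x\<^sup>2 - y\<^sup>2 = g \<and> s * (F x - F y) = w}" (is "?L = uminus ` ?R")
    proof (intro equalityI subsetI)
      fix a assume "a \<in> ?L"
      then obtain x y where "a = (x, y)" "x \<noteq> y" "x\<^sup>2 - y\<^sup>2 = g" "- s * (F x - F y) = w" by auto
      then have "- a \<in> ?R" by (simp add: odd algebra_simps)
      then have "- (- a) \<in> uminus ` ?R" by (rule imageI)
      then show "a \<in> uminus ` ?R" by simp
    next
      fix a assume "a \<in> uminus ` ?R"
      then show "a \<in> ?L" by (auto simp: odd algebra_simps)
    qed
    then show ?thesis unfolding N_def by (simp add: card_image inj_on_def)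
  qed
  have count: "count (\<Sum>B\<in>#image_mset B (mset_set S). differences B) (g, w) = (\<Sum>s\<in>S. N g w s)" for g w
  proof -
    have "count (\<Sum>B\<in>#image_mset B (mset_set S). differences B) (g, w) = (\<Sum>s\<in>S. count (differences (B s)) (g, w))"
      by (simp add: sum_unfold_sum_mset[symmetric] count_sum image_mset.compositionality o_def)
    also have "\<dots> = (\<Sum>s\<in>S. N g w s)"
      unfolding B_def N_def by (intro sum.cong refl count_differences_graph inj S0)
    finally show ?thesis .
  qed
  have sum_K: "(\<Sum>s\<in>K. N g w s) = 2 * l" if w: "w \<noteq> 0" for g w
  proof -
    let ?P = "\<lambda>s. {(x, y). x \<noteq> y \<and> x\<^sup>2 - y\<^sup>2 = g \<and> s * (F x - F y) = w}"
    have "(\<Sum>s\<in>K. N g w s) = card (\<Union>s\<in>K. ?P s)"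
      unfolding N_def
    proof (rule card_UN_disjoint[symmetric])
      show "\<forall>s\<in>K. \<forall>s'\<in>K. s \<noteq> s' \<longrightarrow> ?P s \<inter> ?P s' = {}" using w by auto
    qed auto
    also have "(\<Union>s\<in>K. ?P s) = {(x, y). x \<noteq> y \<and> x\<^sup>2 - y\<^sup>2 = g \<and> (F x - F y) ^ u = w ^ u}"
    proof (intro equalityI subsetI)
      fix a assume "a \<in> (\<Union>s\<in>K. ?P s)"
      then obtain s x y where a: "s \<in> K" "a = (x, y)" "x \<noteq> y" "x\<^sup>2 - y\<^sup>2 = g" "s * (F x - F y) = w" by auto
      have "w ^ u = s ^ u * (F x - F y) ^ u" by (simp add: power_mult_distrib flip: a(5))
      then show "a \<in> {(x, y). x \<noteq> y \<and> x\<^sup>2 - y\<^sup>2 = g \<and> (F x - F y) ^ u = w ^ u}" using a(1-4) by (simp add: K_def)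
    next
      fix a assume "a \<in> {(x, y). x \<noteq> y \<and> x\<^sup>2 - y\<^sup>2 = g \<and> (F x - F y) ^ u = w ^ u}"
      then obtain x y where a: "a = (x, y)" "x \<noteq> y" "x\<^sup>2 - y\<^sup>2 = g" "(F x - F y) ^ u = w ^ u" by auto
      have nz: "F x - F y \<noteq> 0" using a(2) inj by (auto simp: inj_def)
      then have "w / (F x - F y) \<in> K" using a(4) w by (simp add: K_def power_divide)
      moreover have "a \<in> ?P (w / (F x - F y))" using a nz by simp
      ultimately show "a \<in> (\<Union>s\<in>K. ?P s)" by blast
    qed
    also have "card \<dots> = 2 * l" by (rule bal[OF w_u[OF w]])
    finally show ?thesis .
  qed
  have sum_S: "(\<Sum>s\<in>S. N g w s) = l" if "w \<noteq> 0" for g w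
  proof -
    have "(\<Sum>s\<in>K. N g w s) = (\<Sum>s\<in>S. N g w s) + (\<Sum>s\<in>uminus ` S. N g w s)"
      unfolding K_eq using disj by (intro sum.union_disjoint) auto
    also have "(\<Sum>s\<in>uminus ` S. N g w s) = (\<Sum>s\<in>S. N g w s)"
      by (subst sum.reindex) (auto simp: N_neg inj_on_def)
    finally show ?thesis using sum_K[OF that, of g] by simp
  qed
  have zero: "(\<Sum>s\<in>S. N g 0 s) = 0" for g
  proof (rule sum.neutral, rule ballI)
    fix s assume "s \<in> S"
    then have "{(x, y). x \<noteq> y \<and> x\<^sup>2 - y\<^sup>2 = g \<and> s * (F x - F y) = 0} = {}" using S0 inj by (auto simp: inj_def)
    then show "N g 0 s = 0" by (simp add: N_def)
  qed
  have card_B: "card (B s) = card (UNIV :: 'p set)" if "s \<in> S" for s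
    unfolding B_def using S0[OF that] inj by (intro card_image) (auto simp: inj_on_def)
  have "relative_difference_family (UNIV \<times> UNIV :: ('p \<times> 'q) set) (UNIV \<times> {0}) (card (UNIV :: 'p set)) l
      (image_mset B (mset_set S))"
    unfolding relative_difference_family_def
  proof (intro conjI ballI)
    fix g :: "'p \<times> 'q" assume g: "g \<in> UNIV \<times> UNIV - UNIV \<times> {0}"
    obtain g1 w where gw: "g = (g1, w)" by (cases g)
    show "count (\<Sum>B\<in>#image_mset B (mset_set S). differences B) g = l"
      using g unfolding gw count by (intro sum_S) auto
  next
    fix g :: "'p \<times> 'q" assume g: "g \<in> UNIV \<times> {0}"
    then obtain g1 where gw: "g = (g1, 0)" by auto
    show "g \<notin># (\<Sum>B\<in>#image_mset B (mset_set S). differences B)"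
      unfolding gw not_in_iff count by (rule zero)
  qed (use card_B in \<open>auto simp: Defs.additive_subgroup_def zero_prod_def\<close>)
  then show ?thesis by blast
qed

theorem theorem3p15:
  fixes p q l d :: nat
  assumes "primepow p" and "odd p"
    and "l > 0" and "l dvd (p - 1) div 2"
    and "d = (p - 1) div (2 * l)"
    and "primepow q"
    and "[l * (q - 1) = 0] (mod (p - 1))"
    and "real q > Q_bound d (p - 2)"
    and "card (UNIV :: 'p::{field,finite} set) = p"
    and "card (UNIV :: 'q::{field,finite} set) = q"
  shows "\<exists>Bs. relative_difference_family (UNIV \<times> UNIV :: ('p \<times> 'q) set) (UNIV \<times> {0}) p l Bs"
proof -
  have p1: "p > 1" and q1: "q > 1" using assms(1,6) by (simp_all add: primepow_gt_Suc_0)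
  obtain m where m: "(p - 1) div 2 = l * m" using assms(4) by blast
  have "even (p - 1)" using assms(2) p1 by simp
  then have pm: "p - 1 = 2 * l * m" using m by (metis dvd_mult_div_cancel mult.assoc)
  then have d: "d = m" using assms(3,5) by simp
  have pd: "p - 1 = 2 * l * d" using pm d by simp
  have "p - 1 dvd l * (q - 1)" using assms(7) by (simp add: cong_0_iff)
  \<comment> \<open>Cancelling l gives q - 1 = d u with u = 2 k: this evenness makes -1 a d-th power
    and q odd.\<close>
  then obtain k where "l * (q - 1) = 2 * l * d * k" unfolding pd by (elim dvdE)
  then have "q - 1 = d * (2 * k)" using assms(3) by simp
  then have ud: "d * (2 * k) = q - 1" by simp
  have "2 * k > 0" using ud q1 by (cases k) auto
  have "odd q"
  proof -
    have "even (q - 1)" unfolding ud[symmetric] by simp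
    then show ?thesis using q1 by presburger
  qed
  have two: "(2 :: 'p) \<noteq> 0" "(2 :: 'q) \<noteq> 0"
    using two_neq_0_odd_card[where 'a = 'p] two_neq_0_odd_card[where 'a = 'q] assms(2,9,10) \<open>odd q\<close> by simp_all
  have cp: "card (UNIV :: 'p set) = 2 * l * d + 1" using pd p1 assms(9) by simp
  obtain F :: "'p \<Rightarrow> 'q" where F: "\<And>z. F (- z) = - F z" "inj F"
    "\<And>g \<gamma>. \<gamma> ^ d = 1 \<Longrightarrow> card {(x, y). x \<noteq> y \<and> x\<^sup>2 - y\<^sup>2 = g \<and> (F x - F y) ^ (2 * k) = \<gamma>} = 2 * l"
    using exists_balanced_odd_function[OF two cp assms(10)[symmetric] assms(6) ud] assms(8,9) by auto
  have "(w ^ (2 * k)) ^ d = 1" if "w \<noteq> 0" for w :: 'q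
    using power_card_minus_1_eq_1[OF that] unfolding assms(10) ud[symmetric]
    by (simp only: mult.commute flip: power_mult)
  then show ?thesis
    using relative_difference_family_graphs[OF two(2) _ \<open>2 * k > 0\<close> F(1,2) _ F(3)] assms(9) by auto
qed

end
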